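(* Let $W$ be a finite Coxeter group of type $A_n$ or $B_n$ and let $c$ be a bipartite Coxeter element. Then the biCambrian fan $\operatorname{\mathbf{biCamb}}(W,c)$ is a simplicial fan (equivalently, its dual polytope is simple).
   Context: $W$ acts as a reflection group on $\mathbb{R}^n$ with trivial fixed subspace; the reflecting hyperplanes cut space into cones forming the Coxeter fan, whose maximal cones are $wD$ ($w\in W$, $D$ a fixed chamber). Right weak order: $u\le w$ iff $\ell(w)=\ell(u)+\ell(u^{-1}w)$. A bipartite Coxeter element is $c=(\prod_{s\in S_+}s)(\prod_{s\in S_-}s)$ for a partition $S=S_+\sqcup S_-$ of the simple reflections with elements inside each part pairwise commuting. $c$-sortable: with a reduced word $a_1\cdots a_n$ for $c$, the $c$-sorting word of $w$ is the leftmost subword of $a_1\cdots a_na_1\cdots a_n\cdots$ that is reduced for $w$; with $K_i$ the letters from the $i$-th copy, $w$ is $c$-sortable iff $K_1\supseteq K_2\supseteq\cdots$. $\pi_\downarrow^c(w)$ is the largest $c$-sortable element below $w$. The $c$-biCambrian congruence is the equivalence relation $u\equiv v$ iff $\pi_\downarrow^c(u)=\pi_\downarrow^c(v)$ and $\pi_\downarrow^{c^{-1}}(u)=\pi_\downarrow^{c^{-1}}(v)$ (a lattice congruence of the weak order, the meet of the $c$- and $c^{-1}$-Cambrian congruences). For each class, the union of the cones $wD$ over $w$ in the class is a convex cone; these cones and their faces form a complete fan $\operatorname{\mathbf{biCamb}}(W,c)$, which is the coarsest common refinement of the $c$-Cambrian and $c^{-1}$-Cambrian fans. *)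

theory Defs
  imports "HOL-Analysis.Analysis"
begin

section \<open>Finite reflection groups, chambers and simple reflections\<close>

definition reflection :: "'a::euclidean_space \<Rightarrow> 'a \<Rightarrow> 'a" where
  "reflection a x = x - (2 * (a \<bullet> x) / (a \<bullet> a)) *\<^sub>R a"

definition hyperplane :: "'a::euclidean_space \<Rightarrow> 'a set" where
  "hyperplane a = {x. a \<bullet> x = 0}"

definition reflecting_hyperplanes :: "('a::euclidean_space \<Rightarrow> 'a) set \<Rightarrow> 'a set set" where
  "reflecting_hyperplanes W = {hyperplane a | a. a \<noteq> 0 \<and> reflection a \<in> W}"

text \<open>Chambers are closed: they are the maximal cones of the Coxeter fan.\<close>

definition chambers :: "('a::euclidean_space \<Rightarrow> 'a) set \<Rightarrow> 'a set set" where
  "chambers W = closure ` components (- \<Union> (reflecting_hyperplanes W))"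

definition simple_reflections ::
    "('a::euclidean_space \<Rightarrow> 'a) set \<Rightarrow> 'a set \<Rightarrow> ('a \<Rightarrow> 'a) set" where
  "simple_reflections W D =
     {reflection a | a. a \<noteq> 0 \<and> reflection a \<in> W \<and> (D \<inter> hyperplane a) facet_of D}"

definition word_product :: "('a \<Rightarrow> 'a) list \<Rightarrow> 'a \<Rightarrow> 'a" where
  "word_product ws = foldr (\<circ>) ws id"

text \<open>
  Since reflections are involutions, the set of all products of words in the simple reflections
  is the group that they generate. The condition on fixed points says that the fixed subspace
  of \<open>W\<close> is trivial.
\<close>

definition finite_reflection_group :: "('a::euclidean_space \<Rightarrow> 'a) set \<Rightarrow> 'a set \<Rightarrow> bool" where
  "finite_reflection_group W D \<longleftrightarrow>
     finite W \<and> D \<in> chambers W \<and>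
     W = word_product ` lists (simple_reflections W D) \<and>
     {x. \<forall>w\<in>W. w x = x} = {0}"

definition map_order :: "('a \<Rightarrow> 'a) \<Rightarrow> nat" where
  "map_order f = (LEAST k. 0 < k \<and> f ^^ k = id)"

definition has_coxeter_matrix :: "('a \<Rightarrow> 'a) set \<Rightarrow> nat \<Rightarrow> (nat \<Rightarrow> nat \<Rightarrow> nat) \<Rightarrow> bool" where
  "has_coxeter_matrix S n m \<longleftrightarrow>
     (\<exists>s. bij_betw s {1..n} S \<and> (\<forall>i\<in>{1..n}. \<forall>j\<in>{1..n}. map_order (s i \<circ> s j) = m i j))"

definition matrix_A :: "nat \<Rightarrow> nat \<Rightarrow> nat" where
  "matrix_A i j = (if i = j then 1 else if i = Suc j \<or> j = Suc i then 3 else 2)"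

definition matrix_B :: "nat \<Rightarrow> nat \<Rightarrow> nat" where
  "matrix_B i j = (if {i, j} = {1, 2} then 4 else matrix_A i j)"


section \<open>Length, weak order and bipartite Coxeter elements\<close>

definition word_length :: "('a \<Rightarrow> 'a) set \<Rightarrow> ('a \<Rightarrow> 'a) \<Rightarrow> nat" where
  "word_length S w = (LEAST k. \<exists>ws\<in>lists S. length ws = k \<and> word_product ws = w)"

definition reduced_word :: "('a \<Rightarrow> 'a) set \<Rightarrow> ('a \<Rightarrow> 'a) list \<Rightarrow> ('a \<Rightarrow> 'a) \<Rightarrow> bool" where
  "reduced_word S ws w \<longleftrightarrow>
     ws \<in> lists S \<and> word_product ws = w \<and> length ws = word_length S w"

definition weak_le :: "('a \<Rightarrow> 'a) set \<Rightarrow> ('a \<Rightarrow> 'a) \<Rightarrow> ('a \<Rightarrow> 'a) \<Rightarrow> bool" where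
  "weak_le S u w \<longleftrightarrow> word_length S w = word_length S u + word_length S (inv u \<circ> w)"

definition pairwise_commuting :: "('a \<Rightarrow> 'a) set \<Rightarrow> bool" where
  "pairwise_commuting T \<longleftrightarrow> (\<forall>s\<in>T. \<forall>t\<in>T. s \<circ> t = t \<circ> s)"

definition bipartite_coxeter_element :: "('a \<Rightarrow> 'a) set \<Rightarrow> ('a \<Rightarrow> 'a) \<Rightarrow> bool" where
  "bipartite_coxeter_element S c \<longleftrightarrow>
     (\<exists>ps ms. distinct ps \<and> distinct ms \<and> set ps \<union> set ms = S \<and> set ps \<inter> set ms = {} \<and>
        pairwise_commuting (set ps) \<and> pairwise_commuting (set ms) \<and>
        c = word_product ps \<circ> word_product ms)"


section \<open>Sortable elements and the biCambrian congruence\<close>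

text \<open>
  A position \<open>p\<close> (counted from 0) in the infinite word \<open>as as as \<dots>\<close> lies in copy
  \<open>p div length as\<close> of \<open>as\<close>, again counted from 0. A subword is given by the increasing list
  of its positions.
\<close>

definition letter_at :: "('a \<Rightarrow> 'a) list \<Rightarrow> nat \<Rightarrow> 'a \<Rightarrow> 'a" where
  "letter_at as p = as ! (p mod length as)"

definition reduced_subword ::
    "('a \<Rightarrow> 'a) set \<Rightarrow> ('a \<Rightarrow> 'a) list \<Rightarrow> ('a \<Rightarrow> 'a) \<Rightarrow> nat list \<Rightarrow> bool" where
  "reduced_subword S as w xs \<longleftrightarrow>
     sorted_wrt (<) xs \<and> reduced_word S (map (letter_at as) xs) w"

text \<open>``Leftmost'' means lexicographically first as a sequence of positions.\<close>

definition sorting_word ::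
    "('a \<Rightarrow> 'a) set \<Rightarrow> ('a \<Rightarrow> 'a) list \<Rightarrow> ('a \<Rightarrow> 'a) \<Rightarrow> nat list \<Rightarrow> bool" where
  "sorting_word S as w xs \<longleftrightarrow>
     reduced_subword S as w xs \<and>
     (\<forall>ys. reduced_subword S as w ys \<longrightarrow> ys = xs \<or> (xs, ys) \<in> lex less_than)"

definition letters_in_copy :: "('a \<Rightarrow> 'a) list \<Rightarrow> nat list \<Rightarrow> nat \<Rightarrow> ('a \<Rightarrow> 'a) set" where
  "letters_in_copy as xs i = {letter_at as p | p. p \<in> set xs \<and> p div length as = i}"

text \<open>
  Sortability depends only on \<open>c\<close>, not on the reduced word \<open>as\<close> chosen for it: two reduced words
  of a Coxeter element differ by swaps of adjacent commuting letters.
\<close>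

definition sortable :: "('a \<Rightarrow> 'a) set \<Rightarrow> ('a \<Rightarrow> 'a) \<Rightarrow> ('a \<Rightarrow> 'a) \<Rightarrow> bool" where
  "sortable S c w \<longleftrightarrow>
     (\<exists>as xs. reduced_word S as c \<and> sorting_word S as w xs \<and>
        (\<forall>i. letters_in_copy as xs (Suc i) \<subseteq> letters_in_copy as xs i))"

definition pi_down :: "('a \<Rightarrow> 'a) set \<Rightarrow> ('a \<Rightarrow> 'a) \<Rightarrow> ('a \<Rightarrow> 'a) \<Rightarrow> ('a \<Rightarrow> 'a)" where
  "pi_down S c w =
     (THE v. sortable S c v \<and> weak_le S v w \<and>
        (\<forall>u. sortable S c u \<and> weak_le S u w \<longrightarrow> weak_le S u v))"

definition bicambrian_equiv :: "('a \<Rightarrow> 'a) set \<Rightarrow> ('a \<Rightarrow> 'a) \<Rightarrow> ('a \<Rightarrow> 'a) \<Rightarrow> ('a \<Rightarrow> 'a) \<Rightarrow> bool" where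
  "bicambrian_equiv S c u v \<longleftrightarrow>
     pi_down S c u = pi_down S c v \<and> pi_down S (inv c) u = pi_down S (inv c) v"


section \<open>Fans\<close>

definition fan :: "'a::euclidean_space set set \<Rightarrow> bool" where
  "fan \<F> \<longleftrightarrow>
     finite \<F> \<and> \<F> \<noteq> {} \<and>
     (\<forall>C\<in>\<F>. polyhedron C \<and> convex_cone C) \<and>
     (\<forall>C\<in>\<F>. \<forall>F. F face_of C \<and> F \<noteq> {} \<longrightarrow> F \<in> \<F>) \<and>
     (\<forall>C\<in>\<F>. \<forall>C'\<in>\<F>. C \<inter> C' face_of C \<and> C \<inter> C' face_of C')"

definition simplicial_cone :: "'a::euclidean_space set \<Rightarrow> bool" where
  "simplicial_cone C \<longleftrightarrow> (\<exists>B. independent B \<and> C = convex_cone hull B)"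

definition simplicial_fan :: "'a::euclidean_space set set \<Rightarrow> bool" where
  "simplicial_fan \<F> \<longleftrightarrow> fan \<F> \<and> (\<forall>C\<in>\<F>. simplicial_cone C)"

definition bicambrian_cone ::
    "('a::euclidean_space \<Rightarrow> 'a) set \<Rightarrow> 'a set \<Rightarrow> ('a \<Rightarrow> 'a) \<Rightarrow> ('a \<Rightarrow> 'a) \<Rightarrow> 'a set" where
  "bicambrian_cone W D c u =
     (\<Union>w\<in>{w\<in>W. bicambrian_equiv (simple_reflections W D) c u w}. w ` D)"

text \<open>The empty set is excluded because \<open>{} face_of C\<close> holds, but it is not a cone.\<close>

definition biCamb ::
    "('a::euclidean_space \<Rightarrow> 'a) set \<Rightarrow> 'a set \<Rightarrow> ('a \<Rightarrow> 'a) \<Rightarrow> 'a set set" where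
  "biCamb W D c = {F. F \<noteq> {} \<and> (\<exists>u\<in>W. F face_of bicambrian_cone W D c u)}"


section \<open>Dual polytopes\<close>

text \<open>
  A polytope is dual to a complete fan if the fan is its normal fan. Outer normals are used;
  inner normals would give the outer normal fan of the reflected polytope.
\<close>

definition normal_cone :: "'a::euclidean_space set \<Rightarrow> 'a set \<Rightarrow> 'a set" where
  "normal_cone P F = {y. \<forall>f\<in>F. \<forall>x\<in>P. y \<bullet> x \<le> y \<bullet> f}"

definition normal_fan :: "'a::euclidean_space set \<Rightarrow> 'a set set" where
  "normal_fan P = {normal_cone P F | F. F face_of P \<and> F \<noteq> {}}"

definition simple_polytope :: "'a::euclidean_space set \<Rightarrow> bool" where
  "simple_polytope P \<longleftrightarrow>
     polytope P \<and> (\<forall>v. v extreme_point_of P \<longrightarrow> int (card {F. F facet_of P \<and> v \<in> F}) = aff_dim P)"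

end

theory Submission
  imports Defs
begin

text \<open>
  An element \<open>w\<close> of a group of type A is the relative order of the values \<open>x k = e k \<bullet> w p\<close>, where
  the group permutes the vectors \<open>e 1, \<dots>, e N\<close> and \<open>p\<close> is a point of the chamber; type B is the
  folding of type A by \<open>e (N + 1 - k) = - e k\<close>. Sortable elements are those with aligned inversion
  set, so the Cambrian class of \<open>w\<close> is described by arrows \<open>x a < x b\<close> that persist in the class.
  For bipartite \<open>c\<close> the labels of the indices alternate, and an arrow of \<open>c\<close> or of its inverse
  passes below even and above odd indices or vice versa. A biCambrian cone is therefore the cone
  of linear extensions of the order generated by these arrows. Within one class, whether \<open>k\<close> lies
  above or below \<open>k + 1\<close> is constant, which forces all covers of the order to pass \<open>k\<close> on the same
  side. Hence the Hasse diagram is drawn without crossings and is a tree, so that the normals of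
  the cone form a basis.
\<close>

section \<open>Arrows of a configuration of real values\<close>

text \<open>No planar drawing is used. That the covers form a tree is proved as linear algebra: a
  dependency among covers is tested against real functions of the indices, namely the indicators of
  its topmost vertex and of one side of it, and each test forces a further cover into the support
  until two covers would cross. A cover can be read off because it can be made a pair of
  neighbouring values inside the class; the indices between its ends then lie above or below it by
  parity alone. All this concerns configurations of values and serves both types; only the passage
  from covers to wall normals sees the folding. Sortability is defined by a greedy reading of a
  periodic word, not by inversions. The bridge is to let the labels change with every letter read,
  so that alignment passes from each position to the next. That cones meet in common faces is
  independent of simpliciality and holds for each of the two labellings separately. Only the Coxeter
  matrix is given, so the Gram matrix of the simple roots is recovered from orders of products
  before the chain of vectors is built.\<close>

text \<open>Both directions are treated at once: on the way from \<open>a\<close> to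
  \<open>b\<close>, \<open>l\<close> comes strictly before \<open>r\<close>. Increasing and
  decreasing arrows thereby share one definition and one set of proofs.\<close>

definition oriented :: "nat \<Rightarrow> nat \<Rightarrow> nat \<Rightarrow> nat \<Rightarrow> bool" where
  "oriented a b l r \<longleftrightarrow> (a \<le> l \<and> l < r \<and> r \<le> b) \<or> (b \<le> r \<and> r < l \<and> l \<le> a)"

definition btw :: "nat \<Rightarrow> nat \<Rightarrow> nat \<Rightarrow> bool" where
  "btw a b k \<longleftrightarrow> (a < k \<and> k < b) \<or> (b < k \<and> k < a)"

text \<open>
  The arrow \<open>(a, b)\<close> says that \<open>x a < x b\<close> holds for every configuration in the Cambrian class
  of \<open>x\<close>, where the labels encode the orientation of the Coxeter diagram. If \<open>a\<close> and \<open>b\<close> are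
  neighbouring values, it is the shard of the wall \<open>x a = x b\<close> that has the labelled indices
  between \<open>a\<close> and \<open>b\<close> below and the others above.
\<close>

definition arrows :: "nat \<Rightarrow> (nat \<Rightarrow> bool) \<Rightarrow> (nat \<Rightarrow> real) \<Rightarrow> (nat \<times> nat) set" where
  "arrows N lab x = {(a, b). a \<in> {1..N} \<and> b \<in> {1..N} \<and> a \<noteq> b \<and>
     (\<forall>l r. oriented a b l r \<longrightarrow> l = a \<or> lab l \<longrightarrow> r = b \<or> \<not> lab r \<longrightarrow> x l < x r)}"

lemma oriented_self: "a \<noteq> b \<Longrightarrow> oriented a b a b"
  by (auto simp: oriented_def)

lemma oriented_trans: "oriented a b l r \<Longrightarrow> oriented l r l' r' \<Longrightarrow> oriented a b l' r'"
  by (auto simp: oriented_def)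

lemma oriented_in_range:
  "oriented a b l r \<Longrightarrow> a \<in> {1..N} \<Longrightarrow> b \<in> {1..N} \<Longrightarrow> l \<in> {1..N} \<and> r \<in> {1..N} \<and> l \<noteq> r"
  by (auto simp: oriented_def)

lemma arrowsI:
  assumes "a \<in> {1..N}" "b \<in> {1..N}" "a \<noteq> b"
    and "\<And>l r. oriented a b l r \<Longrightarrow> l = a \<or> lab l \<Longrightarrow> r = b \<or> \<not> lab r \<Longrightarrow> x l < x r"
  shows "(a, b) \<in> arrows N lab x"
  using assms by (auto simp: arrows_def)

lemma arrows_less: "(a, b) \<in> arrows N lab x \<Longrightarrow> x a < x b"
  using oriented_self by (auto simp: arrows_def)

lemma arrowsD:
  "(a, b) \<in> arrows N lab x \<Longrightarrow> oriented a b l r \<Longrightarrow> l = a \<or> lab l \<Longrightarrow> r = b \<or> \<not> lab r \<Longrightarrow> x l < x r"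
  by (auto simp: arrows_def)

lemma arrows_range:
  assumes "(a, b) \<in> arrows N lab x"
  shows "a \<in> {1..N}" "b \<in> {1..N}" "a \<noteq> b"
  using assms by (auto simp: arrows_def)

lemma arrows_sub:
  assumes "(a, b) \<in> arrows N lab x" "oriented a b l r" "l = a \<or> lab l" "r = b \<or> \<not> lab r"
  shows "(l, r) \<in> arrows N lab x"
proof (rule arrowsI)
  show "l \<in> {1..N}" "r \<in> {1..N}" "l \<noteq> r"
    using oriented_in_range[OF assms(2)] arrows_range[OF assms(1)] by auto
  fix l' r' assume "oriented l r l' r'" "l' = l \<or> lab l'" "r' = r \<or> \<not> lab r'"
  then show "x l' < x r'"
    using assms oriented_trans[OF assms(2)] arrowsD[OF assms(1), of l' r'] by auto
qed

text \<open>A labelled index may replace the source and an unlabelled one the target. Every index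
  between the ends thus yields a shorter arrow, which drives the inductions on the distance of the
  ends.\<close>

lemma arrows_labelled:
  assumes "(a, b) \<in> arrows N lab x" "btw a b k"
  shows "lab k \<Longrightarrow> (k, b) \<in> arrows N lab x" "\<not> lab k \<Longrightarrow> (a, k) \<in> arrows N lab x"
proof -
  have "oriented a b k b" "oriented a b a k"
    using assms(2) by (auto simp: oriented_def btw_def)
  then show "lab k \<Longrightarrow> (k, b) \<in> arrows N lab x" "\<not> lab k \<Longrightarrow> (a, k) \<in> arrows N lab x"
    using arrows_sub[OF assms(1)] by blast+
qed

lemma oriented_cases:
  assumes "oriented a b l r"
  shows "l = a \<or> btw a b l" "r = b \<or> btw a b r"
  using assms by (auto simp: oriented_def btw_def)

text \<open>With truncated subtraction the measure is the distance |a - b|.\<close>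

lemma distance_induct [case_names step]:
  assumes "\<And>a b. (\<And>a' b'. (a' - b') + (b' - a') < (a - b) + (b - a) \<Longrightarrow> P a' b') \<Longrightarrow> P a (b :: nat)"
  shows "P a b"
proof -
  have "\<forall>a b. (a - b) + (b - a) = n \<longrightarrow> P a b" for n
  proof (induction n rule: less_induct)
    case (less n)
    show ?case
    proof (intro allI impI)
      fix a b :: nat assume n: "(a - b) + (b - a) = n"
      show "P a b"
        by (rule assms) (use less.IH n in simp)
    qed
  qed
  then show ?thesis by simp
qed

lemma btw_dist:
  assumes "btw a b k"
  shows "(k - b) + (b - k) < (a - b) + (b - a)" "(a - k) + (k - a) < (a - b) + (b - a)"
  using assms by (auto simp: btw_def)

text \<open>Sources of the reversed arrow lie weakly below \<open>u b\<close> and its targets weakly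
  above \<open>u a\<close>, so the interval between these two values separates them.\<close>

lemma reversed_arrow:
  assumes "a \<in> {1..N}" "b \<in> {1..N}" "a \<noteq> b" and less: "u b < u a"
    and btw: "\<And>k. btw a b k \<Longrightarrow> lab k \<Longrightarrow> u k \<le> u b" "\<And>k. btw a b k \<Longrightarrow> \<not> lab k \<Longrightarrow> u a \<le> u k"
  shows "(b, a) \<in> arrows N lab u"
proof (rule arrowsI)
  fix l r assume *: "oriented b a l r" "l = b \<or> lab l" "r = a \<or> \<not> lab r"
  have "u l \<le> u b"
    using oriented_cases(1)[OF *(1)] *(2) btw(1)[of l] by (auto simp: btw_def)
  moreover have "u a \<le> u r"
    using oriented_cases(2)[OF *(1)] *(3) btw(2)[of r] by (auto simp: btw_def)
  ultimately show "u l < u r" using less by simp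
qed (use assms in auto)

text \<open>In a shortest arrow of \<open>w\<close> that \<open>u\<close> violates, the shorter
  arrows at the indices in between still hold in \<open>u\<close>. They make the reversed pair an
  arrow of \<open>u\<close>, which \<open>w\<close> would then have to respect.\<close>

lemma arrows_transfer:
  assumes u: "inj_on u {1..N}" and lt: "\<And>a b. (a, b) \<in> arrows N lab u \<Longrightarrow> w a < w b"
  shows "(a, b) \<in> arrows N lab w \<Longrightarrow> u a < u b"
proof (induction a b rule: distance_induct)
  case (step a b)
  note ab = arrows_range[OF step.prems]
  show ?case
  proof (rule ccontr)
    assume "\<not> u a < u b"
    then have ba: "u b < u a"
      using u ab by (metis inj_onD linorder_less_linear)
    have "(b, a) \<in> arrows N lab u"
    proof (rule reversed_arrow)
      show "u k \<le> u b" if "btw a b k" "lab k" for k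
        using step.IH[OF btw_dist(1) arrows_labelled(1)[OF step.prems]] that by (simp add: less_imp_le)
      show "u a \<le> u k" if "btw a b k" "\<not> lab k" for k
        using step.IH[OF btw_dist(2) arrows_labelled(2)[OF step.prems]] that by (simp add: less_imp_le)
    qed (use ab ba in auto)
    then have "w b < w a" by (rule lt)
    with arrows_less[OF step.prems] show False by simp
  qed
qed

lemma arrows_subsetI:
  assumes "\<And>a b. (a, b) \<in> arrows N lab w \<Longrightarrow> u a < u b"
  shows "arrows N lab w \<subseteq> arrows N lab u"
proof (rule subrelI)
  fix a b assume ab: "(a, b) \<in> arrows N lab w"
  show "(a, b) \<in> arrows N lab u"
    by (rule arrowsI) (use arrows_range[OF ab] arrows_sub[OF ab] assms in auto)
qed

text \<open>Respecting the arrows of \<open>u\<close> already makes \<open>w\<close> equivalent to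
  \<open>u\<close>: a Cambrian class consists of the linear extensions of its arrows.\<close>

lemma arrows_eqI:
  assumes "inj_on u {1..N}" and "\<And>a b. (a, b) \<in> arrows N lab u \<Longrightarrow> w a < w b"
  shows "arrows N lab w = arrows N lab u"
proof
  show "arrows N lab w \<subseteq> arrows N lab u"
    by (rule arrows_subsetI) (rule arrows_transfer[OF assms])
  show "arrows N lab u \<subseteq> arrows N lab w"
    by (rule arrows_subsetI) (rule assms(2))
qed

text \<open>The Cambrian projection only reveals the arrows that are inversions. The increasing ones
  are recovered: a shortest increasing arrow of \<open>u\<close> violated by \<open>w\<close> gives
  a reversed arrow of \<open>w\<close>, which is decreasing and hence shared with
  \<open>u\<close>.\<close>

lemma arrows_eq_if_decreasing_eq:
  assumes u: "inj_on u {1..N}" and w: "inj_on w {1..N}"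
    and dec: "\<And>a b. b < a \<Longrightarrow> (a, b) \<in> arrows N lab u \<longleftrightarrow> (a, b) \<in> arrows N lab w"
  shows "arrows N lab w = arrows N lab u"
proof (rule arrows_eqI[OF u])
  fix a b
  show "(a, b) \<in> arrows N lab u \<Longrightarrow> w a < w b"
  proof (induction a b rule: distance_induct)
    case (step a b)
    note ab = arrows_range[OF step.prems]
    show ?case
    proof (cases "b < a")
      case True
      then show ?thesis using dec step.prems arrows_less by blast
    next
      case False
      with ab have "a < b" by simp
      show ?thesis
      proof (rule ccontr)
        assume "\<not> w a < w b"
        then have ba: "w b < w a"
          using w ab by (metis inj_onD linorder_less_linear)
        have "(b, a) \<in> arrows N lab w"
        proof (rule reversed_arrow)
          show "w k \<le> w b" if "btw a b k" "lab k" for k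
            using step.IH[OF btw_dist(1) arrows_labelled(1)[OF step.prems]] that by (simp add: less_imp_le)
          show "w a \<le> w k" if "btw a b k" "\<not> lab k" for k
            using step.IH[OF btw_dist(2) arrows_labelled(2)[OF step.prems]] that by (simp add: less_imp_le)
        qed (use ab ba in auto)
        then have "(b, a) \<in> arrows N lab u" using dec \<open>a < b\<close> by blast
        then show False using arrows_less[OF step.prems] arrows_less[of b a N lab u] by simp
      qed
    qed
  qed
qed

section \<open>Perturbation to generic configurations; common faces of Cambrian cones\<close>

lemma perturbation:
  fixes y u :: "nat \<Rightarrow> real"
  assumes u: "inj_on u {1..N}"
  obtains t where "0 < t" "inj_on (\<lambda>k. y k + t * u k) {1..N}"
    "\<And>i j. i \<in> {1..N} \<Longrightarrow> j \<in> {1..N} \<Longrightarrow> y i < y j \<Longrightarrow> y i + t * u i < y j + t * u j"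
proof -
  have ev: "\<forall>\<^sub>F t in at_right 0. y i < y j \<longrightarrow> y i + t * u i < y j + t * u j" for i j
  proof (cases "y i < y j")
    case True
    have "((\<lambda>t. (y j - y i) + t * (u j - u i)) \<longlongrightarrow> (y j - y i) + 0 * (u j - u i)) (at_right 0)"
      by (intro tendsto_intros)
    then have "\<forall>\<^sub>F t in at_right 0. 0 < (y j - y i) + t * (u j - u i)"
      by (rule order_tendstoD(1)) (use True in simp)
    then show ?thesis by eventually_elim (simp add: algebra_simps)
  qed simp
  have "\<forall>\<^sub>F t in at_right 0. \<forall>i\<in>{1..N}. \<forall>j\<in>{1..N}. y i < y j \<longrightarrow> y i + t * u i < y j + t * u j"
    by (intro eventually_ball_finite ballI ev) auto
  moreover have "\<forall>\<^sub>F t in at_right (0::real). 0 < t"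
    by (simp add: eventually_at_right_less)
  ultimately have "\<forall>\<^sub>F t in at_right 0. 0 < t \<and>
      (\<forall>i\<in>{1..N}. \<forall>j\<in>{1..N}. y i < y j \<longrightarrow> y i + t * u i < y j + t * u j)"
    by eventually_elim auto
  then obtain t where t: "0 < t"
    "\<And>i j. i \<in> {1..N} \<Longrightarrow> j \<in> {1..N} \<Longrightarrow> y i < y j \<Longrightarrow> y i + t * u i < y j + t * u j"
    using eventually_happens'[OF trivial_limit_at_right_real] by blast
  \<comment> \<open>Strict inequalities of \<open>y\<close> survive, so equal perturbed values can
    only come from a tie of \<open>y\<close>, and \<open>u\<close> breaks all ties.\<close>
  have "inj_on (\<lambda>k. y k + t * u k) {1..N}"
  proof (rule inj_onI)
    fix i j assume ij: "i \<in> {1..N}" "j \<in> {1..N}" and eq: "y i + t * u i = y j + t * u j"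
    have "y i = y j" using t(2)[OF ij] t(2)[OF ij(2,1)] eq by fastforce
    with eq t(1) have "u i = u j" by simp
    with u ij show "i = j" by (simp add: inj_onD)
  qed
  with t that show ?thesis by blast
qed

text \<open>
  Two Cambrian cones meet in a common face. In a shortest arrow of \<open>v\<close> violated by \<open>y\<close>, the
  values of \<open>y\<close> force the reversed arrow to hold in the class of \<open>u\<close>, and \<open>z\<close> contradicts it.
\<close>

lemma arrows_segment_aux:
  fixes y z :: "nat \<Rightarrow> real"
  assumes u: "inj_on u {1..N}"
    and y: "\<And>a b. (a, b) \<in> arrows N lab u \<Longrightarrow> y a \<le> y b"
    and z: "\<And>a b. (a, b) \<in> arrows N lab u \<Longrightarrow> z a \<le> z b"
    and ab: "(a, b) \<in> arrows N lab v"
    and less: "\<And>k. btw a b k \<Longrightarrow> lab k \<Longrightarrow> y k \<le> y b" "\<And>k. btw a b k \<Longrightarrow> \<not> lab k \<Longrightarrow> y a \<le> y k"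
    and seg: "y b < y a \<Longrightarrow> z a < z b"
  shows "y a \<le> y b"
proof (rule ccontr)
  assume "\<not> y a \<le> y b"
  then have ba: "y b < y a" by simp
  note rng = arrows_range[OF ab]
  obtain t where t: "0 < t" "inj_on (\<lambda>k. y k + t * u k) {1..N}"
    "\<And>i j. i \<in> {1..N} \<Longrightarrow> j \<in> {1..N} \<Longrightarrow> y i < y j \<Longrightarrow> y i + t * u i < y j + t * u j"
    using perturbation[OF u] by blast
  have "(b, a) \<in> arrows N lab (\<lambda>k. y k + t * u k)"
  proof (rule arrowsI)
    fix l r assume *: "oriented b a l r" "l = b \<or> lab l" "r = a \<or> \<not> lab r"
    have "y l \<le> y b"
      using oriented_cases(1)[OF *(1)] *(2) less(1)[of l] by (auto simp: btw_def)
    moreover have "y a \<le> y r"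
      using oriented_cases(2)[OF *(1)] *(3) less(2)[of r] by (auto simp: btw_def)
    ultimately have "y l < y r" using ba by simp
    then show "y l + t * u l < y r + t * u r"
      using t(3) oriented_in_range[OF *(1)] rng by blast
  qed (use rng in auto)
  \<comment> \<open>The perturbed \<open>y\<close> respects every arrow of \<open>u\<close>
    strictly, being the sum of a weak and a strict solution, so it lies in the class of
    \<open>u\<close>.\<close>
  also have "arrows N lab (\<lambda>k. y k + t * u k) = arrows N lab u"
  proof (rule arrows_eqI[OF u])
    fix a b assume *: "(a, b) \<in> arrows N lab u"
    show "y a + t * u a < y b + t * u b"
      using y[OF *] arrows_less[OF *] t(1) by (simp add: add_le_less_mono)
  qed
  finally have "z b \<le> z a" by (rule z)
  with seg[OF ba] show False by simp
qed

text \<open>The face condition in coordinates: if an inner point of a segment in the cone of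
  \<open>u\<close> lies in the cone of \<open>v\<close>, so do both ends. Whichever end violates an
  arrow, the weights \<open>1 - s\<close> and \<open>s\<close> force the other to satisfy it
  strictly, so the preceding lemma applies with the ends in either role.\<close>

lemma arrows_segment:
  fixes y z :: "nat \<Rightarrow> real"
  assumes u: "inj_on u {1..N}" and s: "0 < s" "s < 1"
    and y: "\<And>a b. (a, b) \<in> arrows N lab u \<Longrightarrow> y a \<le> y b"
    and z: "\<And>a b. (a, b) \<in> arrows N lab u \<Longrightarrow> z a \<le> z b"
    and x: "\<And>a b. (a, b) \<in> arrows N lab v \<Longrightarrow>
        (1 - s) * y a + s * z a \<le> (1 - s) * y b + s * z b"
  shows "(a, b) \<in> arrows N lab v \<Longrightarrow> y a \<le> y b \<and> z a \<le> z b"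
proof (induction a b rule: distance_induct)
  case (step a b)
  have IH: "y k \<le> y b \<and> z k \<le> z b" if "btw a b k" "lab k" for k
    using step.IH[OF btw_dist(1)] arrows_labelled(1)[OF step.prems] that by blast
  have IH': "y a \<le> y k \<and> z a \<le> z k" if "btw a b k" "\<not> lab k" for k
    using step.IH[OF btw_dist(2)] arrows_labelled(2)[OF step.prems] that by blast
  have *: "(1 - s) * (y a - y b) \<le> s * (z b - z a)"
    using x[OF step.prems] by (simp add: algebra_simps)
  have yz: "z a < z b" if "y b < y a"
  proof -
    have "0 < (1 - s) * (y a - y b)" using that s by simp
    with * have "0 < s * (z b - z a)" by linarith
    with s show ?thesis by (simp add: zero_less_mult_iff)
  qed
  have zy: "y a < y b" if "z b < z a"
  proof -
    have "s * (z b - z a) < 0" using that s by (simp add: mult_pos_neg)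
    with * have "(1 - s) * (y a - y b) < 0" by linarith
    with s show ?thesis by (simp add: mult_less_0_iff)
  qed
  have "y a \<le> y b"
    by (rule arrows_segment_aux[where y = y and z = z, OF u y z step.prems])
      (use IH IH' yz in auto)
  moreover have "z a \<le> z b"
    by (rule arrows_segment_aux[where y = z and z = y, OF u z y step.prems])
      (use IH IH' zy in auto)
  ultimately show ?case ..
qed

section \<open>Covers of the biCambrian order\<close>

text \<open>The flag chooses whether the even or the odd indices are labelled. The two labellings
  are complementary and belong to a bipartite Coxeter element and its inverse.\<close>

definition parity :: "bool \<Rightarrow> nat \<Rightarrow> bool" where
  "parity b k \<longleftrightarrow> even k = b"

definition biarrows :: "nat \<Rightarrow> (nat \<Rightarrow> real) \<Rightarrow> (nat \<times> nat) set" where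
  "biarrows N x = (\<Union>b. arrows N (parity b) x)"

definition covers :: "nat \<Rightarrow> (nat \<Rightarrow> real) \<Rightarrow> (nat \<times> nat) set" where
  "covers N x = {(a, b) \<in> (biarrows N x)\<^sup>+. \<not> (\<exists>c. (a, c) \<in> (biarrows N x)\<^sup>+ \<and> (c, b) \<in> (biarrows N x)\<^sup>+)}"

lemma biarrows_less: "(a, b) \<in> biarrows N x \<Longrightarrow> x a < x b"
  by (auto simp: biarrows_def dest: arrows_less)

lemma biarrows_range:
  assumes "(a, b) \<in> biarrows N x"
  shows "a \<in> {1..N}" "b \<in> {1..N}" "a \<noteq> b"
  using assms arrows_range unfolding biarrows_def by blast+

lemma biarrows_eqI:
  assumes "inj_on u {1..N}" and "\<And>a b. (a, b) \<in> biarrows N u \<Longrightarrow> w a < w b"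
  shows "biarrows N w = biarrows N u" "arrows N (parity c) w = arrows N (parity c) u"
proof -
  have "arrows N (parity c) w = arrows N (parity c) u" for c
    by (rule arrows_eqI[OF assms(1)]) (use assms(2) in \<open>auto simp: biarrows_def\<close>)
  then show "biarrows N w = biarrows N u" "arrows N (parity c) w = arrows N (parity c) u"
    by (auto simp: biarrows_def)
qed

lemma trancl_biarrows_strict_mono:
  assumes "\<And>a b. (a, b) \<in> biarrows N u \<Longrightarrow> w a < (w b :: real)"
  shows "(a, b) \<in> (biarrows N u)\<^sup>+ \<Longrightarrow> w a < w b"
  by (induction rule: trancl_induct) (use assms order.strict_trans in blast)+

lemma trancl_biarrows_range:
  "(a, b) \<in> (biarrows N u)\<^sup>+ \<Longrightarrow> a \<in> {1..N} \<and> b \<in> {1..N}"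
  by (induction rule: trancl_induct) (use biarrows_range in blast)+

lemma trancl_biarrows_less: "(a, b) \<in> (biarrows N u)\<^sup>+ \<Longrightarrow> u a < u b"
  by (rule trancl_biarrows_strict_mono[of N u u]) (auto dest: biarrows_less)

lemma covers_trancl: "(a, b) \<in> covers N u \<Longrightarrow> (a, b) \<in> (biarrows N u)\<^sup>+"
  by (simp add: covers_def)

lemma covers_less: "(a, b) \<in> covers N u \<Longrightarrow> u a < u b"
  using trancl_biarrows_less[OF covers_trancl] by blast

lemma covers_range:
  assumes "(a, b) \<in> covers N u"
  shows "a \<in> {1..N}" "b \<in> {1..N}" "a \<noteq> b"
  using trancl_biarrows_range[OF covers_trancl[OF assms]] covers_less[OF assms] by auto

lemma finite_covers: "finite (covers N u)"
  by (rule finite_subset[of _ "{1..N} \<times> {1..N}"]) (use covers_range in auto)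

lemma covers_no_between:
  "(a, b) \<in> covers N u \<Longrightarrow> (a, c) \<in> (biarrows N u)\<^sup>+ \<Longrightarrow> (c, b) \<notin> (biarrows N u)\<^sup>+"
  by (auto simp: covers_def)

lemma covers_biarrows: 
  assumes "(a, b) \<in> covers N u"
  shows "(a, b) \<in> biarrows N u"
  using covers_trancl[OF assms]
proof (cases rule: tranclE)
  case (step c)
  then show ?thesis using covers_no_between[OF assms] by blast
qed

text \<open>A pair that is not a cover splits at an intermediate element; the number of values
  strictly between the ends drops for both halves.\<close>

lemma covers_le_imp_biarrows_le:
  fixes y :: "nat \<Rightarrow> real"
  assumes "\<And>a b. (a, b) \<in> covers N u \<Longrightarrow> y a \<le> y b"
  shows "(a, b) \<in> (biarrows N u)\<^sup>+ \<Longrightarrow> y a \<le> y b"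
proof (induction "card {k \<in> {1..N}. u a < u k \<and> u k < u b}" arbitrary: a b rule: less_induct)
  case (less a b)
  show ?case
  proof (cases "(a, b) \<in> covers N u")
    case False
    then obtain c where c: "(a, c) \<in> (biarrows N u)\<^sup>+" "(c, b) \<in> (biarrows N u)\<^sup>+"
      using less.prems by (auto simp: covers_def)
    note lt = trancl_biarrows_less[OF c(1)] trancl_biarrows_less[OF c(2)]
    have cN: "c \<in> {1..N}" using trancl_biarrows_range[OF c(1)] by simp
    have cin: "c \<in> {k \<in> {1..N}. u a < u k \<and> u k < u b}" using lt cN by simp
    have "{k \<in> {1..N}. u a < u k \<and> u k < u c} \<subseteq> {k \<in> {1..N}. u a < u k \<and> u k < u b} - {c}"
      "{k \<in> {1..N}. u c < u k \<and> u k < u b} \<subseteq> {k \<in> {1..N}. u a < u k \<and> u k < u b} - {c}"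
      using lt by auto
    then have "{k \<in> {1..N}. u a < u k \<and> u k < u c} \<subset> {k \<in> {1..N}. u a < u k \<and> u k < u b}"
      "{k \<in> {1..N}. u c < u k \<and> u k < u b} \<subset> {k \<in> {1..N}. u a < u k \<and> u k < u b}"
      using cin by blast+
    then have "card {k \<in> {1..N}. u a < u k \<and> u k < u c} < card {k \<in> {1..N}. u a < u k \<and> u k < u b}"
      "card {k \<in> {1..N}. u c < u k \<and> u k < u b} < card {k \<in> {1..N}. u a < u k \<and> u k < u b}"
      by (simp_all add: psubset_card_mono)
    then have "y a \<le> y c" "y c \<le> y b"
      using less.hyps c by auto
    then show ?thesis by simp
  qed (rule assms)
qed

text \<open>The set \<open>A\<close> is the part of the configuration below a cut. If between
  \<open>a\<close> and \<open>b\<close> it consists of the indices of one parity, then for the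
  labelling of that parity all sources are below the cut and all targets above.\<close>

lemma cut_biarrow:
  assumes "a \<in> {1..N}" "b \<in> {1..N}" "a \<noteq> b" "a \<in> A" "b \<notin> A"
    and cut: "\<And>k l. k \<in> A \<Longrightarrow> l \<notin> A \<Longrightarrow> w k < w l"
    and btw: "\<And>k. btw a b k \<Longrightarrow> k \<in> A \<longleftrightarrow> even k = c"
  shows "(a, b) \<in> biarrows N w"
proof -
  have "(a, b) \<in> arrows N (parity c) w"
  proof (rule arrowsI)
    fix l r assume *: "oriented a b l r" "l = a \<or> parity c l" "r = b \<or> \<not> parity c r"
    have "l \<in> A" "r \<notin> A"
      using oriented_cases[OF *(1)] *(2,3) assms(4,5) btw by (auto simp: parity_def btw_def)
    then show "w l < w r" by (rule cut)
  qed (use assms in auto)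
  then show ?thesis by (auto simp: biarrows_def)
qed

text \<open>The converse for neighbouring values: a labelled index in between lies below
  \<open>b\<close>, hence not above \<open>a\<close>, and an unlabelled one lies above
  \<open>a\<close>.\<close>

lemma biarrow_neighbours:
  assumes ab: "(a, b) \<in> biarrows N w"
    and adj: "\<And>k. k \<in> {1..N} \<Longrightarrow> w k \<le> w a \<or> w b \<le> w k"
    and inj: "inj_on w {1..N}"
  obtains c where "\<And>k. btw a b k \<Longrightarrow> w k \<le> w a \<longleftrightarrow> even k = c"
proof -
  obtain c where c: "(a, b) \<in> arrows N (parity c) w"
    using ab by (auto simp: biarrows_def)
  note rng = arrows_range[OF c]
  have "w k \<le> w a \<longleftrightarrow> even k = c" if k: "btw a b k" for k
  proof -
    have kN: "k \<in> {1..N}" using k rng by (auto simp: btw_def)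
    show ?thesis
    proof (cases "even k = c")
      case True
      then have "w k < w b"
        using arrows_less[OF arrows_labelled(1)[OF c k]] by (simp add: parity_def)
      then show ?thesis using True adj[OF kN] by simp
    next
      case False
      then have "w a < w k"
        using arrows_less[OF arrows_labelled(2)[OF c k]] by (simp add: parity_def)
      then show ?thesis using False by simp
    qed
  qed
  then show ?thesis using that by blast
qed

text \<open>A linear extension may list the elements below \<open>b\<close> other than
  \<open>a\<close> first, then \<open>a\<close>, then \<open>b\<close>, then the rest. Nothing lies
  strictly between the ends of a cover, so no relation is broken.\<close>

lemma cover_adjacent:
  assumes u: "inj_on u {1..N}" and ab: "(a, b) \<in> covers N u"
  obtains w c where "inj_on w {1..N}" "biarrows N w = biarrows N u"
    "\<And>k. k \<in> {1..N} \<Longrightarrow> w k \<le> w a \<or> w b \<le> w k"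
    "\<And>k. btw a b k \<Longrightarrow> w k \<le> w a \<longleftrightarrow> even k = c"
proof -
  define P where "P = (biarrows N u)\<^sup>+"
  have P: "trans P" by (simp add: P_def)
  note rng = covers_range[OF ab]
  define L where "L = {x. (x, b) \<in> P \<and> x \<noteq> a}"
  define K where "K = Max ((\<lambda>k. \<bar>u k\<bar>) ` {1..N}) + 1"
  have K: "\<bar>u k\<bar> < K" if "k \<in> {1..N}" for k
  proof -
    have "\<bar>u k\<bar> \<le> Max ((\<lambda>k. \<bar>u k\<bar>) ` {1..N})" by (rule Max_ge) (use that in auto)
    then show ?thesis by (simp add: K_def)
  qed
  have K1: "1 \<le> K"
  proof -
    have "\<bar>u a\<bar> \<le> Max ((\<lambda>k. \<bar>u k\<bar>) ` {1..N})" by (rule Max_ge) (use rng in auto)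
    then show ?thesis using abs_ge_zero[of "u a"] unfolding K_def by linarith
  qed
  have bL: "b \<notin> L" using trancl_biarrows_less[of b b] by (auto simp: L_def P_def)
  have aL: "a \<notin> L" by (simp add: L_def)
  \<comment> \<open>On \<open>{1..N}\<close> the values of \<open>u\<close> lie in
    \<open>(-K, K)\<close>. Since \<open>1 \<le> K\<close>, the four blocks \<open>(-K, K)\<close>,
    \<open>K\<close>, \<open>K + 1\<close> and \<open>(2 * K, 4 * K)\<close> are disjoint and in
    ascending order.\<close>
  define w where "w = (\<lambda>k. if k \<in> L then u k else if k = a then K else if k = b then K + 1 else u k + 3 * K)"
  have wa: "w a = K" and wb: "w b = K + 1" using aL bL rng by (auto simp: w_def)
  have Kb: "- K < u k" "u k < K" if "k \<in> {1..N}" for k using K[OF that] by auto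
  have inj: "inj_on w {1..N}"
  proof (rule inj_onI)
    fix i j assume ij: "i \<in> {1..N}" "j \<in> {1..N}" "w i = w j"
    then show "i = j"
      using Kb[OF ij(1)] Kb[OF ij(2)] K1 inj_onD[OF u, of i j] 
      by (auto simp: w_def split: if_splits)
  qed
  have "w x < w y" if xy: "(x, y) \<in> biarrows N u" for x y
  proof -
    have xyP: "(x, y) \<in> P" using xy by (auto simp: P_def)
    note r = biarrows_range[OF xy]
    have uxy: "u x < u y" by (rule biarrows_less[OF xy])
    have 1: "x \<in> L" if "y \<in> L"
    proof -
      have "(x, b) \<in> P" using that xyP P by (auto simp: L_def dest: transD)
      moreover have "x \<noteq> a" using that xyP covers_no_between[OF ab] by (auto simp: L_def P_def)
      ultimately show ?thesis by (simp add: L_def)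
    qed
    have 2: "x \<in> L" if "y = a"
      using that xyP covers_trancl[OF ab] P r(3) by (auto simp: L_def P_def dest: trancl_trans)
    have 3: "x \<in> L \<or> x = a" if "y = b" using that xyP by (auto simp: L_def)
    show ?thesis
      using 1 2 3 uxy Kb[OF r(1)] Kb[OF r(2)] K1 r(3) unfolding w_def by auto
  qed
  then have eq: "biarrows N w = biarrows N u" by (rule biarrows_eqI(1)[OF u])
  have adj: "w k \<le> w a \<or> w b \<le> w k" if "k \<in> {1..N}" for k
    unfolding wa wb using Kb[OF that] K1 by (auto simp: w_def)
  have "(a, b) \<in> biarrows N w" using covers_biarrows[OF ab] eq by simp
  then obtain c where "\<And>k. btw a b k \<Longrightarrow> w k \<le> w a \<longleftrightarrow> even k = c"
    using biarrow_neighbours[OF _ adj inj] by blast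
  with that inj eq adj show ?thesis by blast
qed

text \<open>In \<open>w\<close> the cut just above \<open>a\<close> sorts the indices between
  \<open>a\<close> and \<open>b\<close> by parity. It does so on the parts from \<open>k\<close> to
  \<open>b\<close> and from \<open>a\<close> to \<open>k\<close> as well, which gives the two
  arrows.\<close>

lemma cover_spanned:
  assumes u: "inj_on u {1..N}" and ab: "(a, b) \<in> covers N u" and k: "btw a b k"
    and adj: "inj_on w {1..N}" "biarrows N w = biarrows N u"
      "\<And>k. k \<in> {1..N} \<Longrightarrow> w k \<le> w a \<or> w b \<le> w k"
      "\<And>k. btw a b k \<Longrightarrow> w k \<le> w a \<longleftrightarrow> even k = c"
  shows "even k = c \<Longrightarrow> (k, b) \<in> biarrows N u" "even k \<noteq> c \<Longrightarrow> (a, k) \<in> biarrows N u"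
proof -
  note rng = covers_range[OF ab]
  have wab: "w a < w b" using covers_biarrows[OF ab] biarrows_less adj(2) by blast
  have kN: "k \<in> {1..N}" using k rng by (auto simp: btw_def)
  show "(k, b) \<in> biarrows N u" if "even k = c"
    unfolding adj(2)[symmetric]
    by (rule cut_biarrow[where A = "{l. w l \<le> w a}" and c = c])
      (use that k kN rng wab adj(4) in \<open>auto simp: btw_def\<close>)
  show "(a, k) \<in> biarrows N u" if "even k \<noteq> c"
    unfolding adj(2)[symmetric]
    by (rule cut_biarrow[where A = "{l. w l \<le> w a}" and c = c])
      (use that k kN rng wab adj(4) in \<open>auto simp: btw_def\<close>)
qed

text \<open>With \<open>p\<close> and \<open>t\<close> adjacent in \<open>w\<close>, the index
  \<open>q\<close> lies below \<open>p\<close>. The cut just below \<open>w p\<close> sorts the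
  indices between \<open>q\<close> and \<open>p\<close> by parity, so \<open>q\<close> is below
  \<open>p\<close> in the order, and \<open>(q, t)\<close> is no cover.\<close>

lemma covers_same_side:
  assumes u: "inj_on u {1..N}" and p: "(p, t) \<in> covers N u" and q: "(q, t) \<in> covers N u"
    and btw: "btw p t q"
  shows False
proof -
  obtain w c where w: "inj_on w {1..N}" "biarrows N w = biarrows N u"
    "\<And>k. k \<in> {1..N} \<Longrightarrow> w k \<le> w p \<or> w t \<le> w k"
    "\<And>k. btw p t k \<Longrightarrow> w k \<le> w p \<longleftrightarrow> even k = c"
    using cover_adjacent[OF u p] by blast
  note rng = covers_range[OF p] covers_range[OF q]
  have "w q < w t" using covers_biarrows[OF q] biarrows_less w(2) by blast
  then have "w q \<le> w p" using w(3) rng by fastforce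
  moreover have "q \<noteq> p" using btw by (auto simp: btw_def)
  ultimately have qp: "w q < w p" using w(1) rng by (metis inj_onD order_less_le)
  have "(q, p) \<in> biarrows N w"
  proof (rule cut_biarrow[where A = "{l. w l < w p}" and c = c])
    fix k assume k: "btw q p k"
    then have k': "btw p t k" using btw by (auto simp: btw_def)
    have "k \<in> {1..N}" "k \<noteq> p" using k rng by (auto simp: btw_def)
    then have "w k \<noteq> w p" using w(1) rng by (metis inj_onD)
    then show "k \<in> {l. w l < w p} \<longleftrightarrow> even k = c" using w(4)[OF k'] by auto
  qed (use rng qp \<open>q \<noteq> p\<close> in auto)
  then show False using covers_no_between[OF q, of p] covers_trancl[OF p] w(2) by auto
qed

text \<open>
  If a cover passes below \<open>t\<close>, then \<open>t\<close> lies above both index neighbours throughout the class, so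
  covers ending in \<open>t\<close> from different sides follow the same parity and their lower ends are
  comparable.
\<close>

lemma covers_opposite_sides:
  assumes u: "inj_on u {1..N}" and p: "(p, t) \<in> covers N u" and q: "(q, t) \<in> covers N u"
    and ptq: "(p < t \<and> t < q) \<or> (q < t \<and> t < p)"
    and ab: "(a, b) \<in> covers N u" and btw: "btw a b t" and ub: "u b < u t"
  shows False
proof -
  note rng = covers_range[OF p] covers_range[OF q] covers_range[OF ab]
  obtain w3 c3 where w3: "inj_on w3 {1..N}" "biarrows N w3 = biarrows N u"
    "\<And>k. k \<in> {1..N} \<Longrightarrow> w3 k \<le> w3 a \<or> w3 b \<le> w3 k"
    "\<And>k. btw a b k \<Longrightarrow> w3 k \<le> w3 a \<longleftrightarrow> even k = c3"
    using cover_adjacent[OF u ab] by blast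
  \<comment> \<open>The other parity would put \<open>t\<close> below \<open>b\<close> in the order.
    So the cover \<open>(a, b)\<close> passes below \<open>t\<close>.\<close>
  have t3: "even t \<noteq> c3"
    using cover_spanned(1)[OF u ab btw w3] biarrows_less[of t b N u] ub by auto
  have w3ab: "w3 a < w3 b" using covers_biarrows[OF ab] biarrows_less w3(2) by blast
  have t3b: "w3 b < w3 t"
  proof -
    have "w3 b \<le> w3 t" using w3(3)[of t] w3(4)[OF btw] t3 rng by auto
    moreover have "b \<noteq> t" using btw by (auto simp: btw_def)
    ultimately show ?thesis using w3(1) rng by (metis inj_onD order_less_le)
  qed
  define c where "c = (\<not> even t)"
  \<comment> \<open>The indices next to \<open>t\<close> have the other parity, so the cover
    \<open>(a, b)\<close> passes above them unless they are its ends; in either case they are below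
    \<open>t\<close>.\<close>
  have nb: "(k, t) \<in> biarrows N u" if k: "k = t - 1 \<or> k = t + 1" for k
  proof -
    have kc: "even k \<noteq> even t" using k btw by (auto simp: btw_def)
    have "k = a \<or> k = b \<or> btw a b k" using k btw by (auto simp: btw_def)
    then have "w3 k < w3 t"
    proof (elim disjE)
      assume "btw a b k"
      then have "w3 k \<le> w3 a" using w3(4) kc t3 by auto
      then show ?thesis using w3ab t3b by simp
    qed (use w3ab t3b in auto)
    moreover have "k \<in> {1..N}" using \<open>k = a \<or> k = b \<or> btw a b k\<close> rng by (auto simp: btw_def)
    ultimately show ?thesis
      unfolding w3(2)[symmetric]
      \<comment> \<open>No index lies between \<open>t\<close> and its neighbour, so the parity
        condition is vacuous and the flag \<open>True\<close> is a mere choice.\<close>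
      by (intro cut_biarrow[where A = "{l. w3 l < w3 t}" and c = True])
        (use k rng in \<open>auto simp: btw_def\<close>)
  qed
  \<comment> \<open>The neighbour of \<open>t\<close> towards \<open>x\<close> is below
    \<open>t\<close>, which fixes the parity of the indices that the cover \<open>(x, t)\<close> has
    above it. If nothing lies between \<open>x\<close> and \<open>t\<close>, any flag will
    do.\<close>
  have par: "\<exists>w. inj_on w {1..N} \<and> biarrows N w = biarrows N u \<and>
      (\<forall>k\<in>{1..N}. w k \<le> w x \<or> w t \<le> w k) \<and> (\<forall>k. btw x t k \<longrightarrow> (w k \<le> w x \<longleftrightarrow> even k = c))"
    if x: "(x, t) \<in> covers N u" for x
  proof -
    obtain w d where w: "inj_on w {1..N}" "biarrows N w = biarrows N u"
      "\<And>k. k \<in> {1..N} \<Longrightarrow> w k \<le> w x \<or> w t \<le> w k"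
      "\<And>k. btw x t k \<Longrightarrow> w k \<le> w x \<longleftrightarrow> even k = d"
      using cover_adjacent[OF u x] by blast
    have "d = c" if k: "btw x t k" for k
    proof -
      define m where "m = (if x < t then t - 1 else t + 1)"
      have m: "btw x t m" using k by (auto simp: m_def btw_def)
      have "m \<in> {1..N}" using m covers_range[OF x] by (auto simp: btw_def)
      have "(m, t) \<in> biarrows N w" using nb[of m] w(2) by (auto simp: m_def)
      then have "w m < w t" by (rule biarrows_less)
      then have "w m \<le> w x" using w(3)[OF \<open>m \<in> {1..N}\<close>] by auto
      then have "even m = d" using w(4)[OF m] by simp
      then show "d = c" using m by (auto simp: m_def c_def btw_def split: if_splits)
    qed
    then show ?thesis using w by blast
  qed
  obtain w1 where w1: "inj_on w1 {1..N}" "biarrows N w1 = biarrows N u"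
    "\<And>k. k \<in> {1..N} \<Longrightarrow> w1 k \<le> w1 p \<or> w1 t \<le> w1 k"
    "\<And>k. btw p t k \<Longrightarrow> w1 k \<le> w1 p \<longleftrightarrow> even k = c"
    using par[OF p] by blast
  obtain w where w: "inj_on w {1..N}" "biarrows N w = biarrows N u"
    "\<And>k. k \<in> {1..N} \<Longrightarrow> w k \<le> w q \<or> w t \<le> w k"
    "\<And>k. btw q t k \<Longrightarrow> w k \<le> w q \<longleftrightarrow> even k = c"
    using par[OF q] by blast
  have below: "w k < w q" if "(k, t) \<in> biarrows N u" "k \<in> {1..N}" "k \<noteq> q" for k
  proof -
    have "w k < w t" using that(1) biarrows_less w(2) by blast
    then have "w k \<le> w q" using w(3)[OF that(2)] by auto
    then show ?thesis using w(1) rng that by (metis inj_onD order_less_le)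
  qed
  have wqt: "w q < w t" using covers_biarrows[OF q] biarrows_less w(2) by blast
  \<comment> \<open>In \<open>w\<close> the indices \<open>q\<close> and \<open>t\<close> are
    adjacent. An arrow into \<open>q\<close> is sought that starts from \<open>p\<close> or from an
    index that the order puts above \<open>p\<close>. Among those below \<open>q\<close> the one
    nearest to \<open>t\<close> is taken, so that all later indices on the way to \<open>t\<close>
    that have the parity of \<open>t\<close> lie above \<open>q\<close>.\<close>
  define S where "S = {k. (k = p \<or> (btw p t k \<and> even k \<noteq> c)) \<and> w k < w q}"
  have pS: "p \<in> S" using below[OF covers_biarrows[OF p]] rng ptq by (auto simp: S_def)
  have "finite S" by (rule finite_subset[of _ "{1..N}"]) (use rng in \<open>auto simp: S_def btw_def\<close>)
  have "\<exists>k\<in>S. \<forall>m\<in>S. \<not> btw k t m"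
  proof (cases "p < t")
    case True
    have "Max S \<in> S" "\<And>m. m \<in> S \<Longrightarrow> m \<le> Max S"
      using Max_in[OF \<open>finite S\<close>] Max_ge[OF \<open>finite S\<close>] pS by blast+
    moreover have "Max S < t" using \<open>Max S \<in> S\<close> True by (auto simp: S_def btw_def)
    ultimately show ?thesis by (intro bexI[of _ "Max S"]) (auto simp: btw_def, fastforce)
  next
    case False
    have "Min S \<in> S" "\<And>m. m \<in> S \<Longrightarrow> Min S \<le> m"
      using Min_in[OF \<open>finite S\<close>] Min_le[OF \<open>finite S\<close>] pS by blast+
    moreover have "t < Min S" using \<open>Min S \<in> S\<close> False ptq by (auto simp: S_def btw_def)
    ultimately show ?thesis by (intro bexI[of _ "Min S"]) (auto simp: btw_def, fastforce)
  qed
  then obtain k where k: "k \<in> S" "\<And>m. m \<in> S \<Longrightarrow> \<not> btw k t m" by blast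
  have kpt: "k = p \<or> btw p t k" using k(1) by (auto simp: S_def)
  have kN: "k \<in> {1..N}" using kpt rng by (auto simp: btw_def)
  have "(k, q) \<in> biarrows N w"
  proof (rule cut_biarrow[where A = "{l. w l < w q}" and c = c])
    fix m assume m: "btw k q m"
    have mN: "m \<in> {1..N}" "m \<noteq> q" using m rng kN by (auto simp: btw_def)
    have "btw k t m \<or> m = t \<or> btw q t m" using m kpt ptq unfolding btw_def by linarith
    then consider "btw k t m" | "m = t" | "btw q t m" by blast
    then show "m \<in> {l. w l < w q} \<longleftrightarrow> even m = c"
    proof cases
      case 1
      then have m': "btw p t m" using kpt by (auto simp: btw_def)
      show ?thesis
      proof (cases "even m = c")
        case True
        then show ?thesis
          using below[OF cover_spanned(1)[OF u p m' w1]] mN by simp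
      next
        case False
        then show ?thesis using k(2)[of m] 1 m' by (auto simp: S_def)
      qed
    next
      case 2
      then show ?thesis using wqt by (auto simp: c_def)
    next
      case 3
      have "w m \<noteq> w q" using w(1) rng mN by (metis inj_onD)
      then show ?thesis using w(4)[OF 3] by auto
    qed
  qed (use k kN rng kpt ptq in \<open>auto simp: S_def btw_def\<close>)
  then have kq: "(k, q) \<in> biarrows N u" using w(2) by simp
  have "(p, q) \<in> (biarrows N u)\<^sup>+"
  proof (cases "k = p")
    case False
    then have "btw p t k" "even k \<noteq> c" using k(1) by (auto simp: S_def)
    then have "(p, k) \<in> biarrows N u" using cover_spanned(2)[OF u p _ w1] by blast
    then show ?thesis using kq by auto
  qed (use kq in auto)
  then show False using covers_no_between[OF p] covers_trancl[OF q] by blast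
qed

text \<open>
  The covers form a forest. In a nontrivial dependency the topmost vertex \<open>t\<close> has two lower
  covers, on different sides of \<open>t\<close>; as the coefficients beyond \<open>t\<close> cancel, some other cover in
  the support spans \<open>t\<close>.
\<close>

lemma covers_independent:
  fixes coef :: "nat \<times> nat \<Rightarrow> real"
  assumes u: "inj_on u {1..N}"
    and dep: "\<And>f :: nat \<Rightarrow> real. (\<Sum>e\<in>covers N u. coef e * (f (snd e) - f (fst e))) = 0"
    and e: "e \<in> covers N u"
  shows "coef e = 0"
proof (rule ccontr)
  assume ne: "coef e \<noteq> 0"
  define E where "E = {e \<in> covers N u. coef e \<noteq> 0}"
  have finE: "finite E" using finite_covers by (auto simp: E_def)
  have dep': "(\<Sum>e\<in>E. coef e * (f (snd e) - f (fst e))) = 0" for f :: "nat \<Rightarrow> real"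
    unfolding dep[symmetric, of f] by (rule sum.mono_neutral_left) (auto simp: E_def finite_covers)
  define V where "V = fst ` E \<union> snd ` E"
  have "e \<in> E" using e ne by (simp add: E_def)
  then have V: "finite V" "V \<noteq> {}" using finE by (auto simp: V_def)
  have "Max (u ` V) \<in> u ` V" using V by simp
  then obtain t where t': "t \<in> V" "Max (u ` V) = u t" by blast
  have t: "t \<in> V" "\<And>v. v \<in> V \<Longrightarrow> u v \<le> u t"
    using t' V Max_ge[of "u ` V"] by auto
  have EE: "(a, b) \<in> covers N u" "coef (a, b) \<noteq> 0" if "(a, b) \<in> E" for a b using that by (auto simp: E_def)
  have not_fst: "a \<noteq> t" if "(a, b) \<in> E" for a b
  proof -
    have "b \<in> V" using image_eqI[of b snd "(a, b)" E] that by (simp add: V_def)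
    then show ?thesis using t(2)[of b] covers_less[OF EE(1)[OF that]] by auto
  qed
  have "\<exists>a b. (a, b) \<in> E \<and> (t = a \<or> t = b)" using t(1) by (force simp: V_def)
  then obtain q where q: "(q, t) \<in> E" using not_fst by blast
  \<comment> \<open>Tested against a function that separates \<open>q\<close> from \<open>t\<close>,
    the dependency cannot be carried by the cover \<open>(q, t)\<close> alone.\<close>
  have ex: "\<exists>e'\<in>E. e' \<noteq> (q, t) \<and> f (snd e') \<noteq> f (fst e')" if "f q \<noteq> f t" for f :: "nat \<Rightarrow> real"
  proof (rule ccontr)
    assume no: "\<not> ?thesis"
    have "(\<Sum>e\<in>E. coef e * (f (snd e) - f (fst e))) = (\<Sum>e\<in>{(q,t)}. coef e * (f (snd e) - f (fst e)))"
      by (rule sum.mono_neutral_right) (use finE q no in auto)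
    then show False using dep'[of f] EE(2)[OF q] that by simp
  qed
  have "\<exists>a b. (a, b) \<in> E \<and> (a, b) \<noteq> (q, t) \<and> (a = t \<or> b = t)"
    using ex[of "\<lambda>k. if k = t then 1 else 0"] covers_range(3)[OF EE(1)[OF q]] by fastforce
  then have "\<exists>p. p \<noteq> q \<and> (p, t) \<in> E" using not_fst by blast
  then obtain p where p: "p \<noteq> q" "(p, t) \<in> E" by blast
  note covers_side = covers_same_side[OF u EE(1) EE(1)]
  have side: "(x < t \<and> t < y) \<or> (y < t \<and> t < x)" if "(x, t) \<in> E" "(y, t) \<in> E" "x \<noteq> y" for x y
    using covers_side[OF that(1,2)] covers_side[OF that(2,1)] that(3)
      covers_range(3)[OF EE(1)[OF that(1)]] covers_range(3)[OF EE(1)[OF that(2)]]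
    unfolding btw_def by arith
  \<comment> \<open>The test function is now the indicator of the side of \<open>t\<close> on which
    \<open>q\<close> lies. It sees exactly the covers that enter or leave this side.\<close>
  have "\<exists>a b. (a, b) \<in> E \<and> (a, b) \<noteq> (q, t) \<and>
      (q < t \<and> (a < t) \<noteq> (b < t) \<or> t < q \<and> (t < a) \<noteq> (t < b))"
  proof (cases "q < t")
    case True
    then obtain e' where "e' \<in> E" "e' \<noteq> (q, t)" "(snd e' < t) \<noteq> (fst e' < t)"
      using ex[of "\<lambda>k. if k < t then 1 else 0"] by (auto split: if_splits)
    then show ?thesis using True by (intro exI[of _ "fst e'"] exI[of _ "snd e'"]) auto
  next
    case False
    then have tq: "t < q" using covers_range(3)[OF EE(1)[OF q]] by auto
    then obtain e' where "e' \<in> E" "e' \<noteq> (q, t)" "(t < snd e') \<noteq> (t < fst e')"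
      using ex[of "\<lambda>k. if t < k then 1 else 0"] by (auto split: if_splits)
    then show ?thesis using tq by (intro exI[of _ "fst e'"] exI[of _ "snd e'"]) auto
  qed
  then obtain a b where ab: "(a, b) \<in> E" "(a, b) \<noteq> (q, t)"
    "(q < t \<and> (a < t) \<noteq> (b < t)) \<or> (t < q \<and> (t < a) \<noteq> (t < b))" by blast
  \<comment> \<open>A cover ending in \<open>t\<close> from the side of \<open>q\<close> would be a
    second one on that side.\<close>
  have bt: "b \<noteq> t" using side[of a q] ab q by auto
  have "btw a b t" using ab(3) bt not_fst[OF ab(1)] by (auto simp: btw_def)
  moreover have "u b < u t"
  proof -
    have "b \<in> V" using image_eqI[of b snd "(a, b)" E] ab(1) by (simp add: V_def)
    then have "u b \<le> u t" by (rule t(2))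
    then show ?thesis
      using u bt covers_range[OF EE(1)[OF ab(1)]] covers_range[OF EE(1)[OF q]] by (metis inj_onD order_less_le)
  qed
  ultimately show False
    using covers_opposite_sides[OF u EE(1)[OF p(2)] EE(1)[OF q] side[OF p(2) q p(1)] EE(1)[OF ab(1)]]
    by blast
qed

section \<open>The symmetry of folded configurations\<close>

text \<open>Reversing the indices negates the values and exchanges labelled with unlabelled indices.
  Both turn sources into targets, so arrows go to arrows.\<close>

lemma arrows_reflect:
  assumes ab: "(a, b) \<in> arrows N lab u"
    and u: "\<And>k. k \<in> {1..N} \<Longrightarrow> u (N + 1 - k) = - u k"
    and lab: "\<And>k. k \<in> {1..N} \<Longrightarrow> lab (N + 1 - k) \<longleftrightarrow> \<not> lab k"
  shows "(N + 1 - b, N + 1 - a) \<in> arrows N lab u"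
proof (rule arrowsI)
  note rng = arrows_range[OF ab]
  show rng': "N + 1 - b \<in> {1..N}" "N + 1 - a \<in> {1..N}" "N + 1 - b \<noteq> N + 1 - a" using rng by auto
  fix l r assume *: "oriented (N + 1 - b) (N + 1 - a) l r" "l = N + 1 - b \<or> lab l" "r = N + 1 - a \<or> \<not> lab r"
  have lr: "l \<in> {1..N}" "r \<in> {1..N}" using oriented_in_range[OF *(1)] rng' by auto
  have "oriented a b (N + 1 - r) (N + 1 - l)" using *(1) rng by (auto simp: oriented_def)
  moreover have "N + 1 - r = a \<or> lab (N + 1 - r)" using *(3) lab[OF lr(2)] rng by auto
  moreover have "N + 1 - l = b \<or> \<not> lab (N + 1 - l)" using *(2) lab[OF lr(1)] rng by auto
  ultimately have "u (N + 1 - r) < u (N + 1 - l)" using arrowsD[OF ab] by blast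
  then show "u l < u r" using u lr by simp
qed

text \<open>For even \<open>N\<close> the indices \<open>k\<close> and \<open>N + 1 - k\<close>
  differ in parity, so the reversal complements each parity labelling.\<close>

lemma biarrows_reflect:
  assumes "(a, b) \<in> biarrows N u" "even N"
    and "\<And>k. k \<in> {1..N} \<Longrightarrow> u (N + 1 - k) = - u k"
  shows "(N + 1 - b, N + 1 - a) \<in> biarrows N u"
  using assms arrows_reflect[of a b N "parity _" u] by (auto simp: biarrows_def parity_def)

lemma covers_reflect:
  assumes ab: "(a, b) \<in> covers N u" and "even N"
    and u: "\<And>k. k \<in> {1..N} \<Longrightarrow> u (N + 1 - k) = - u k"
  shows "(N + 1 - b, N + 1 - a) \<in> covers N u"
proof -
  have r: "(N + 1 - y, N + 1 - x) \<in> biarrows N u" if "(x, y) \<in> biarrows N u" for x y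
    by (rule biarrows_reflect) (use that \<open>even N\<close> u in auto)
  have tr: "(N + 1 - y, N + 1 - x) \<in> (biarrows N u)\<^sup>+" if "(x, y) \<in> (biarrows N u)\<^sup>+" for x y
    using that
  proof (induction rule: trancl_induct)
    case (step y z)
    then show ?case using r[OF step.hyps(2)] by (meson trancl_into_trancl2)
  qed (use r in blast)
  show ?thesis
    unfolding covers_def
  proof (clarsimp, intro conjI allI impI)
    show "(Suc N - b, Suc N - a) \<in> (biarrows N u)\<^sup>+" using tr[OF covers_trancl[OF ab]] by simp
    fix c assume *: "(Suc N - b, c) \<in> (biarrows N u)\<^sup>+"
    show "(c, Suc N - a) \<notin> (biarrows N u)\<^sup>+"
    proof
      assume "(c, Suc N - a) \<in> (biarrows N u)\<^sup>+"
      from tr[OF this] tr[OF *] show False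
        using covers_no_between[OF ab, of "N + 1 - c"] covers_range[OF ab] by auto
    qed
  qed
qed

text \<open>No index lies between \<open>k\<close> and \<open>Suc k\<close>, so the cut condition is
  vacuous. This connects all indices and will make the wall normals span.\<close>

lemma consecutive_comparable:
  assumes "inj_on u {1..N}" "k \<in> {1..N}" "Suc k \<in> {1..N}"
  shows "(k, Suc k) \<in> biarrows N u \<or> (Suc k, k) \<in> biarrows N u"
proof (cases "u k < u (Suc k)")
  case True
  then show ?thesis
    by (intro disjI1 cut_biarrow[where A = "{l. u l \<le> u k}"]) (use assms in \<open>auto simp: btw_def\<close>)
next
  case False
  then have "u (Suc k) < u k" using assms by (metis inj_onD n_not_Suc_n linorder_less_linear)
  then show ?thesis
    by (intro disjI2 cut_biarrow[where A = "{l. u l \<le> u (Suc k)}"]) (use assms in \<open>auto simp: btw_def\<close>)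
qed

section \<open>Aligned configurations\<close>

text \<open>
  The inversions of \<open>x\<close> are the pairs \<open>i < j\<close> with \<open>x j < x i\<close>. Alignment is the condition on
  inversion sets that characterises sortable elements.
\<close>

definition aligned :: "nat \<Rightarrow> (nat \<Rightarrow> bool) \<Rightarrow> (nat \<Rightarrow> real) \<Rightarrow> bool" where
  "aligned N lab x \<longleftrightarrow> (\<forall>i m j. 1 \<le> i \<longrightarrow> i < m \<longrightarrow> m < j \<longrightarrow> j \<le> N \<longrightarrow> x j < x i \<longrightarrow>
     (if lab m then x m < x i else x j < x m))"

lemma alignedD:
  assumes "aligned N lab x" "1 \<le> i" "i < m" "m < j" "j \<le> N" "x j < x i"
  shows "lab m \<Longrightarrow> x m < x i" "\<not> lab m \<Longrightarrow> x j < x m"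
  using assms unfolding aligned_def by metis+

text \<open>Alignment is used twice: at \<open>l\<close> for the inversion \<open>(i, j)\<close>,
  which puts \<open>l\<close> below \<open>i\<close>, then at \<open>r\<close> for the inversion
  \<open>(i, l)\<close>.\<close>

lemma aligned_imp_decreasing_arrow:
  assumes al: "aligned N lab x" and ij: "i \<in> {1..N}" "j \<in> {1..N}" "i < j" "x j < x i"
  shows "(j, i) \<in> arrows N lab x"
proof (rule arrowsI)
  fix l r assume *: "oriented j i l r" "l = j \<or> lab l" "r = i \<or> \<not> lab r"
  then have lr: "i \<le> r" "r < l" "l \<le> j" using ij(3) by (auto simp: oriented_def)
  have li: "x l < x i" if "i < l"
  proof (cases "l = j")
    case False
    then have "i < l" "l < j" "lab l" using lr * by auto
    then show ?thesis using alignedD(1)[OF al] ij by auto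
  qed (use ij in simp)
  show "x l < x r"
  proof (cases "r = i")
    case False
    then have "i < r" "r < l" "\<not> lab r" using lr * by auto
    then show ?thesis using alignedD(2)[OF al, of i r l] li ij lr by auto
  qed (use li lr in auto)
qed (use ij in auto)

lemma aligned_if_inversions_arrows:
  assumes "\<And>i j. i \<in> {1..N} \<Longrightarrow> j \<in> {1..N} \<Longrightarrow> i < j \<Longrightarrow> y j < y i \<longleftrightarrow> (j, i) \<in> arrows N lab x"
  shows "aligned N lab y"
  unfolding aligned_def
proof (intro allI impI)
  fix i m j assume *: "1 \<le> i" "i < m" "m < j" "j \<le> N" "y j < y i"
  then have "(j, i) \<in> arrows N lab x" using assms[of i j] by simp
  from arrows_labelled[OF this, of m] * show "if lab m then y m < y i else y j < y m"
    using assms[of i m] assms[of m j] by (auto simp: btw_def)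
qed

text \<open>A decreasing arrow is a conjunction of inversions, hence monotone in the inversion
  set.\<close>

lemma arrow_if_inversions_subset:
  assumes "(j, i) \<in> arrows N lab y" "i < j"
    and "\<And>i j. i \<in> {1..N} \<Longrightarrow> j \<in> {1..N} \<Longrightarrow> i < j \<Longrightarrow> y j < y i \<Longrightarrow> x j < x i"
  shows "(j, i) \<in> arrows N lab x"
proof (rule arrowsI)
  note rng = arrows_range[OF assms(1)]
  fix l r assume *: "oriented j i l r" "l = j \<or> lab l" "r = i \<or> \<not> lab r"
  have "y l < y r" using arrowsD[OF assms(1) *] .
  moreover have "r < l" using *(1) assms(2) by (auto simp: oriented_def)
  ultimately show "x l < x r" using assms(3) oriented_in_range[OF *(1)] rng by blast
qed (use arrows_range[OF assms(1)] in auto)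

text \<open>
  Moving a letter \<open>s\<close> that is initial in the Coxeter element to its end exchanges the labels
  next to the gaps \<open>G\<close> on which \<open>s\<close> acts.
\<close>

definition swap_gaps :: "nat set \<Rightarrow> nat \<Rightarrow> nat" where
  "swap_gaps G k = (if k \<in> G then Suc k else if 0 < k \<and> k - 1 \<in> G then k - 1 else k)"

lemma swap_gaps_involution:
  assumes "\<And>g. g \<in> G \<Longrightarrow> Suc g \<notin> G"
  shows "swap_gaps G (swap_gaps G k) = k"
  using assms[of "k - 1"] assms[of k] by (auto simp: swap_gaps_def split: if_splits)

lemma swap_gaps_range:
  assumes "G \<subseteq> {1..<N}"
  shows "swap_gaps G k \<in> {1..N} \<longleftrightarrow> k \<in> {1..N}"
  using assms by (auto simp: swap_gaps_def split: if_splits)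

lemma swap_gaps_less:
  assumes "i < j" "\<not> (j = Suc i \<and> i \<in> G)" "\<And>g. g \<in> G \<Longrightarrow> Suc g \<notin> G"
  shows "swap_gaps G i < swap_gaps G j"
proof -
  have i: "swap_gaps G i \<le> Suc i" "i \<notin> G \<Longrightarrow> swap_gaps G i \<le> i"
    by (auto simp: swap_gaps_def)
  obtain j' where j: "j = Suc j'" using assms(1) by (cases j) auto
  show ?thesis
  proof (cases "j \<notin> G \<and> j' \<in> G")
    case True
    then have "swap_gaps G j = j'" by (simp add: swap_gaps_def j)
    moreover have "i \<noteq> j'" "i \<in> G \<Longrightarrow> Suc i \<noteq> j'" using True assms(2) assms(3)[of i] j by auto
    ultimately show ?thesis using i assms(1) j by (cases "i \<in> G") auto
  next
    case False
    then have "j \<le> swap_gaps G j" by (auto simp: swap_gaps_def j)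
    moreover have "i \<in> G \<Longrightarrow> Suc i \<noteq> j" using assms(2) by auto
    ultimately show ?thesis using i assms(1) by (cases "i \<in> G") auto
  qed
qed

text \<open>A triple whose order the exchange keeps goes to a triple with the same label in the
  middle. If the exchange reverses two neighbours of the triple, the labels next to the gap ask for
  an inequality that follows from the inversion at the gap.\<close>

lemma aligned_swap:
  fixes x :: "nat \<Rightarrow> real"
  assumes G: "G \<subseteq> {1..<N}" "\<And>g. g \<in> G \<Longrightarrow> Suc g \<notin> G"
    and lab: "\<And>g. g \<in> G \<Longrightarrow> 1 < g \<Longrightarrow> \<not> lab g" "\<And>g. g \<in> G \<Longrightarrow> Suc g < N \<Longrightarrow> lab (Suc g)"
    and lab': "\<And>g. g \<in> G \<Longrightarrow> 1 < g \<Longrightarrow> lab' g" "\<And>g. g \<in> G \<Longrightarrow> Suc g < N \<Longrightarrow> \<not> lab' (Suc g)"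
    and same: "\<And>k. 1 < k \<Longrightarrow> k < N \<Longrightarrow> k \<notin> G \<Longrightarrow> k - 1 \<notin> G \<Longrightarrow> lab' k = lab k"
    and inv: "\<And>g. g \<in> G \<Longrightarrow> x (Suc g) < x g"
    and x': "\<And>k. k \<in> {1..N} \<Longrightarrow> x' k = x (swap_gaps G k)"
  shows "aligned N lab x \<longleftrightarrow> aligned N lab' x'"
proof -
  let ?t = "swap_gaps G"
  have labt: "lab' m = lab (?t m)" if "1 < m" "m < N" "1 < ?t m" "?t m < N" for m
    using that lab[of m] lab'[of m] lab[of "m - 1"] lab'[of "m - 1"] same[of m] G(1)
    by (auto simp: swap_gaps_def split: if_splits)
  show ?thesis
  proof
    assume al: "aligned N lab x"
    show "aligned N lab' x'"
      unfolding aligned_def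
    proof (intro allI impI)
      fix i m j assume *: "1 \<le> i" "i < m" "m < j" "j \<le> N" and ji: "x' j < x' i"
      have rng: "?t i \<in> {1..N}" "?t m \<in> {1..N}" "?t j \<in> {1..N}" using swap_gaps_range[OF G(1)] * by auto
      have x't: "x' i = x (?t i)" "x' m = x (?t m)" "x' j = x (?t j)" using x' * by auto
      consider (im) "m = Suc i" "i \<in> G" | (mj) "j = Suc m" "m \<in> G" | (ord) "?t i < ?t m" "?t m < ?t j"
        using swap_gaps_less[of i m G] swap_gaps_less[of m j G] * G(2) by blast
      then show "if lab' m then x' m < x' i else x' j < x' m"
      proof cases
        case im
        then have "?t i = m" "?t m = i" using swap_gaps_involution[of G i] G(2) by (auto simp: swap_gaps_def)
        then show ?thesis using lab'(2)[of i] inv[of i] im * ji x't by auto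
      next
        case mj
        then have "?t m = j" "?t j = m" using swap_gaps_involution[of G m] G(2) by (auto simp: swap_gaps_def)
        then show ?thesis using lab'(1)[of m] inv[of m] mj * ji x't by auto
      next
        case ord
        then have "lab' m = lab (?t m)" using labt[of m] * rng by auto
        then show ?thesis using alignedD[OF al _ ord] ji x't rng by auto
      qed
    qed
  next
    assume al: "aligned N lab' x'"
    have xt: "x k = x' (?t k)" if "k \<in> {1..N}" for k
      using x'[of "?t k"] swap_gaps_range[OF G(1)] that swap_gaps_involution[of G k] G(2) by simp
    show "aligned N lab x"
      unfolding aligned_def
    proof (intro allI impI)
      fix i m j assume *: "1 \<le> i" "i < m" "m < j" "j \<le> N" and ji: "x j < x i"
      have rng: "?t i \<in> {1..N}" "?t m \<in> {1..N}" "?t j \<in> {1..N}" using swap_gaps_range[OF G(1)] * by auto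
      have x't: "x i = x' (?t i)" "x m = x' (?t m)" "x j = x' (?t j)" using xt * by auto
      consider (im) "m = Suc i" "i \<in> G" | (mj) "j = Suc m" "m \<in> G" | (ord) "?t i < ?t m" "?t m < ?t j"
        using swap_gaps_less[of i m G] swap_gaps_less[of m j G] * G(2) by blast
      then show "if lab m then x m < x i else x j < x m"
      proof cases
        case im
        then show ?thesis using lab(2)[of i] inv[of i] * by auto
      next
        case mj
        then show ?thesis using lab(1)[of m] inv[of m] * by auto
      next
        case ord
        then have "lab m = lab' (?t m)"
          using labt[of "?t m"] * rng swap_gaps_involution[of G m] G(2) by auto
        then show ?thesis using alignedD[OF al _ ord] ji x't rng by auto
      qed
    qed
  qed
qed

text \<open>An inversion across the gap would, by alignment at \<open>g\<close> and then at
  \<open>Suc g\<close>, make the gap itself an inversion.\<close>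

lemma aligned_no_crossing:
  assumes al: "aligned N lab x" and g: "g \<in> {1..<N}"
    and lab: "1 < g \<Longrightarrow> \<not> lab g" "Suc g < N \<Longrightarrow> lab (Suc g)"
    and less: "x g < x (Suc g)"
    and ij: "1 \<le> i" "i \<le> g" "g < j" "j \<le> N"
  shows "x i \<le> x j"
proof (rule ccontr)
  assume "\<not> x i \<le> x j"
  then have ji: "x j < x i" by simp
  have gj: "x j < x g"
  proof (cases "i = g")
    case False
    then show ?thesis using alignedD(2)[OF al _ _ _ _ ji, of g] lab(1) ij by auto
  qed (use ji in simp)
  show False
  proof (cases "j = Suc g")
    case False
    then show ?thesis using alignedD(1)[OF al _ _ _ _ gj, of "Suc g"] lab(2) ij g less by auto
  qed (use gj less in simp)
qed

text \<open>Alignment reads the label of an index only inside an inversion. Without inversions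
  across the gaps in \<open>G\<close>, the labels beside these gaps are never read.\<close>

lemma aligned_relabel:
  assumes al: "aligned N lab x"
    and same: "\<And>k. 1 < k \<Longrightarrow> k < N \<Longrightarrow> k \<notin> G \<Longrightarrow> k - 1 \<notin> G \<Longrightarrow> lab' k = lab k"
    and nc: "\<And>g i j. g \<in> G \<Longrightarrow> 1 \<le> i \<Longrightarrow> i \<le> g \<Longrightarrow> g < j \<Longrightarrow> j \<le> N \<Longrightarrow> x i \<le> x j"
  shows "aligned N lab' x"
  unfolding aligned_def
proof (intro allI impI)
  fix i m j assume *: "1 \<le> i" "i < m" "m < j" "j \<le> N" and ji: "x j < x i"
  have "i \<le> m - 1" "m - 1 < j" using * by auto
  then have "m \<notin> G" "m - 1 \<notin> G" using nc[of m i j] nc[of "m - 1" i j] * ji by auto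
  then have "lab' m = lab m" using same * by auto
  then show "if lab' m then x m < x i else x j < x m" using alignedD[OF al *(1,2,3,4) ji] by auto
qed

section \<open>Realising the decreasing arrows as an inversion set\<close>

lemma decreasing_arrows_closed:
  assumes "(k, i) \<in> arrows N lab x" "(j, k) \<in> arrows N lab x" "i < k" "k < j"
  shows "(j, i) \<in> arrows N lab x"
proof (rule arrowsI)
  fix l r assume *: "oriented j i l r" "l = j \<or> lab l" "r = i \<or> \<not> lab r"
  then have lr: "i \<le> r" "r < l" "l \<le> j" using assms(3,4) by (auto simp: oriented_def)
  consider "l \<le> k" | "k \<le> r" | "r < k" "k < l" by linarith
  then show "x l < x r"
  proof cases
    case 1
    have "l = k \<or> lab l" using * 1 assms(4) by auto
    then show ?thesis using arrowsD[OF assms(1) _ _ *(3)] 1 lr by (auto simp: oriented_def)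
  next
    case 2
    have "r = k \<or> \<not> lab r" using * 2 assms(3) by auto
    then show ?thesis using arrowsD[OF assms(2) _ *(2)] 2 lr by (auto simp: oriented_def)
  next
    case 3
    have "x l < x k" using arrowsD[OF assms(2) _ *(2), of k] 3 lr by (auto simp: oriented_def)
    also have "x k < x r" using arrowsD[OF assms(1) _ _ *(3), of k] 3 lr by (auto simp: oriented_def)
    finally show ?thesis .
  qed
qed (use arrows_range[OF assms(1)] arrows_range[OF assms(2)] assms in auto)

text \<open>The total order whose inversions are to be the decreasing arrows: smaller index first,
  except across a decreasing arrow.\<close>

definition before :: "nat \<Rightarrow> (nat \<Rightarrow> bool) \<Rightarrow> (nat \<Rightarrow> real) \<Rightarrow> nat \<Rightarrow> nat \<Rightarrow> bool" where
  "before N lab x i k \<longleftrightarrow> i \<in> {1..N} \<and> k \<in> {1..N} \<and>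
     (i < k \<and> (k, i) \<notin> arrows N lab x \<or> k < i \<and> (i, k) \<in> arrows N lab x)"

lemma before_total: "i \<in> {1..N} \<Longrightarrow> k \<in> {1..N} \<Longrightarrow> i \<noteq> k \<Longrightarrow> before N lab x i k \<or> before N lab x k i"
  by (auto simp: before_def)

lemma before_asym: "before N lab x i k \<Longrightarrow> \<not> before N lab x k i"
  by (auto simp: before_def)

text \<open>A set of index pairs is an inversion set iff it and its complement are closed under
  composition. Here \<open>cl\<close> is the closedness and \<open>co\<close>, read off from the
  label of the middle index, that of the complement.\<close>

lemma before_trans:
  assumes "before N lab x i m" "before N lab x m j"
  shows "before N lab x i j"
proof -
  let ?A = "arrows N lab x"
  have cl: "(c, a) \<in> ?A" if "(b, a) \<in> ?A" "(c, b) \<in> ?A" "a < b" "b < c" for a b c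
    using decreasing_arrows_closed that by blast
  have co: "(b, a) \<in> ?A \<or> (c, b) \<in> ?A" if "(c, a) \<in> ?A" "a < b" "b < c" for a b c
    using arrows_labelled[OF that(1), of b] that(2,3) by (auto simp: btw_def)
  have "i \<noteq> j" using assms before_asym by blast
  then consider "i < m" "m < j" | "i < j" "j < m" | "m < i" "i < j" | "m < j" "j < i" | "j < i" "i < m" | "j < m" "m < i"
    using assms unfolding before_def by (metis linorder_less_linear)
  then show ?thesis
  proof cases
    case 1 then show ?thesis using assms co[of j i m] by (auto simp: before_def)
  next
    case 2 then show ?thesis using assms cl[of j i m] by (auto simp: before_def)
  next
    case 3 then show ?thesis using assms cl[of i m j] by (auto simp: before_def)
  next
    case 4 then show ?thesis using assms co[of i m j] by (auto simp: before_def)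
  next
    case 5 then show ?thesis using assms co[of m j i] by (auto simp: before_def)
  next
    case 6 then show ?thesis using assms cl[of m j i] by (auto simp: before_def)
  qed
qed

lemma realise_decreasing_arrows:
  obtains f :: "nat \<Rightarrow> real"
  where "inj_on f {1..N}"
    "\<And>i j. i \<in> {1..N} \<Longrightarrow> j \<in> {1..N} \<Longrightarrow> i < j \<Longrightarrow> f j < f i \<longleftrightarrow> (j, i) \<in> arrows N lab x"
    "(\<And>k. k \<in> {1..N} \<Longrightarrow> x (N + 1 - k) = - x k) \<Longrightarrow>
      (\<And>k. k \<in> {1..N} \<Longrightarrow> lab (N + 1 - k) \<longleftrightarrow> \<not> lab k) \<Longrightarrow>
      (\<And>k. k \<in> {1..N} \<Longrightarrow> f (N + 1 - k) = - f k)"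
proof -
  let ?b = "before N lab x"
  \<comment> \<open>Rank from below minus rank from above: unlike the plain rank, the difference
    changes sign under the reversal of the indices, as the folded case requires.\<close>
  define f where "f = (\<lambda>k. real (card {i. ?b i k}) - real (card {i. ?b k i}))"
  have fin: "finite {i. ?b i k}" "finite {i. ?b k i}" for k
    by (rule finite_subset[of _ "{1..N}"], auto simp: before_def)+
  have less: "f i < f k" if ik: "?b i k" for i k
  proof -
    have "{j. ?b j i} \<subset> {j. ?b j k}"
      using ik before_trans[OF _ ik] before_asym by blast
    then have "card {j. ?b j i} < card {j. ?b j k}" by (rule psubset_card_mono[OF fin(1)])
    moreover have "{j. ?b k j} \<subseteq> {j. ?b i j}" using ik before_trans[OF ik] by blast
    then have "card {j. ?b k j} \<le> card {j. ?b i j}" by (rule card_mono[OF fin(2)])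
    ultimately show ?thesis by (simp add: f_def)
  qed
  have iff: "f i < f k \<longleftrightarrow> ?b i k" if "i \<in> {1..N}" "k \<in> {1..N}" for i k
    using less[of i k] less[of k i] before_total[OF that] by fastforce
  have "inj_on f {1..N}"
    by (rule inj_onI) (metis less before_total less_irrefl)
  moreover have "f j < f i \<longleftrightarrow> (j, i) \<in> arrows N lab x" if "i \<in> {1..N}" "j \<in> {1..N}" "i < j" for i j
    using iff[OF that(2,1)] that by (auto simp: before_def)
  moreover have "f (N + 1 - k) = - f k"
    if x: "\<And>k. k \<in> {1..N} \<Longrightarrow> x (N + 1 - k) = - x k"
      and lab: "\<And>k. k \<in> {1..N} \<Longrightarrow> lab (N + 1 - k) \<longleftrightarrow> \<not> lab k" and k: "k \<in> {1..N}" for k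
  proof -
    have refl: "(N + 1 - b, N + 1 - a) \<in> arrows N lab x \<longleftrightarrow> (a, b) \<in> arrows N lab x"
      if "a \<in> {1..N}" "b \<in> {1..N}" for a b
      using arrows_reflect[of a b N lab x] arrows_reflect[of "N + 1 - b" "N + 1 - a" N lab x] x lab that
      by auto
    have b: "?b (N + 1 - j) (N + 1 - i) \<longleftrightarrow> ?b i j" if "i \<in> {1..N}" "j \<in> {1..N}" for i j
      using refl[OF that] refl[OF that(2,1)] that unfolding before_def by auto
    have rng: "i \<in> {1..N}" "j \<in> {1..N}" if "?b i j" for i j using that by (auto simp: before_def)
    have "bij_betw (\<lambda>i. N + 1 - i) {i. ?b i (N + 1 - k)} {i. ?b k i}"
    proof (rule bij_betw_byWitness[where f' = "\<lambda>i. N + 1 - i"])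
      show "(\<lambda>i. N + 1 - i) ` {i. ?b i (N + 1 - k)} \<subseteq> {i. ?b k i}"
      proof clarsimp
        fix i assume i: "?b i (Suc N - k)"
        have "Suc N - i \<in> {1..N}" using rng[OF i] by auto
        then show "?b k (Suc N - i)" using b[of k "Suc N - i"] rng[OF i] k i by auto
      qed
      show "(\<lambda>i. N + 1 - i) ` {i. ?b k i} \<subseteq> {i. ?b i (N + 1 - k)}"
        using b[OF k] rng by auto
    qed (use rng in fastforce)+
    then have 1: "card {i. ?b i (N + 1 - k)} = card {i. ?b k i}" by (rule bij_betw_same_card)
    have "bij_betw (\<lambda>i. N + 1 - i) {i. ?b (N + 1 - k) i} {i. ?b i k}"
    proof (rule bij_betw_byWitness[where f' = "\<lambda>i. N + 1 - i"])
      show "(\<lambda>i. N + 1 - i) ` {i. ?b (N + 1 - k) i} \<subseteq> {i. ?b i k}"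
      proof clarsimp
        fix i assume i: "?b (Suc N - k) i"
        have "Suc N - i \<in> {1..N}" using rng[OF i] by auto
        then show "?b (Suc N - i) k" using b[of "Suc N - i" k] rng[OF i] k i by auto
      qed
      show "(\<lambda>i. N + 1 - i) ` {i. ?b i k} \<subseteq> {i. ?b (N + 1 - k) i}"
        using b[OF _ k] rng by auto
    qed (use rng in fastforce)+
    then have 2: "card {i. ?b (N + 1 - k) i} = card {i. ?b i k}" by (rule bij_betw_same_card)
    show ?thesis unfolding f_def 1 2 by simp
  qed
  ultimately show ?thesis using that by blast
qed

section \<open>Simplicial cones\<close>

lemma dual_basis:
  fixes B :: "'a::euclidean_space set"
  assumes "independent B"
  obtains w where "\<And>b b'. b \<in> B \<Longrightarrow> b' \<in> B \<Longrightarrow> w b \<bullet> b' = (if b = b' then 1 else 0)"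
proof -
  have "\<exists>v. \<forall>b'\<in>B. v \<bullet> b' = (if b = b' then 1 else 0)" for b
  proof -
    obtain f :: "'a \<Rightarrow> real" where f: "linear f" "\<forall>x\<in>B. f x = (if b = x then 1 else 0)"
      using linear_independent_extend[OF assms, of "\<lambda>x. if b = x then 1 else 0"] by auto
    have "adjoint f 1 \<bullet> x = f x" for x
      using adjoint_works[OF f(1), of x 1] by (simp add: inner_commute)
    then show ?thesis using f(2) by (intro exI[of _ "adjoint f 1"]) simp
  qed
  then show ?thesis using that by metis
qed

lemma eq_0_if_orthogonal_basis:
  fixes B :: "'a::euclidean_space set"
  assumes "span B = UNIV" "\<And>b. b \<in> B \<Longrightarrow> b \<bullet> x = 0"
  shows "x = 0"
proof -
  have "x \<in> span B" using assms(1) by simp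
  then have "x \<bullet> x = 0"
    by (rule orthogonal_to_span[unfolded orthogonal_def]) (use assms(2) in \<open>simp add: inner_commute\<close>)
  then show ?thesis by simp
qed

lemma span_UNIV_if_orthogonal_0:
  fixes B :: "'a::euclidean_space set"
  assumes "\<And>x. (\<And>b. b \<in> B \<Longrightarrow> b \<bullet> x = 0) \<Longrightarrow> x = 0"
  shows "span B = UNIV"
proof (rule ccontr)
  assume "span B \<noteq> UNIV"
  then have "dim B < DIM('a)"
    using dim_eq_full[of B] dim_subset_UNIV[of B] by (simp add: order_less_le)
  then obtain x where x: "x \<noteq> 0" "\<And>y. y \<in> span B \<Longrightarrow> orthogonal x y"
    using orthogonal_to_subspace_exists by blast
  have "b \<bullet> x = 0" if "b \<in> B" for b
    using x(2)[OF span_base[OF that]] by (simp add: orthogonal_def inner_commute)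
  then show False using assms x(1) by blast
qed

context
  fixes B :: "'a::euclidean_space set" and w :: "'a \<Rightarrow> 'a"
  assumes indep: "independent B" and span: "span B = UNIV"
    and dual: "\<And>b b'. b \<in> B \<Longrightarrow> b' \<in> B \<Longrightarrow> w b \<bullet> b' = (if b = b' then 1 else 0)"
begin

lemma dual_expand: "x = (\<Sum>b\<in>B. (b \<bullet> x) *\<^sub>R w b)"
proof -
  have fin: "finite B" using indep by (rule independent_imp_finite)
  have "x - (\<Sum>b\<in>B. (b \<bullet> x) *\<^sub>R w b) = 0"
  proof (rule eq_0_if_orthogonal_basis[OF span])
    fix c assume c: "c \<in> B"
    have "c \<bullet> (\<Sum>b\<in>B. (b \<bullet> x) *\<^sub>R w b) = (\<Sum>b\<in>B. if b = c then b \<bullet> x else 0)"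
      unfolding inner_sum_right by (rule sum.cong) (use dual c in \<open>auto simp: inner_commute[of c]\<close>)
    also have "\<dots> = c \<bullet> x" using c fin by simp
    finally show "c \<bullet> (x - (\<Sum>b\<in>B. (b \<bullet> x) *\<^sub>R w b)) = 0" by (simp add: inner_diff_right)
  qed
  then show ?thesis by simp
qed

lemma basis_expand: "x = (\<Sum>b\<in>B. (w b \<bullet> x) *\<^sub>R b)"
proof -
  have fin: "finite B" using indep by (rule independent_imp_finite)
  have "x \<in> span B" using span by simp
  then obtain u where u: "x = (\<Sum>b\<in>B. u b *\<^sub>R b)" by (auto simp: span_finite[OF fin])
  have "w c \<bullet> x = u c" if c: "c \<in> B" for c
  proof -
    have "w c \<bullet> x = (\<Sum>b\<in>B. if b = c then u b else 0)"
      unfolding u inner_sum_right by (rule sum.cong) (use dual c in auto)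
    then show ?thesis using c fin by simp
  qed
  then show ?thesis using u by simp
qed

lemma inj_on_dual: "inj_on w B"
  by (rule inj_onI) (metis dual zero_neq_one)

lemma independent_dual: "independent (w ` B)"
proof (rule independent_if_scalars_zero)
  show "finite (w ` B)" using independent_imp_finite[OF indep] by simp
  fix f x assume 0: "(\<Sum>x\<in>w ` B. f x *\<^sub>R x) = 0" and "x \<in> w ` B"
  then obtain c where c: "c \<in> B" "x = w c" by blast
  have "0 = (\<Sum>x\<in>w ` B. f x *\<^sub>R x) \<bullet> c" using 0 by simp
  also have "\<dots> = (\<Sum>b\<in>B. f (w b) * (w b \<bullet> c))"
    by (simp add: sum.reindex[OF inj_on_dual] inner_sum_left)
  also have "\<dots> = (\<Sum>b\<in>B. if b = c then f (w b) else 0)"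
    by (rule sum.cong) (use dual c in auto)
  also have "\<dots> = f x" using c independent_imp_finite[OF indep] by simp
  finally show "f x = 0" by simp
qed

text \<open>The generators are the dual basis: the coordinates of \<open>x\<close> in it are the
  products with the elements of \<open>B\<close>.\<close>

lemma halfspaces_eq_cone_hull: "{x. \<forall>b\<in>B. 0 \<le> b \<bullet> x} = convex_cone hull (w ` B)"
proof
  show "convex_cone hull (w ` B) \<subseteq> {x. \<forall>b\<in>B. 0 \<le> b \<bullet> x}"
  proof (rule hull_minimal)
    show "w ` B \<subseteq> {x. \<forall>b\<in>B. 0 \<le> b \<bullet> x}" using dual by (auto simp: inner_commute)
    show "convex_cone {x. \<forall>b\<in>B. 0 \<le> b \<bullet> x}"
      by (auto simp: convex_cone_iff inner_add_right)
  qed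
  show "{x. \<forall>b\<in>B. 0 \<le> b \<bullet> x} \<subseteq> convex_cone hull (w ` B)"
  proof
    fix x assume x: "x \<in> {x. \<forall>b\<in>B. 0 \<le> b \<bullet> x}"
    have "(\<Sum>b\<in>A. (b \<bullet> x) *\<^sub>R w b) \<in> convex_cone hull (w ` B)" if "finite A" "A \<subseteq> B" for A
      using that
    proof (induction A rule: finite_induct)
      case (insert a A)
      have "(a \<bullet> x) *\<^sub>R w a \<in> convex_cone hull (w ` B)"
        by (rule convex_cone_hull_mul) (use insert.prems x in \<open>auto intro: hull_inc\<close>)
      then show ?case using insert by (simp add: convex_cone_hull_add)
    qed (simp add: convex_cone_hull_contains_0)
    from this[OF independent_imp_finite[OF indep] order_refl]
    show "x \<in> convex_cone hull (w ` B)" using dual_expand[of x] by simp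
  qed
qed

end

lemma simplicial_cone_halfspaces:
  fixes B :: "'a::euclidean_space set"
  assumes "independent B" "span B = UNIV"
  shows "simplicial_cone {x. \<forall>b\<in>B. 0 \<le> b \<bullet> x}"
proof -
  obtain w where w: "\<And>b b'. b \<in> B \<Longrightarrow> b' \<in> B \<Longrightarrow> w b \<bullet> b' = (if b = b' then 1 else 0)"
    using dual_basis[OF assms(1)] by blast
  show ?thesis
    unfolding simplicial_cone_def
    using halfspaces_eq_cone_hull[OF assms w] independent_dual[OF assms w] by blast
qed

section \<open>Faces of finitely generated cones\<close>

lemma convex_cone_hull_finite:
  fixes B :: "'a::real_vector set"
  assumes "finite B" "x \<in> convex_cone hull B"
  obtains c where "\<And>b. b \<in> B \<Longrightarrow> 0 \<le> c b" "x = (\<Sum>b\<in>B. c b *\<^sub>R b)"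
proof -
  let ?S = "{\<Sum>b\<in>B. c b *\<^sub>R b |c. \<forall>b\<in>B. (0::real) \<le> c b}"
  have "convex_cone hull B \<subseteq> ?S"
  proof (rule hull_minimal)
    show "B \<subseteq> ?S"
    proof
      fix b assume b: "b \<in> B"
      have "(\<Sum>b'\<in>B. (if b' = b then 1 else 0) *\<^sub>R b') = (\<Sum>b'\<in>B. if b' = b then b' else 0)"
        by (rule sum.cong) auto
      then have "b = (\<Sum>b'\<in>B. (if b' = b then 1 else 0) *\<^sub>R b')" using b assms(1) by simp
      then show "b \<in> ?S" by (intro CollectI exI[of _ "\<lambda>b'. if b' = b then 1 else 0"]) auto
    qed
    show "convex_cone ?S"
      unfolding convex_cone_iff
    proof (intro conjI ballI allI impI)
      show "0 \<in> ?S" by (intro CollectI exI[of _ "\<lambda>_. 0"]) auto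
      fix x y assume "x \<in> ?S" "y \<in> ?S"
      then obtain c d where "x = (\<Sum>b\<in>B. c b *\<^sub>R b)" "y = (\<Sum>b\<in>B. d b *\<^sub>R b)"
        "\<forall>b\<in>B. 0 \<le> c b" "\<forall>b\<in>B. 0 \<le> d b" by blast
      then show "x + y \<in> ?S"
        by (intro CollectI exI[of _ "\<lambda>b. c b + d b"]) (auto simp: scaleR_add_left sum.distrib)
    next
      fix x and t :: real assume "x \<in> ?S" "0 \<le> t"
      then obtain c where "x = (\<Sum>b\<in>B. c b *\<^sub>R b)" "\<forall>b\<in>B. 0 \<le> c b" by blast
      then show "t *\<^sub>R x \<in> ?S" using \<open>0 \<le> t\<close>
        by (intro CollectI exI[of _ "\<lambda>b. t * c b"]) (auto simp: scaleR_sum_right)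
    qed
  qed
  then show ?thesis using assms(2) that by blast
qed

lemma convex_cone_sum:
  assumes "convex_cone C" "finite A" "\<And>a. a \<in> A \<Longrightarrow> f a \<in> C"
  shows "(\<Sum>a\<in>A. f a) \<in> C"
  using assms(2,3)
  by (induction A rule: finite_induct) (auto simp: convex_cone_contains_0[OF assms(1)] convex_cone_add[OF assms(1)])

lemma face_of_convex_cone:
  fixes C :: "'a::real_vector set"
  assumes C: "convex_cone C" and F: "F face_of C" "F \<noteq> {}"
  shows "convex_cone F"
proof -
  have sub: "F \<subseteq> C" and cvx: "convex F" using F by (auto simp: face_of_def)
  have scale: "t *\<^sub>R x \<in> F" if x: "x \<in> F" and t: "0 \<le> t" for x t
  proof (cases "x = 0")
    case False
    \<comment> \<open>The factor \<open>t + 2\<close> exceeds both 1 and \<open>t\<close>, so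
      \<open>x\<close> is interior to the segment and the multiple of \<open>x\<close> by
      \<open>t\<close> lies on it.\<close>
    have "x \<in> open_segment 0 ((t + 2) *\<^sub>R x)"
      unfolding in_segment using False t
      by (intro conjI exI[of _ "1 / (t + 2)"]) (auto simp: add_nonneg_eq_0_iff simp del: scaleR_add_left)
    moreover have "0 \<in> C" "(t + 2) *\<^sub>R x \<in> C"
      using C sub x t by (auto intro: convex_cone_contains_0 convex_cone_scaleR)
    ultimately have in_F: "0 \<in> F" "(t + 2) *\<^sub>R x \<in> F" using F(1) x by (auto simp: face_of_def)
    have "(1 - t / (t + 2)) *\<^sub>R 0 + (t / (t + 2)) *\<^sub>R ((t + 2) *\<^sub>R x) \<in> F"
      using cvx[unfolded convex_alt, rule_format, OF in_F, of "t / (t + 2)"] t by (simp add: divide_simps)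
    then show ?thesis using t by simp
  qed (use x in simp)
  obtain x0 where x0: "x0 \<in> F" using F(2) by blast
  show ?thesis
    unfolding convex_cone_iff
  proof (intro conjI ballI allI impI)
    show "0 \<in> F" using scale[OF x0, of 0] by simp
    fix x y assume xy: "x \<in> F" "y \<in> F"
    have "(1 - 1/2) *\<^sub>R x + (1/2) *\<^sub>R y \<in> F" using cvx[unfolded convex_alt, rule_format, OF xy, of "1/2"] by simp
    then have "2 *\<^sub>R ((1 - 1/2) *\<^sub>R x + (1/2) *\<^sub>R y) \<in> F" by (rule scale) simp
    then show "x + y \<in> F" by (simp add: scaleR_add_right)
  qed (rule scale)
qed

lemma face_of_cone_hull:
  fixes B :: "'a::real_vector set"
  assumes B: "finite B" and F: "F face_of (convex_cone hull B)" "F \<noteq> {}"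
  shows "F = convex_cone hull (B \<inter> F)"
proof
  let ?C = "convex_cone hull B"
  have C: "convex_cone ?C" by (rule convex_cone_convex_cone_hull)
  have coneF: "convex_cone F" by (rule face_of_convex_cone[OF C F])
  show "convex_cone hull (B \<inter> F) \<subseteq> F" by (rule hull_minimal) (use coneF in auto)
  show "F \<subseteq> convex_cone hull (B \<inter> F)"
  proof
    fix x assume x: "x \<in> F"
    then have "x \<in> ?C" using F by (auto simp: face_of_def)
    then obtain c where c: "\<And>b. b \<in> B \<Longrightarrow> 0 \<le> c b" "x = (\<Sum>b\<in>B. c b *\<^sub>R b)"
      using convex_cone_hull_finite[OF B] by blast
    have mem: "b \<in> F" if b: "b \<in> B" "c b \<noteq> 0" for b
    proof -
      \<comment> \<open>As \<open>b\<close> carries a nonzero coefficient, \<open>x\<close> is the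
        midpoint of a positive multiple of \<open>b\<close> and twice the remaining sum. The face
        property puts that multiple of \<open>b\<close> into \<open>F\<close>.\<close>
      define y where "y = 2 *\<^sub>R (\<Sum>b'\<in>B - {b}. c b' *\<^sub>R b')"
      define z where "z = (2 * c b) *\<^sub>R b"
      have yC: "y \<in> ?C" unfolding y_def
        by (intro convex_cone_scaleR[OF C] convex_cone_sum[OF C]) (use B c in \<open>auto intro: hull_inc\<close>)
      have zC: "z \<in> ?C" unfolding z_def
        by (intro convex_cone_scaleR[OF C]) (use b c in \<open>auto intro: hull_inc\<close>)
      have "x = c b *\<^sub>R b + (\<Sum>b'\<in>B - {b}. c b' *\<^sub>R b')" unfolding c(2) using B b by (simp add: sum.remove)
      then have xyz: "x = (1 - 1/2) *\<^sub>R y + (1/2) *\<^sub>R z" by (simp add: y_def z_def)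
      have "z \<in> F"
      proof (cases "y = z")
        case True
        then have "x = z" unfolding xyz by (simp flip: scaleR_add_left)
        then show ?thesis using x by simp
      next
        case False
        then have "x \<in> open_segment y z" unfolding in_segment xyz by (intro conjI exI[of _ "1/2"]) auto
        then show ?thesis using F(1) yC zC x by (auto simp: face_of_def)
      qed
      then have "(1 / (2 * c b)) *\<^sub>R z \<in> F" using convex_cone_scaleR[OF coneF] c(1)[OF b(1)] by simp
      then show ?thesis using b by (simp add: z_def)
    qed
    have "c b *\<^sub>R b \<in> convex_cone hull (B \<inter> F)" if "b \<in> B" for b
    proof (cases "c b = 0")
      case False
      then show ?thesis using mem[OF that] that c by (intro convex_cone_hull_mul hull_inc) auto
    qed (simp add: convex_cone_hull_contains_0)
    then show "x \<in> convex_cone hull (B \<inter> F)" unfolding c(2)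
      by (intro convex_cone_sum convex_cone_convex_cone_hull B)
  qed
qed

lemma face_of_simplicial_cone:
  assumes "simplicial_cone C" "F face_of C" "F \<noteq> {}"
  shows "simplicial_cone F"
proof -
  obtain B where B: "independent B" "C = convex_cone hull B"
    using assms(1) by (auto simp: simplicial_cone_def)
  have "F = convex_cone hull (B \<inter> F)"
    using face_of_cone_hull[OF independent_imp_finite[OF B(1)]] assms B by simp
  then show ?thesis
    unfolding simplicial_cone_def using independent_mono[OF B(1), of "B \<inter> F"] by auto
qed

lemma simplicial_cone_polyhedron: "simplicial_cone C \<Longrightarrow> polyhedron C"
  using polyhedron_convex_cone_hull independent_imp_finite by (auto simp: simplicial_cone_def)

lemma simplicial_cone_convex_cone: "simplicial_cone C \<Longrightarrow> convex_cone C"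
  using convex_cone_convex_cone_hull by (auto simp: simplicial_cone_def)

text \<open>Only maximal cones need to be compared: two faces \<open>F\<close> and \<open>F'\<close>
  meet in the intersection of two faces of the common face \<open>C \<inter> C'\<close>.\<close>

lemma simplicial_fan_faces:
  fixes \<C> :: "'a::euclidean_space set set"
  assumes fin: "finite \<C>" "\<C> \<noteq> {}" and simp: "\<And>C. C \<in> \<C> \<Longrightarrow> simplicial_cone C"
    and int: "\<And>C C'. C \<in> \<C> \<Longrightarrow> C' \<in> \<C> \<Longrightarrow> C \<inter> C' face_of C"
  shows "simplicial_fan {F. F \<noteq> {} \<and> (\<exists>C\<in>\<C>. F face_of C)}"
proof -
  let ?F = "{F. F \<noteq> {} \<and> (\<exists>C\<in>\<C>. F face_of C)}"
  have sF: "simplicial_cone F" if "F \<in> ?F" for F using that face_of_simplicial_cone simp by blast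
  have finF: "finite ?F"
  proof (rule finite_subset)
    show "?F \<subseteq> (\<Union>C\<in>\<C>. {F. F face_of C})" by blast
    show "finite (\<Union>C\<in>\<C>. {F. F face_of C})"
      using fin finite_polyhedron_faces[OF simplicial_cone_polyhedron[OF simp]] by blast
  qed
  obtain C where C: "C \<in> \<C>" using fin by blast
  then have "C \<in> ?F"
    using simplicial_cone_convex_cone[OF simp[OF C]]
    by (auto simp: convex_cone_def intro!: bexI[of _ C] face_of_refl)
  then have neF: "?F \<noteq> {}" by blast
  have intF: "F \<inter> F' face_of F" if F: "F \<in> ?F" "F' \<in> ?F" for F F'
  proof -
    obtain C C' where C: "C \<in> \<C>" "F face_of C" "C' \<in> \<C>" "F' face_of C'" using F by blast
    have 1: "C \<inter> C' face_of C" using int C by blast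
    have 2: "C \<inter> C' face_of C'" using int[OF C(3,1)] by (simp add: Int_commute)
    have "F \<inter> C' face_of C \<inter> C'"
    proof (rule face_of_subset[of _ C])
      have "F \<inter> C' = F \<inter> (C \<inter> C')" using face_of_imp_subset[OF C(2)] by blast
      then show "F \<inter> C' face_of C" using face_of_Int[OF C(2) 1] by simp
    qed (use face_of_imp_subset[OF C(2)] in auto)
    moreover have "C \<inter> F' face_of C \<inter> C'"
    proof (rule face_of_subset[of _ C'])
      have "C \<inter> F' = F' \<inter> (C \<inter> C')" using face_of_imp_subset[OF C(4)] by blast
      then show "C \<inter> F' face_of C'" using face_of_Int[OF C(4) 2] by simp
    qed (use face_of_imp_subset[OF C(4)] in auto)
    ultimately have "(F \<inter> C') \<inter> (C \<inter> F') face_of C \<inter> C'" by (rule face_of_Int)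
    moreover have "(F \<inter> C') \<inter> (C \<inter> F') = F \<inter> F'"
      using face_of_imp_subset[OF C(2)] face_of_imp_subset[OF C(4)] by blast
    ultimately have "F \<inter> F' face_of C" using face_of_trans[OF _ 1] by simp
    then show ?thesis by (rule face_of_subset) (use face_of_imp_subset[OF C(2)] in auto)
  qed
  have "fan ?F"
    unfolding fan_def
  proof (intro conjI ballI allI impI)
    show "finite ?F" "?F \<noteq> {}" by (fact finF neF)+
    show "polyhedron C" "convex_cone C" if "C \<in> ?F" for C
      using simplicial_cone_polyhedron simplicial_cone_convex_cone sF[OF that] by auto
    show "F \<in> ?F" if "C \<in> ?F" "F face_of C \<and> F \<noteq> {}" for C F
      using that face_of_trans by blast
    show "C \<inter> C' face_of C" if "C \<in> ?F" "C' \<in> ?F" for C C' by (rule intF[OF that])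
    show "C \<inter> C' face_of C'" if "C \<in> ?F" "C' \<in> ?F" for C C'
      using intF[OF that(2,1)] by (simp add: Int_commute)
  qed
  then show ?thesis using sF by (simp add: simplicial_fan_def)
qed

section \<open>Polytopes with simplicial normal fan\<close>

text \<open>At a vertex the simplicial normal cone is generated by a basis \<open>B\<close> of the
  space. Each generator exposes one facet through the vertex and every facet through it arises so,
  which gives as many facets as the dimension.\<close>

lemma simple_polytope_if_normal_fan_simplicial:
  fixes P :: "'a::euclidean_space set"
  assumes P: "polytope P" and simp: "\<And>C. C \<in> normal_fan P \<Longrightarrow> simplicial_cone C"
  shows "simple_polytope P"
  unfolding simple_polytope_def
proof (intro conjI allI impI)
  fix v assume v: "v extreme_point_of P"
  define N where "N = normal_cone P {v}"
  have vP: "v \<in> P" using v by (simp add: extreme_point_of_def)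
  have N: "y \<in> N \<longleftrightarrow> (\<forall>x\<in>P. y \<bullet> x \<le> y \<bullet> v)" for y by (simp add: N_def normal_cone_def)
  have vface: "{v} face_of P" using v by (simp add: face_of_singleton)
  have "N \<in> normal_fan P" using vface by (auto simp: normal_fan_def N_def)
  then obtain B where B: "independent B" "N = convex_cone hull B"
    using simp by (auto simp: simplicial_cone_def)
  have finB: "finite B" using B(1) by (rule independent_imp_finite)
  have BN: "b \<in> N" if "b \<in> B" for b using that B(2) by (simp add: hull_inc)
  have poly: "polyhedron P" using P by (rule polytope_imp_polyhedron)
  \<comment> \<open>The vertex is exposed by some \<open>a\<close>. The functionals smaller at each
    of the other finitely many generators of \<open>P\<close> than at \<open>v\<close> form an open
    set around \<open>a\<close> inside the normal cone, so that cone has full dimension.\<close>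
  have spanB: "span B = UNIV"
  proof -
    have "{v} exposed_face_of P" using vface exposed_face_of_polyhedron[OF poly] by simp
    then obtain a c where ac: "P \<subseteq> {x. a \<bullet> x \<le> c}" "{v} = P \<inter> {x. a \<bullet> x = c}"
      by (auto simp: exposed_face_of_def)
    obtain V where V: "finite V" "P = convex hull V" using P by (auto simp: polytope_def)
    let ?U = "\<Inter>x\<in>V - {v}. {y. (x - v) \<bullet> y < 0}"
    have "open ?U" using V(1) by (intro open_INT) (auto simp: open_halfspace_lt)
    moreover have "?U \<subseteq> N"
    proof
      fix y assume y: "y \<in> ?U"
      have "y \<bullet> x \<le> y \<bullet> v" if "x \<in> V" for x
      proof (cases "x = v")
        case False
        then have "(x - v) \<bullet> y < 0" using y that by blast
        then show ?thesis by (simp add: inner_diff_right inner_commute[of _ y])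
      qed simp
      then have "V \<subseteq> {x. y \<bullet> x \<le> y \<bullet> v}" by blast
      then have "P \<subseteq> {x. y \<bullet> x \<le> y \<bullet> v}"
        unfolding V(2) by (rule hull_minimal) (simp add: convex_halfspace_le)
      then show "y \<in> N" by (auto simp: N)
    qed
    moreover have "a \<in> ?U"
    proof (rule INT_I)
      fix x assume x: "x \<in> V - {v}"
      have "x \<in> P" using x V(2) by (simp add: hull_inc)
      then have "a \<bullet> x \<le> c" "a \<bullet> x \<noteq> c" using ac x by auto
      moreover have "a \<bullet> v = c" using ac by blast
      ultimately show "a \<in> {y. (x - v) \<bullet> y < 0}" by (simp add: inner_commute[of _ a] inner_diff_right)
    qed
    ultimately have "interior N \<noteq> {}" using interior_maximal by blast
    moreover have "N \<subseteq> span B" unfolding B(2)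
      by (rule hull_minimal) (auto simp: span_superset convex_cone_span)
    ultimately have "interior (span B) \<noteq> {}" using interior_mono by blast
    then have "\<not> dim (span B) < DIM('a)" using empty_interior_lowdim by blast
    then have "dim (span B) = DIM('a)" using dim_subset_UNIV[of "span B"] by simp
    then show ?thesis by (simp add: dim_eq_full)
  qed
  have cardB: "card B = DIM('a)"
    using dim_eq_card_independent[OF B(1)] spanB dim_eq_full[of B] by simp
  obtain w where w: "\<And>b b'. b \<in> B \<Longrightarrow> b' \<in> B \<Longrightarrow> w b \<bullet> b' = (if b = b' then 1 else 0)"
    using dual_basis[OF B(1)] by blast
  \<comment> \<open>A direction with nonpositive product with all generators of the normal cone is
    feasible: the normal of an active half-space is a nonnegative combination of them, and inactive
    half-spaces leave room for small \<open>t\<close>.\<close>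
  have move: "\<exists>t>0. v + t *\<^sub>R d \<in> P" if d: "\<And>b. b \<in> B \<Longrightarrow> b \<bullet> d \<le> 0" for d
  proof -
    obtain \<H> where H: "finite \<H>" "P = \<Inter>\<H>" "\<And>h. h \<in> \<H> \<Longrightarrow> \<exists>a b. a \<noteq> 0 \<and> h = {x. a \<bullet> x \<le> b}"
      using poly by (auto simp: polyhedron_def)
    have "\<forall>\<^sub>F t in at_right 0. v + t *\<^sub>R d \<in> h" if h: "h \<in> \<H>" for h
    proof -
      obtain a b where ab: "h = {x. a \<bullet> x \<le> b}" using H(3)[OF h] by blast
      have Ph: "P \<subseteq> h" using H(2) h by blast
      then have avb: "a \<bullet> v \<le> b" using vP ab by auto
      show ?thesis
      proof (cases "a \<bullet> v = b")
        case True
        then have "a \<in> N" using Ph ab by (auto simp: N)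
        then obtain c where c: "\<And>b. b \<in> B \<Longrightarrow> 0 \<le> c b" "a = (\<Sum>b\<in>B. c b *\<^sub>R b)"
          using convex_cone_hull_finite[OF finB] B(2) by blast
        have ad: "a \<bullet> d \<le> 0"
          unfolding c(2) inner_sum_left by (rule sum_nonpos) (use c d in \<open>simp add: mult_nonneg_nonpos\<close>)
        have "\<forall>\<^sub>F t in at_right (0::real). 0 < t" by (simp add: eventually_at_right_less)
        then show ?thesis
          by eventually_elim (use ad True ab in \<open>simp add: inner_add_right mult_nonneg_nonpos\<close>)
      next
        case False
        have "((\<lambda>t. a \<bullet> (v + t *\<^sub>R d)) \<longlongrightarrow> a \<bullet> (v + 0 *\<^sub>R d)) (at_right 0)"
          by (intro tendsto_intros)
        then have "\<forall>\<^sub>F t in at_right 0. a \<bullet> (v + t *\<^sub>R d) < b"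
          by (rule order_tendstoD(2)) (use False avb in simp)
        then show ?thesis by eventually_elim (simp add: ab)
      qed
    qed
    then have "\<forall>\<^sub>F t in at_right 0. \<forall>h\<in>\<H>. v + t *\<^sub>R d \<in> h"
      by (intro eventually_ball_finite H(1)) auto
    moreover have "\<forall>\<^sub>F t in at_right (0::real). 0 < t" by (simp add: eventually_at_right_less)
    ultimately have "\<forall>\<^sub>F t in at_right 0. 0 < t \<and> v + t *\<^sub>R d \<in> P"
      by eventually_elim (simp add: H(2))
    then show ?thesis using eventually_happens'[OF trivial_limit_at_right_real] by blast
  qed
  \<comment> \<open>The negated dual basis vectors are the edge directions at \<open>v\<close>: each
    leaves one supporting hyperplane of a generator and stays in all others.\<close>
  have "\<exists>t>0. v + t *\<^sub>R (- w b) \<in> P" if "b \<in> B" for b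
    by (rule move) (use w that in \<open>auto simp: inner_commute\<close>)
  then obtain t where t: "\<And>b. b \<in> B \<Longrightarrow> t b > 0" "\<And>b. b \<in> B \<Longrightarrow> v + t b *\<^sub>R (- w b) \<in> P" by metis
  define G where "G = (\<lambda>b. P \<inter> {x. b \<bullet> x = b \<bullet> v})"
  have Gmem: "v + t b' *\<^sub>R (- w b') \<in> G b \<longleftrightarrow> b \<noteq> b'" if "b \<in> B" "b' \<in> B" for b b'
  proof -
    have "b \<bullet> (v + t b' *\<^sub>R (- w b')) = b \<bullet> v - t b' * (b \<bullet> w b')"
      by (simp add: inner_diff_right)
    then show ?thesis
      using t(1,2)[OF that(2)] w[OF that(2,1)] by (simp add: G_def inner_commute[of b "w b'"])
  qed
  have aff: "aff_dim P = int DIM('a)"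
  proof (rule ccontr)
    assume "aff_dim P \<noteq> int DIM('a)"
    then have "aff_dim P < int DIM('a)" using aff_dim_le_DIM[of P] by simp
    then obtain a c where ac: "a \<noteq> 0" "P \<subseteq> {x. a \<bullet> x = c}" using aff_lowdim_subset_hyperplane by blast
    have "a \<bullet> w b = 0" if b: "b \<in> B" for b
    proof -
      have "a \<bullet> (v + t b *\<^sub>R (- w b)) = a \<bullet> v" using ac vP t(2)[OF b] by auto
      then show ?thesis using t(1)[OF b] by (simp add: inner_diff_right)
    qed
    then have "a = 0" using basis_expand[OF B(1) spanB w, of a] by (simp add: inner_commute)
    with ac show False by simp
  qed
  have Gface: "G b face_of P" if "b \<in> B" for b
    unfolding G_def
    by (rule face_of_Int_supporting_hyperplane_le[OF polyhedron_imp_convex[OF poly]])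
      (use BN[OF that] N in auto)
  have vG: "v \<in> G b" for b using vP by (simp add: G_def)
  have Gfacet: "G b facet_of P" if b: "b \<in> B" for b
  proof -
    have "aff_dim (G b) \<le> aff_dim P - 1"
    proof -
      have "G b \<noteq> P" using Gmem[OF b b] t(2)[OF b] by auto
      then show ?thesis
        using face_of_aff_dim_lt[OF polyhedron_imp_convex[OF poly] Gface[OF b]] by simp
    qed
    moreover have "aff_dim P - 1 \<le> aff_dim (G b)"
    proof -
      let ?T = "(+) (- v) ` G b"
      have "0 \<in> ?T" using vG[of b] by force
      then have dimT: "aff_dim (G b) = int (dim ?T)"
        using aff_dim_zero[of ?T] aff_dim_translation_eq[of "- v" "G b"] by (simp add: hull_inc)
      have "w ` (B - {b}) \<subseteq> span ?T"
      proof
        fix x assume "x \<in> w ` (B - {b})"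
        then obtain b' where b': "b' \<in> B" "b' \<noteq> b" "x = w b'" by blast
        have "v + t b' *\<^sub>R (- w b') \<in> G b" using Gmem[OF b b'(1)] b'(2) by simp
        then have "- v + (v + t b' *\<^sub>R (- w b')) \<in> ?T" by blast
        then have "(- 1 / t b') *\<^sub>R (- v + (v + t b' *\<^sub>R (- w b'))) \<in> span ?T"
          by (intro span_scale span_base)
        then show "x \<in> span ?T" using t(1)[OF b'(1)] b'(3) by simp
      qed
      then have "dim (w ` (B - {b})) \<le> dim ?T" by (rule dim_subset[THEN order_trans]) simp
      moreover have "independent (w ` (B - {b}))"
        by (rule independent_mono[OF independent_dual[OF B(1) spanB w]]) auto
      then have "dim (w ` (B - {b})) = card (B - {b})"
        using dim_eq_card_independent[of "w ` (B - {b})"]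
          card_image[OF inj_on_subset[OF inj_on_dual[OF B(1) spanB w]], of "B - {b}"] by auto
      moreover have "card (B - {b}) = DIM('a) - 1" using cardB b finB by simp
      ultimately show ?thesis using dimT aff by linarith
    qed
    ultimately show ?thesis using Gface[OF b] vG[of b] by (auto simp: facet_of_def)
  qed
  have "{F. F facet_of P \<and> v \<in> F} = G ` B"
  proof
    show "G ` B \<subseteq> {F. F facet_of P \<and> v \<in> F}" using Gfacet vG by blast
    show "{F. F facet_of P \<and> v \<in> F} \<subseteq> G ` B"
    proof clarify
      fix F assume F: "F facet_of P" "v \<in> F"
      have Fface: "F face_of P" using F(1) by (simp add: facet_of_def)
      have "F exposed_face_of P" using Fface exposed_face_of_polyhedron[OF poly] by simp
      then obtain a c where ac: "P \<subseteq> {x. a \<bullet> x \<le> c}" "F = P \<inter> {x. a \<bullet> x = c}"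
        by (auto simp: exposed_face_of_def)
      have avc: "a \<bullet> v = c" using F(2) ac by blast
      have FP: "F \<noteq> P" using F(1) by (auto simp: facet_of_def)
      have a0: "a \<noteq> 0" using FP ac avc by auto
      have "a \<in> N" using ac(1) avc by (auto simp: N)
      then obtain k where k: "\<And>b. b \<in> B \<Longrightarrow> 0 \<le> k b" "a = (\<Sum>b\<in>B. k b *\<^sub>R b)"
        using convex_cone_hull_finite[OF finB] B(2) by blast
      have "\<exists>b\<in>B. k b \<noteq> 0"
      proof (rule ccontr)
        assume "\<not> ?thesis"
        then have "(\<Sum>b\<in>B. k b *\<^sub>R b) = 0" by (intro sum.neutral) auto
        with a0 show False using k(2) by simp
      qed
      \<comment> \<open>A generator used by the functional that exposes \<open>F\<close> is constant
        on \<open>F\<close>, so \<open>F\<close> lies in the facet \<open>G b\<close>; equal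
        dimensions make them equal.\<close>
      then obtain b where b: "b \<in> B" "k b \<noteq> 0" by blast
      have "F \<subseteq> G b"
      proof
        fix x assume x: "x \<in> F"
        then have xP: "x \<in> P" and "a \<bullet> x = a \<bullet> v" using ac avc by auto
        then have "(\<Sum>b\<in>B. k b * (b \<bullet> v - b \<bullet> x)) = 0"
          using k(2) by (simp add: inner_sum_left right_diff_distrib sum_subtractf)
        moreover have "0 \<le> k b * (b \<bullet> v - b \<bullet> x)" if "b \<in> B" for b
          using k(1)[OF that] BN[OF that] xP by (simp add: N)
        ultimately have "k b * (b \<bullet> v - b \<bullet> x) = 0"
          using sum_nonneg_eq_0_iff[OF finB, of "\<lambda>b. k b * (b \<bullet> v - b \<bullet> x)"] b(1) by simp
        then show "x \<in> G b" using b xP by (simp add: G_def)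
      qed
      moreover have "F face_of G b"
        by (rule face_of_subset[OF Fface]) (use calculation face_of_imp_subset[OF Gface[OF b(1)]] in auto)
      moreover have "aff_dim F = aff_dim (G b)" using F(1) Gfacet[OF b(1)] by (simp add: facet_of_def)
      ultimately have "F = G b"
        using face_of_aff_dim_lt[of "G b" F] face_of_imp_convex[OF Gface[OF b(1)]] by fastforce
      then show "F \<in> G ` B" using b by blast
    qed
  qed
  moreover have "inj_on G B" by (rule inj_onI) (metis Gmem)
  ultimately show "int (card {F. F facet_of P \<and> v \<in> F}) = aff_dim P"
    using aff cardB by (simp add: card_image)
qed (rule P)

section \<open>Reflection groups permuting a chain of vectors\<close>

lemma linear_reflection: "linear (reflection a)"
  by (rule linearI) (simp_all add: reflection_def inner_add_right algebra_simps add_divide_distrib)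

lemma reflection_self: "reflection a a = - a"
  by (cases "a = 0") (simp_all add: reflection_def scaleR_2)

lemma reflection_involution: "reflection a (reflection a x) = x"
  by (cases "a = 0") (simp_all add: reflection_def inner_diff_right)

lemma reflection_comp_self: "reflection a \<circ> reflection a = id"
  by (rule ext) (simp add: reflection_involution)

lemma inner_reflection: "reflection a x \<bullet> y = x \<bullet> reflection a y"
  by (simp add: reflection_def inner_diff_left inner_diff_right inner_commute)

lemma reflection_eq_imp_parallel:
  assumes "reflection a = reflection b"
  shows "b = ((a \<bullet> b) / (a \<bullet> a)) *\<^sub>R a"
proof -
  have "b - (2 * (a \<bullet> b) / (a \<bullet> a)) *\<^sub>R a = - b"
    using assms reflection_self[of b] by (simp add: reflection_def fun_eq_iff)
  then have "2 *\<^sub>R b = (2 * (a \<bullet> b) / (a \<bullet> a)) *\<^sub>R a"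
    by (metis add.commute diff_eq_eq scaleR_2 uminus_add_conv_diff)
  then have "(1/2) *\<^sub>R (2 *\<^sub>R b) = (1/2) *\<^sub>R ((2 * (a \<bullet> b) / (a \<bullet> a)) *\<^sub>R a)" by simp
  then show ?thesis by simp
qed

lemma word_product_simps [simp]:
  "word_product [] = id" "word_product (s # ws) = s \<circ> word_product ws"
  by (simp_all add: word_product_def)

lemma word_product_append: "word_product (xs @ ys) = word_product xs \<circ> word_product ys"
  by (induction xs) (simp_all add: comp_assoc)

lemma word_product_rev:
  assumes "\<And>s. s \<in> set ws \<Longrightarrow> s \<circ> s = id"
  shows "word_product (rev ws) \<circ> word_product ws = id"
  using assms
proof (induction ws)
  case (Cons s ws)
  have "word_product (rev (s # ws)) \<circ> word_product (s # ws)
      = word_product (rev ws) \<circ> (s \<circ> s) \<circ> word_product ws"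
    by (simp add: word_product_append comp_assoc)
  also have "\<dots> = word_product (rev ws) \<circ> word_product ws"
    using Cons.prems[of s] by (simp only: list.set_intros comp_id)
  also have "\<dots> = id"
  proof (rule Cons.IH)
    fix t assume "t \<in> set ws"
    then show "t \<circ> t = id" by (intro Cons.prems) simp
  qed
  finally show ?case .
qed simp

definition gap :: "(nat \<Rightarrow> 'a::real_vector) \<Rightarrow> nat \<Rightarrow> 'a" where
  "gap e g = e (Suc g) - e g"

text \<open>
  Type A is the unfolded case and type B the folded one, where \<open>e (N + 1 - k) = - e k\<close> and a
  simple reflection exchanges the neighbours at two gaps simultaneously, except at the central gap.
\<close>

locale chain =
  fixes N :: nat and e :: "nat \<Rightarrow> 'a::euclidean_space" and folded :: bool
  assumes act: "g \<in> {1..<N} \<Longrightarrow> k \<in> {1..N} \<Longrightarrow>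
      reflection (gap e g) (e k) = e (swap_gaps {h \<in> {1..<N}. gap e h = gap e g} k)"
    and adjacent: "1 \<le> g \<Longrightarrow> Suc g < N \<Longrightarrow> gap e g \<bullet> gap e (Suc g) < 0"
    and obtuse: "g \<in> {1..<N} \<Longrightarrow> h \<in> {1..<N} \<Longrightarrow> gap e g \<noteq> gap e h \<Longrightarrow> gap e g \<bullet> gap e h \<le> 0"
    and indep: "independent (gap e ` {1..<N})"
    and span: "span (gap e ` {1..<N}) = UNIV"
    and unfolded: "\<not> folded \<Longrightarrow> inj_on (gap e) {1..<N}"
    and folded: "folded \<Longrightarrow> even N" "folded \<Longrightarrow> k \<in> {1..N} \<Longrightarrow> e (N + 1 - k) = - e k"
      "folded \<Longrightarrow> g \<in> {1..<N} \<Longrightarrow> h \<in> {1..<N} \<Longrightarrow> gap e g = gap e h \<Longrightarrow> h = g \<or> h = N - g"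
    and finite_group: "finite (word_product ` lists (reflection ` gap e ` {1..<N}))"
begin

definition "\<Delta> = gap e ` {1..<N}"
definition "S = reflection ` \<Delta>"
definition "W = word_product ` lists S"
definition "D = {x. \<forall>d\<in>\<Delta>. 0 \<le> d \<bullet> x}"
text \<open>A set of vectors, not of index pairs. In the folded case \<open>(i, j)\<close> and
  \<open>(N + 1 - j, N + 1 - i)\<close> give the same vector, so that the size of an inversion set
  is the length there too.\<close>

definition "\<Phi> = {e j - e i |i j. 1 \<le> i \<and> i < j \<and> j \<le> N}"
definition "same_gap g = {h \<in> {1..<N}. gap e h = gap e g}"
text \<open>The point \<open>p\<close> of the overview, normalised like the vector rho of Lie
  theory: it pairs to 1 with every simple root.\<close>

definition "base = (SOME p. \<forall>d\<in>\<Delta>. d \<bullet> p = 1)"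
definition "values w k = e k \<bullet> w base"
definition "inversions w = {\<beta> \<in> \<Phi>. \<beta> \<bullet> w base < 0}"

lemma finite_W: "finite W" using finite_group by (simp add: W_def S_def \<Delta>_def)

lemma finite_\<Delta>: "finite \<Delta>" by (simp add: \<Delta>_def)

lemma gap_in: "g \<in> {1..<N} \<Longrightarrow> gap e g \<in> \<Delta>" by (simp add: \<Delta>_def)

lemma S_gap: "s \<in> S \<Longrightarrow> \<exists>g\<in>{1..<N}. s = reflection (gap e g)" by (auto simp: S_def \<Delta>_def)

lemma gap_refl_in: "g \<in> {1..<N} \<Longrightarrow> reflection (gap e g) \<in> S" by (auto simp: S_def \<Delta>_def)

lemma prescribe: "\<exists>v. \<forall>d\<in>\<Delta>. d \<bullet> v = h d"
proof -
  obtain w where w: "\<And>b b'. b \<in> \<Delta> \<Longrightarrow> b' \<in> \<Delta> \<Longrightarrow> w b \<bullet> b' = (if b = b' then 1 else 0)"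
    using dual_basis[OF indep] unfolding \<Delta>_def by blast
  have "d \<bullet> (\<Sum>b\<in>\<Delta>. h b *\<^sub>R w b) = h d" if "d \<in> \<Delta>" for d
  proof -
    have "d \<bullet> (\<Sum>b\<in>\<Delta>. h b *\<^sub>R w b) = (\<Sum>b\<in>\<Delta>. if b = d then h b else 0)"
      unfolding inner_sum_right by (rule sum.cong) (use w that in \<open>auto simp: inner_commute[of d]\<close>)
    then show ?thesis using that finite_\<Delta> by simp
  qed
  then show ?thesis by blast
qed

lemma base: "d \<in> \<Delta> \<Longrightarrow> d \<bullet> base = 1"
proof -
  have "\<exists>v. \<forall>d\<in>\<Delta>. d \<bullet> v = 1" by (rule prescribe)
  from someI_ex[OF this] show "d \<in> \<Delta> \<Longrightarrow> d \<bullet> base = 1" unfolding base_def by blast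
qed

lemma \<Delta>_eq_0: "(\<And>g. g \<in> {1..<N} \<Longrightarrow> gap e g \<bullet> x = 0) \<Longrightarrow> x = 0"
  by (rule eq_0_if_orthogonal_basis[OF span]) auto

lemma chain_le:
  assumes x: "\<And>g. g \<in> {1..<N} \<Longrightarrow> 0 \<le> gap e g \<bullet> x" and ij: "1 \<le> i" "i \<le> j" "j \<le> N"
  shows "e i \<bullet> x \<le> e j \<bullet> x"
  using ij(2,1,3)
proof (induction j rule: dec_induct)
  case (step j)
  then show ?case using x[of j] by (simp add: gap_def inner_diff_left)
qed simp

lemma chain_less:
  assumes x: "\<And>g. g \<in> {1..<N} \<Longrightarrow> 0 < gap e g \<bullet> x" and ij: "1 \<le> i" "i < j" "j \<le> N"
  shows "e i \<bullet> x < e j \<bullet> x"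
proof -
  have "e i \<bullet> x < e (Suc i) \<bullet> x" using x[of i] ij by (simp add: gap_def inner_diff_left)
  also have "\<dots> \<le> e j \<bullet> x" by (rule chain_le) (use x ij in \<open>auto intro: less_imp_le\<close>)
  finally show ?thesis .
qed

lemma root_base_pos: "\<beta> \<in> \<Phi> \<Longrightarrow> 0 < \<beta> \<bullet> base"
  using chain_less[of base] base gap_in by (fastforce simp: \<Phi>_def inner_diff_left)

lemma root_D: "\<beta> \<in> \<Phi> \<Longrightarrow> x \<in> D \<Longrightarrow> 0 \<le> \<beta> \<bullet> x"
  using chain_le[of x] by (fastforce simp: \<Phi>_def D_def \<Delta>_def inner_diff_left)

lemma gap_root: "g \<in> {1..<N} \<Longrightarrow> gap e g \<in> \<Phi>"
  by (force simp: \<Phi>_def gap_def)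

lemma finite_\<Phi>: "finite \<Phi>"
proof -
  have "\<Phi> \<subseteq> (\<lambda>(i, j). e j - e i) ` ({1..N} \<times> {1..N})" by (force simp: \<Phi>_def)
  then show ?thesis by (rule finite_subset) simp
qed

lemma same_gap_sub: "same_gap g \<subseteq> {1..<N}" by (auto simp: same_gap_def)

lemma same_gap_nonadjacent: "h \<in> same_gap g \<Longrightarrow> Suc h \<notin> same_gap g"
proof
  assume h: "h \<in> same_gap g" "Suc h \<in> same_gap g"
  then have "gap e h = gap e (Suc h)" by (simp add: same_gap_def)
  moreover have "gap e h \<bullet> gap e (Suc h) < 0" using h adjacent[of h] by (auto simp: same_gap_def)
  ultimately show False using inner_ge_zero[of "gap e (Suc h)"] by simp
qed

lemma act': "g \<in> {1..<N} \<Longrightarrow> k \<in> {1..N} \<Longrightarrow> reflection (gap e g) (e k) = e (swap_gaps (same_gap g) k)"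
  using act by (simp add: same_gap_def)

lemma act_value:
  "g \<in> {1..<N} \<Longrightarrow> k \<in> {1..N} \<Longrightarrow> e k \<bullet> reflection (gap e g) x = e (swap_gaps (same_gap g) k) \<bullet> x"
  using act' inner_reflection by metis

lemma swap_range: "k \<in> {1..N} \<Longrightarrow> swap_gaps (same_gap g) k \<in> {1..N}"
  using swap_gaps_range[OF same_gap_sub] by blast

text \<open>The exchange of neighbours keeps the order of every pair except those that it exchanges,
  and these all have the vector \<open>gap e g\<close>.\<close>

lemma reflection_root:
  assumes g: "g \<in> {1..<N}" and b: "\<beta> \<in> \<Phi>" "\<beta> \<noteq> gap e g"
  shows "reflection (gap e g) \<beta> \<in> \<Phi>"
proof -
  obtain i j where ij: "\<beta> = e j - e i" "1 \<le> i" "i < j" "j \<le> N" using b(1) by (auto simp: \<Phi>_def)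
  let ?t = "swap_gaps (same_gap g)"
  have "reflection (gap e g) \<beta> = e (?t j) - e (?t i)"
    using act'[OF g, of i] act'[OF g, of j] ij by (simp add: linear_diff[OF linear_reflection])
  moreover have "?t i < ?t j"
  proof (rule swap_gaps_less)
    show "\<not> (j = Suc i \<and> i \<in> same_gap g)" using b(2) ij(1) by (auto simp: same_gap_def gap_def)
  qed (use ij same_gap_nonadjacent in auto)
  moreover have "?t i \<in> {1..N}" "?t j \<in> {1..N}" using swap_range ij by auto
  ultimately show ?thesis by (auto simp: \<Phi>_def)
qed

lemma S_involution: "s \<in> S \<Longrightarrow> s \<circ> s = id"
  using reflection_comp_self by (auto simp: S_def)

lemma W_id: "id \<in> W" by (auto simp: W_def intro!: image_eqI[of _ _ "[]"])

lemma W_Cons: "s \<in> S \<Longrightarrow> w \<in> W \<Longrightarrow> s \<circ> w \<in> W"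
proof -
  assume s: "s \<in> S" and "w \<in> W"
  then obtain ws where "ws \<in> lists S" "w = word_product ws" by (auto simp: W_def)
  then have "s \<circ> w = word_product (s # ws)" "s # ws \<in> lists S" using s by auto
  then show ?thesis unfolding W_def by blast
qed

lemma W_S: "s \<in> S \<Longrightarrow> s \<in> W" using W_Cons[OF _ W_id] by simp

lemma W_comp: "u \<in> W \<Longrightarrow> w \<in> W \<Longrightarrow> u \<circ> w \<in> W"
proof -
  assume "u \<in> W" "w \<in> W"
  then obtain us ws where "us \<in> lists S" "u = word_product us" "ws \<in> lists S" "w = word_product ws"
    by (auto simp: W_def)
  then have "u \<circ> w = word_product (us @ ws)" "us @ ws \<in> lists S" by (auto simp: word_product_append)
  then show ?thesis unfolding W_def by blast
qed

lemma W_induct [consumes 1, case_names id step]: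
  assumes "w \<in> W" "P id"
    and step: "\<And>g w. g \<in> {1..<N} \<Longrightarrow> w \<in> W \<Longrightarrow> P w \<Longrightarrow> P (reflection (gap e g) \<circ> w)"
  shows "P w"
proof -
  have "P (word_product ws)" if "ws \<in> lists S" for ws
    using that
  proof (induction ws)
    case (Cons s ws)
    then have "s \<in> S" by simp
    then obtain g where "g \<in> {1..<N}" "s = reflection (gap e g)" using S_gap by blast
    moreover have "word_product ws \<in> W" using Cons by (auto simp: W_def)
    ultimately show ?case using step[of g "word_product ws"] Cons by (simp only: word_product_simps)
  qed (use assms(2) in \<open>simp only: word_product_simps\<close>)
  then show ?thesis using assms(1) by (auto simp: W_def)
qed

lemma W_word_inverse:
  assumes "ws \<in> lists S"
  shows "word_product (rev ws) \<circ> word_product ws = id" "word_product ws \<circ> word_product (rev ws) = id"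
  using word_product_rev[of ws] word_product_rev[of "rev ws"] S_involution assms by auto

lemma inv_word_product:
  assumes "ws \<in> lists S"
  shows "inv (word_product ws) = word_product (rev ws)"
  using W_word_inverse[OF assms] by (simp add: inv_unique_comp)

lemma W_bij: "w \<in> W \<Longrightarrow> bij w"
  using W_word_inverse o_bij by (auto simp: W_def)

lemma W_inv: "w \<in> W \<Longrightarrow> inv w \<in> W"
proof -
  assume "w \<in> W"
  then obtain ws where "ws \<in> lists S" "w = word_product ws" by (auto simp: W_def)
  then have "inv w = word_product (rev ws)" "rev ws \<in> lists S" using inv_word_product by auto
  then show ?thesis unfolding W_def by blast
qed

lemma inv_W_apply: "w \<in> W \<Longrightarrow> w (inv w x) = x" "w \<in> W \<Longrightarrow> inv w (w x) = x"
  using W_bij by (auto simp: bij_is_surj surj_f_inv_f bij_is_inj)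

lemma W_linear: "w \<in> W \<Longrightarrow> linear w"
proof (induction rule: W_induct)
  case (step g w)
  then show ?case using linear_compose[OF _ linear_reflection] by blast
qed (rule linear_id)

lemma W_inner: "w \<in> W \<Longrightarrow> w x \<bullet> w y = x \<bullet> y"
  by (induction rule: W_induct) (auto simp: inner_reflection reflection_involution)

lemma W_inner_inv: "w \<in> W \<Longrightarrow> x \<bullet> w y = inv w x \<bullet> y"
  using W_inner[of w "inv w x" y] by (simp add: inv_W_apply)

lemma W_root: "w \<in> W \<Longrightarrow> \<beta> \<in> \<Phi> \<Longrightarrow> w \<beta> \<in> \<Phi> \<or> - w \<beta> \<in> \<Phi>"
proof (induction rule: W_induct)
  case (step g w)
  note lin = linear_reflection[of "gap e g"]
  have "\<gamma> \<in> \<Phi> \<Longrightarrow> reflection (gap e g) \<gamma> \<in> \<Phi> \<or> - reflection (gap e g) \<gamma> \<in> \<Phi>" for \<gamma>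
    using reflection_root[OF step.hyps(1)] reflection_self gap_root[OF step.hyps(1)] by (metis minus_minus)
  then show ?case using step linear_neg[OF lin, of "w \<beta>"] by (metis comp_apply minus_minus)
qed simp

lemma root_generic: "w \<in> W \<Longrightarrow> \<beta> \<in> \<Phi> \<Longrightarrow> \<beta> \<bullet> w base \<noteq> 0"
proof -
  assume w: "w \<in> W" and b: "\<beta> \<in> \<Phi>"
  have "inv w \<beta> \<in> \<Phi> \<or> - inv w \<beta> \<in> \<Phi>" by (rule W_root[OF W_inv[OF w] b])
  then show ?thesis using root_base_pos[of "inv w \<beta>"] root_base_pos[of "- inv w \<beta>"] W_inner_inv[OF w] by fastforce
qed

section \<open>Length as the number of inversions\<close>

lemma finite_inversions: "finite (inversions w)"
  using finite_\<Phi> by (simp add: inversions_def)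

lemma inj_reflection: "inj (reflection a)"
  by (rule injI) (metis reflection_involution)

lemma inversions_descent:
  assumes g: "g \<in> {1..<N}" and neg: "gap e g \<bullet> w base < 0"
  shows "inversions (reflection (gap e g) \<circ> w) = reflection (gap e g) ` (inversions w - {gap e g})"
proof -
  let ?r = "reflection (gap e g)"
  have "\<beta> \<in> inversions (?r \<circ> w) \<longleftrightarrow> ?r \<beta> \<in> inversions w - {gap e g}" for \<beta>
  proof -
    have 1: "\<beta> \<bullet> (?r \<circ> w) base = ?r \<beta> \<bullet> w base" by (simp add: inner_reflection)
    have 2: "?r \<beta> \<noteq> gap e g" if "\<beta> \<in> \<Phi>"
    proof
      assume "?r \<beta> = gap e g"
      then have "\<beta> = - gap e g" using reflection_involution[of "gap e g" \<beta>] reflection_self by metis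
      then show False using root_base_pos[OF that] root_base_pos[OF gap_root[OF g]] by simp
    qed
    have 3: "gap e g \<notin> inversions (?r \<circ> w)"
      using neg by (simp add: inversions_def reflection_self flip: inner_reflection)
    show ?thesis
    proof
      assume b: "\<beta> \<in> inversions (?r \<circ> w)"
      then have "\<beta> \<in> \<Phi>" "\<beta> \<noteq> gap e g" using 3 by (auto simp: inversions_def)
      then show "?r \<beta> \<in> inversions w - {gap e g}"
        using b 1 2 reflection_root[OF g] by (auto simp: inversions_def)
    next
      assume b: "?r \<beta> \<in> inversions w - {gap e g}"
      then have "?r (?r \<beta>) \<in> \<Phi>" using reflection_root[OF g] by (auto simp: inversions_def)
      then show "\<beta> \<in> inversions (?r \<circ> w)"
        using b 1 by (auto simp: inversions_def reflection_involution)
    qed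
  qed
  note iff = this
  show ?thesis
  proof (intro set_eqI iffI)
    fix \<beta> assume "\<beta> \<in> inversions (?r \<circ> w)"
    then show "\<beta> \<in> ?r ` (inversions w - {gap e g})"
      using iff reflection_involution[of "gap e g" \<beta>] by (metis image_eqI)
  next
    fix \<beta> assume "\<beta> \<in> ?r ` (inversions w - {gap e g})"
    then obtain \<gamma> where "\<gamma> \<in> inversions w - {gap e g}" "\<beta> = ?r \<gamma>" by blast
    then show "\<beta> \<in> inversions (?r \<circ> w)" using iff[of \<beta>] by (simp add: reflection_involution)
  qed
qed

lemma card_inversions_descent:
  assumes g: "g \<in> {1..<N}" and neg: "gap e g \<bullet> w base < 0"
  shows "card (inversions w) = Suc (card (inversions (reflection (gap e g) \<circ> w)))"
proof -
  have "gap e g \<in> inversions w" using neg gap_root[OF g] by (simp add: inversions_def)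
  then have "card (inversions w) = Suc (card (inversions w - {gap e g}))"
    by (rule card.remove[OF finite_inversions])
  moreover have "card (inversions (reflection (gap e g) \<circ> w)) = card (inversions w - {gap e g})"
    unfolding inversions_descent[where w = w, OF assms] by (rule card_image[OF inj_on_subset[OF inj_reflection subset_UNIV]])
  ultimately show ?thesis by simp
qed

lemma card_inversions_ascent:
  assumes g: "g \<in> {1..<N}" and pos: "0 < gap e g \<bullet> w base"
  shows "card (inversions (reflection (gap e g) \<circ> w)) = Suc (card (inversions w))"
proof -
  have "gap e g \<bullet> (reflection (gap e g) \<circ> w) base < 0"
    using pos by (simp add: reflection_self flip: inner_reflection)
  from card_inversions_descent[where w = "reflection (gap e g) \<circ> w", OF g this] show ?thesis
    by (simp add: comp_assoc[symmetric] reflection_comp_self)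
qed

lemma values_inj: "w \<in> W \<Longrightarrow> inj_on (values w) {1..N}"
proof (rule inj_onI)
  fix i j assume w: "w \<in> W" and ij: "i \<in> {1..N}" "j \<in> {1..N}" "values w i = values w j"
  show "i = j"
  proof (rule ccontr)
    assume "i \<noteq> j"
    then have "e j - e i \<in> \<Phi> \<or> e i - e j \<in> \<Phi>" using ij by (auto simp: \<Phi>_def) (metis le_less_linear less_linear)
    then show False
      using root_generic[OF w, of "e j - e i"] root_generic[OF w, of "e i - e j"] ij(3)
      by (auto simp: values_def inner_diff_left)
  qed
qed

lemma W_permutes:
  "w \<in> W \<Longrightarrow> \<exists>\<pi>. \<pi> ` {1..N} \<subseteq> {1..N} \<and> (\<forall>k\<in>{1..N}. w (e k) = e (\<pi> k))"
proof (induction rule: W_induct)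
  case (step g w)
  then obtain \<pi> where "\<pi> ` {1..N} \<subseteq> {1..N}" "\<forall>k\<in>{1..N}. w (e k) = e (\<pi> k)" by blast
  then show ?case
    using act'[OF step.hyps(1)] swap_range
    by (intro exI[of _ "\<lambda>k. swap_gaps (same_gap g) (\<pi> k)"])
      (simp add: image_subset_iff del: atLeastAtMost_iff)
qed (auto intro: exI[of _ id])

lemma increasing_self_map:
  fixes f :: "nat \<Rightarrow> nat"
  assumes f: "f ` {1..N} \<subseteq> {1..N}" "\<And>k. 1 \<le> k \<Longrightarrow> k < N \<Longrightarrow> f k < f (Suc k)" and k: "k \<in> {1..N}"
  shows "f k = k"
proof -
  have "1 \<le> k \<Longrightarrow> k \<le> N \<Longrightarrow> k \<le> f k" for k
  proof (induction k rule: nat_induct_at_least[of 1])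
    case base then show ?case using f(1) by force
  next
    case (Suc k) then show ?case using f(2)[of k] by auto
  qed
  moreover have "k \<le> N \<Longrightarrow> 1 \<le> k \<Longrightarrow> f k \<le> k" for k
  proof (induction k rule: inc_induct)
    case base then show ?case using f(1) by force
  next
    case (step k) then show ?case using f(2)[of k] by auto
  qed
  ultimately show ?thesis using k by (simp add: le_antisym)
qed

text \<open>The inverse of \<open>w\<close> permutes the chain; without inversions it maps indices
  increasingly and so fixes every one of them.\<close>

lemma inversions_empty_imp_id:
  assumes w: "w \<in> W" and "inversions w = {}"
  shows "w = id"
proof -
  obtain \<pi> where p: "\<pi> ` {1..N} \<subseteq> {1..N}" "\<forall>k\<in>{1..N}. inv w (e k) = e (\<pi> k)"
    using W_permutes[OF W_inv[OF w]] by blast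
  have "\<pi> k < \<pi> (Suc k)" if k: "1 \<le> k" "k < N" for k
  proof (rule ccontr)
    assume "\<not> \<pi> k < \<pi> (Suc k)"
    moreover have "\<pi> l \<in> {1..N}" if "l \<in> {1..N}" for l using p(1) that by blast
    then have "\<pi> k \<in> {1..N}" "\<pi> (Suc k) \<in> {1..N}" using k by auto
    ultimately have "e (\<pi> (Suc k)) \<bullet> base \<le> e (\<pi> k) \<bullet> base"
      by (intro chain_le) (use base gap_in in auto)
    then have "gap e k \<bullet> w base \<le> 0"
      using p(2) k W_inner_inv[where w = w and x = "e k", OF w] W_inner_inv[where w = w and x = "e (Suc k)", OF w]
      by (simp add: gap_def inner_diff_left)
    then have "gap e k \<in> inversions w"
      using gap_root[of k] root_generic[OF w, of "gap e k"] k by (simp add: inversions_def)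
    then show False using assms(2) by simp
  qed
  then have "\<pi> k = k" if "k \<in> {1..N}" for k using increasing_self_map[of \<pi> k] p(1) that by blast
  then have fixed: "inv w (e k) = e k" if "k \<in> {1..N}" for k using p(2) that by simp
  have "w x = x" for x
  proof -
    have "w x - x = 0"
    proof (rule \<Delta>_eq_0)
      fix g assume g: "g \<in> {1..<N}"
      have "inv w (gap e g) = gap e g"
        unfolding gap_def linear_diff[OF W_linear[OF W_inv[OF w]]] using fixed g by simp
      then show "gap e g \<bullet> (w x - x) = 0" using W_inner_inv[OF w] by (simp add: inner_diff_right)
    qed
    then show ?thesis by simp
  qed
  then show ?thesis by (simp add: fun_eq_iff)
qed

lemma reduced_word_exists:
  "w \<in> W \<Longrightarrow> \<exists>ws\<in>lists S. length ws = card (inversions w) \<and> word_product ws = w"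
proof (induction "card (inversions w)" arbitrary: w)
  case 0
  then have "inversions w = {}" using finite_inversions by simp
  then have "w = id" using inversions_empty_imp_id 0 by blast
  then show ?case using 0 by (intro bexI[of _ "[]"]) auto
next
  case (Suc n)
  have "\<exists>g\<in>{1..<N}. gap e g \<bullet> w base < 0"
  proof (rule ccontr)
    assume "\<not> ?thesis"
    then have "w base \<in> D" by (force simp: D_def \<Delta>_def)
    then have "inversions w = {}" using root_D by (fastforce simp: inversions_def)
    then show False using Suc.hyps(2) by simp
  qed
  then obtain g where g: "g \<in> {1..<N}" "gap e g \<bullet> w base < 0" by blast
  let ?r = "reflection (gap e g)"
  have n: "n = card (inversions (?r \<circ> w))" using card_inversions_descent[where w = w, OF g] Suc.hyps(2) by simp
  have "?r \<circ> w \<in> W" using W_Cons gap_refl_in g Suc.prems by blast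
  then obtain ws where ws: "ws \<in> lists S" "length ws = n" "word_product ws = ?r \<circ> w"
    using Suc.hyps(1)[OF n] n by auto
  then have "word_product (?r # ws) = w" by (simp add: comp_assoc[symmetric] reflection_comp_self)
  then show ?case using ws g gap_refl_in Suc.hyps(2) by (intro bexI[of _ "?r # ws"]) auto
qed

lemma card_inversions_le: "ws \<in> lists S \<Longrightarrow> card (inversions (word_product ws)) \<le> length ws"
proof (induction ws)
  case Nil
  have "inversions (word_product []) = {}"
    unfolding word_product_simps using root_base_pos by (fastforce simp: inversions_def)
  then show ?case by (metis card.empty le0)
next
  case (Cons s ws)
  then have "s \<in> S" by simp
  then obtain g where g: "g \<in> {1..<N}" "s = reflection (gap e g)" using S_gap by blast
  have w: "word_product ws \<in> W" using Cons by (auto simp: W_def)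
  show ?case
  proof (cases "gap e g \<bullet> word_product ws base < 0")
    case True
    then show ?thesis
      unfolding word_product_simps g(2)
      using card_inversions_descent[where w = "word_product ws", OF g(1) True] Cons
      by (simp del: comp_apply)
  next
    case False
    then have "0 < gap e g \<bullet> word_product ws base"
      using root_generic[OF w gap_root[OF g(1)]] by simp
    then show ?thesis
      unfolding word_product_simps g(2)
      using card_inversions_ascent[where w = "word_product ws", OF g(1)] Cons
      by (simp del: comp_apply)
  qed
qed

lemma word_length_eq: "w \<in> W \<Longrightarrow> word_length S w = card (inversions w)"
  unfolding word_length_def
  by (rule Least_equality) (use reduced_word_exists card_inversions_le in auto)

lemma reduced_word_iff:
  "reduced_word S ws w \<longleftrightarrow> ws \<in> lists S \<and> word_product ws = w \<and> length ws = card (inversions w)"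
proof -
  have "w \<in> W" if "ws \<in> lists S" "word_product ws = w" using that by (auto simp: W_def)
  then show ?thesis unfolding reduced_word_def using word_length_eq by metis
qed

text \<open>Up to sign \<open>u\<close> permutes the roots. A root \<open>\<beta>\<close> is an
  inversion of the quotient when the hyperplane of \<open>u \<beta>\<close> separates
  \<open>u base\<close> from \<open>w base\<close>.\<close>

lemma card_inversions_quotient:
  assumes u: "u \<in> W" and w: "w \<in> W"
  shows "card (inversions (inv u \<circ> w)) = card ((inversions u - inversions w) \<union> (inversions w - inversions u))"
proof -
  define pos where "pos = (\<lambda>\<beta>. if u \<beta> \<in> \<Phi> then u \<beta> else - u \<beta>)"
  have lin: "linear u" by (rule W_linear[OF u])
  have neg: "- \<beta> \<notin> \<Phi>" if "\<beta> \<in> \<Phi>" for \<beta> using root_base_pos[of \<beta>] root_base_pos[of "- \<beta>"] that by fastforce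
  have range: "pos \<beta> \<in> \<Phi>" if "\<beta> \<in> \<Phi>" for \<beta> using W_root[OF u that] by (auto simp: pos_def)
  have inj: "inj_on pos \<Phi>"
  proof (rule inj_onI)
    fix \<beta> \<gamma> assume *: "\<beta> \<in> \<Phi>" "\<gamma> \<in> \<Phi>" "pos \<beta> = pos \<gamma>"
    then have "u \<beta> = u \<gamma> \<or> u \<beta> = - u \<gamma>" unfolding pos_def by (metis minus_minus)
    then have "u \<beta> = u \<gamma> \<or> u \<beta> = u (- \<gamma>)" by (simp add: linear_neg[OF lin])
    then have "\<beta> = \<gamma> \<or> \<beta> = - \<gamma>" using W_bij[OF u] by (auto dest: bij_is_inj injD)
    then show "\<beta> = \<gamma>" using neg * by blast
  qed
  have surj: "pos ` \<Phi> = \<Phi>" by (rule endo_inj_surj[OF finite_\<Phi> _ inj]) (use range in auto)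
  have iff: "\<beta> \<in> inversions (inv u \<circ> w) \<longleftrightarrow>
      pos \<beta> \<in> (inversions u - inversions w) \<union> (inversions w - inversions u)" if b: "\<beta> \<in> \<Phi>" for \<beta>
  proof -
    have 1: "\<beta> \<bullet> (inv u \<circ> w) base = u \<beta> \<bullet> w base"
      using W_inner[OF u, of \<beta> "inv u (w base)"] inv_W_apply(1)[OF u] by simp
    have 2: "0 < u \<beta> \<bullet> u base" using W_inner[OF u] root_base_pos[OF b] by simp
    show ?thesis
    proof (cases "u \<beta> \<in> \<Phi>")
      case True
      then show ?thesis using 1 2 b by (auto simp: pos_def inversions_def)
    next
      case False
      then have m: "- u \<beta> \<in> \<Phi>" using W_root[OF u b] by simp
      have "u \<beta> \<bullet> w base \<noteq> 0" using root_generic[OF w m] by simp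
      then show ?thesis using 1 2 b m False by (auto simp: pos_def inversions_def)
    qed
  qed
  have "pos ` inversions (inv u \<circ> w) = (inversions u - inversions w) \<union> (inversions w - inversions u)" (is "_ = ?R")
  proof
    show "pos ` inversions (inv u \<circ> w) \<subseteq> ?R" using iff by (auto simp: inversions_def)
    show "?R \<subseteq> pos ` inversions (inv u \<circ> w)"
    proof
      fix \<gamma> assume g: "\<gamma> \<in> ?R"
      then have "\<gamma> \<in> \<Phi>" by (auto simp: inversions_def)
      then obtain \<beta> where "\<beta> \<in> \<Phi>" "\<gamma> = pos \<beta>" using surj by blast
      then show "\<gamma> \<in> pos ` inversions (inv u \<circ> w)" using iff g by blast
    qed
  qed
  then show ?thesis
    using card_image[OF inj_on_subset[OF inj], of "inversions (inv u \<circ> w)"] by (auto simp: inversions_def)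
qed

text \<open>The length condition says that the symmetric difference has the size of the second set
  minus that of the first, which holds only for an inclusion.\<close>

lemma weak_le_iff:
  assumes u: "u \<in> W" and w: "w \<in> W"
  shows "weak_le S u w \<longleftrightarrow> inversions u \<subseteq> inversions w"
proof -
  let ?U = "inversions u" and ?V = "inversions w"
  have fin: "finite ?U" "finite ?V" by (rule finite_inversions)+
  have "card ((?U - ?V) \<union> (?V - ?U)) = card (?U - ?V) + card (?V - ?U)"
    by (rule card_Un_disjoint) (use fin in auto)
  moreover have "card ?V = card (?V - ?U) + card (?U \<inter> ?V)"
    using card_Diff_subset_Int[of ?V ?U] fin card_mono[of ?V "?U \<inter> ?V"] by (simp add: Int_commute)
  moreover have "card ?U = card (?U - ?V) + card (?U \<inter> ?V)"
    using card_Diff_subset_Int[of ?U ?V] fin card_mono[of ?U "?U \<inter> ?V"] by simp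
  moreover have "?U \<subseteq> ?V \<longleftrightarrow> card (?U - ?V) = 0" using fin by auto
  ultimately show ?thesis
    unfolding weak_le_def
    by (simp add: word_length_eq u w W_comp W_inv card_inversions_quotient)
qed

lemma inversions_inj:
  assumes "u \<in> W" "w \<in> W" "inversions u = inversions w"
  shows "u = w"
proof -
  have "card (inversions (inv u \<circ> w)) = 0" using card_inversions_quotient assms by simp
  then have "inv u \<circ> w = id" using inversions_empty_imp_id W_comp W_inv finite_inversions assms by simp
  then have "u \<circ> (inv u \<circ> w) = u" by simp
  moreover have "u \<circ> (inv u \<circ> w) = w" using inv_W_apply(1)[OF assms(1)] by (simp add: fun_eq_iff)
  ultimately show ?thesis by simp
qed

lemma inversion_iff:
  assumes "i \<in> {1..N}" "j \<in> {1..N}" "i < j"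
  shows "values w j < values w i \<longleftrightarrow> e j - e i \<in> inversions w"
  using assms by (auto simp: values_def inversions_def \<Phi>_def inner_diff_left)

lemma inversions_subset_iff:
  "inversions u \<subseteq> inversions w \<longleftrightarrow>
    (\<forall>i\<in>{1..N}. \<forall>j\<in>{1..N}. i < j \<longrightarrow> values u j < values u i \<longrightarrow> values w j < values w i)"
proof -
  have "inversions x = {e j - e i |i j. i \<in> {1..N} \<and> j \<in> {1..N} \<and> i < j \<and> values x j < values x i}" for x
    by (fastforce simp: values_def inversions_def \<Phi>_def inner_diff_left)
  then show ?thesis using inversion_iff by (smt (verit, ccfv_threshold) mem_Collect_eq subset_iff)
qed

lemma word_values: "g \<in> {1..<N} \<Longrightarrow> k \<in> {1..N} \<Longrightarrow>
    values (reflection (gap e g) \<circ> w) k = values w (swap_gaps (same_gap g) k)"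
  by (simp add: values_def act_value)

end

section \<open>Words for bipartite Coxeter elements\<close>

context chain
begin

text \<open>The dual basis of the simple roots, that is, the fundamental weights up to scaling. Each
  is fixed by all simple reflections but its own, and pairing with it reads off a coefficient in the
  simple roots.\<close>

definition "omega = (SOME w. \<forall>b\<in>\<Delta>. \<forall>b'\<in>\<Delta>. w b \<bullet> b' = (if b = b' then 1 else 0))"

lemma omega: "d \<in> \<Delta> \<Longrightarrow> d' \<in> \<Delta> \<Longrightarrow> omega d \<bullet> d' = (if d = d' then 1 else 0)"
proof -
  have "\<exists>w. \<forall>b\<in>\<Delta>. \<forall>b'\<in>\<Delta>. w b \<bullet> b' = (if b = b' then 1 else 0)"
    using dual_basis[OF indep] unfolding \<Delta>_def by metis
  from someI_ex[OF this] show "d \<in> \<Delta> \<Longrightarrow> d' \<in> \<Delta> \<Longrightarrow> omega d \<bullet> d' = (if d = d' then 1 else 0)"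
    unfolding omega_def by blast
qed

lemma simple_expand: "x = (\<Sum>d\<in>\<Delta>. (omega d \<bullet> x) *\<^sub>R d)"
  using basis_expand[of \<Delta> omega x] indep span omega unfolding \<Delta>_def by blast

lemma reflection_inj: "d \<in> \<Delta> \<Longrightarrow> d' \<in> \<Delta> \<Longrightarrow> reflection d = reflection d' \<Longrightarrow> d = d'"
proof -
  assume d: "d \<in> \<Delta>" "d' \<in> \<Delta>" "reflection d = reflection d'"
  then obtain k where k: "d' = k *\<^sub>R d" using reflection_eq_imp_parallel by blast
  then have "d' \<bullet> base = k * (d \<bullet> base)" by simp
  then have "k = 1" using base d by simp
  then show ?thesis using k by simp
qed

lemma \<Delta>_nz: "d \<in> \<Delta> \<Longrightarrow> 0 < d \<bullet> d"
  using base by fastforce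

lemma \<Delta>_obtuse: "d \<in> \<Delta> \<Longrightarrow> d' \<in> \<Delta> \<Longrightarrow> d \<noteq> d' \<Longrightarrow> d \<bullet> d' \<le> 0"
  using obtuse by (auto simp: \<Delta>_def)

lemma reflection_omega: "d \<in> \<Delta> \<Longrightarrow> d' \<in> \<Delta> \<Longrightarrow> d \<noteq> d' \<Longrightarrow> reflection d' (omega d) = omega d"
  using omega[of d d'] by (simp add: reflection_def inner_commute)

lemma omega_word:
  assumes "ws \<in> lists S" "d \<in> \<Delta>" "reflection d \<notin> set ws"
  shows "word_product ws (omega d) = omega d" "omega d \<bullet> word_product ws x = omega d \<bullet> x"
proof -
  have "word_product ws (omega d) = omega d \<and> omega d \<bullet> word_product ws x = omega d \<bullet> x"
    using assms(1,3)
  proof (induction ws)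
    case (Cons s ws)
    obtain d' where d': "d' \<in> \<Delta>" "s = reflection d'" using Cons.hyps(1) by (auto simp: S_def)
    then have "d \<noteq> d'" using Cons.prems by auto
    then show ?case
      using Cons d' reflection_omega[OF assms(2) d'(1)] by (simp flip: inner_reflection)
  qed simp
  then show "word_product ws (omega d) = omega d" "omega d \<bullet> word_product ws x = omega d \<bullet> x"
    by auto
qed

lemma word_linear: "ws \<in> lists S \<Longrightarrow> linear (word_product ws)"
  using W_linear by (auto simp: W_def)

text \<open>A letter changes only the coefficient of its own root. As no letter is repeated, that
  coefficient was 0, and it becomes nonnegative because simple roots make no acute angles.\<close>

lemma omega_word_nonneg:
  assumes "ws \<in> lists S" "distinct ws" "d \<in> \<Delta>" "reflection d \<notin> set ws" "d' \<in> \<Delta>"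
  shows "0 \<le> omega d' \<bullet> word_product ws d"
  using assms(1,2,4,5)
proof (induction ws arbitrary: d')
  case Nil
  then show ?case using omega[of d' d] assms(3) by simp
next
  case (Cons s ws)
  obtain \<delta> where \<delta>: "\<delta> \<in> \<Delta>" "s = reflection \<delta>" using Cons.hyps(1) by (auto simp: S_def)
  let ?y = "word_product ws d"
  show ?case
  proof (cases "d' = \<delta>")
    case False
    then show ?thesis
      using Cons reflection_omega[OF Cons.prems(3) \<delta>(1)] \<delta>(2) by (simp flip: inner_reflection)
  next
    case True
    have "\<delta> \<noteq> d" using Cons.prems \<delta> by auto
    then have 0: "omega \<delta> \<bullet> ?y = 0"
      using omega_word(2)[OF Cons.hyps(2) \<delta>(1), of d] Cons.prems \<delta> omega[OF \<delta>(1) assms(3)] by simp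
    have "\<delta> \<bullet> ?y = (\<Sum>x\<in>\<Delta>. (omega x \<bullet> ?y) * (\<delta> \<bullet> x))"
      by (subst simple_expand[of ?y]) (simp add: inner_sum_right)
    also have "\<dots> \<le> 0"
    proof (rule sum_nonpos)
      fix x assume x: "x \<in> \<Delta>"
      show "(omega x \<bullet> ?y) * (\<delta> \<bullet> x) \<le> 0"
      proof (cases "x = \<delta>")
        case True
        then show ?thesis using 0 by simp
      next
        case False
        then show ?thesis
          using \<Delta>_obtuse[OF \<delta>(1) x] Cons.IH[OF _ _ x] Cons.prems by (auto intro: mult_nonneg_nonpos)
      qed
    qed
    finally have "\<delta> \<bullet> ?y \<le> 0" .
    then have "0 \<le> - (2 * (\<delta> \<bullet> ?y) / (\<delta> \<bullet> \<delta>))" using \<Delta>_nz[OF \<delta>(1)] by (simp add: divide_nonpos_pos)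
    then show ?thesis
      using 0 True \<delta> omega[OF \<delta>(1) \<delta>(1)] by (simp add: reflection_def inner_diff_right)
  qed
qed

text \<open>A word without the letter of \<open>d\<close> fixes \<open>omega d\<close>, whereas
  \<open>c\<close> uses that letter once and lowers the product of \<open>omega d\<close> with its
  image by \<open>2 / (d \<bullet> d)\<close>.\<close>

lemma coxeter_word_set:
  assumes c: "c = word_product bs" "bs \<in> lists S" "distinct bs" "set bs = S"
    and as: "as \<in> lists S" "word_product as = c"
  shows "set as = S"
proof -
  have "s \<in> set as" if s: "s \<in> S" for s
  proof (rule ccontr)
    assume not: "s \<notin> set as"
    obtain d where d: "d \<in> \<Delta>" "s = reflection d" using s by (auto simp: S_def)
    have "s \<in> set bs" using s c(4) by simp
    then obtain xs ys where bs: "bs = xs @ s # ys" using split_list by metis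
    have l: "xs \<in> lists S" "ys \<in> lists S" "s \<notin> set xs" "s \<notin> set ys" using c(2,3) bs by auto
    have "omega d \<bullet> c (omega d) = omega d \<bullet> word_product xs (s (word_product ys (omega d)))"
      unfolding c(1) bs by (simp add: word_product_append)
    also have "\<dots> = omega d \<bullet> s (omega d)"
      using omega_word[OF l(1) d(1)] omega_word[OF l(2) d(1)] l d by simp
    also have "\<dots> = omega d \<bullet> omega d - 2 / (d \<bullet> d)"
      using omega[OF d(1) d(1)] d(2) by (simp add: reflection_def inner_diff_right inner_commute[of d "omega d"])
    finally have "omega d \<bullet> c (omega d) \<noteq> omega d \<bullet> omega d" using \<Delta>_nz[OF d(1)] by simp
    moreover have "c (omega d) = omega d" using omega_word(1)[OF as(1) d(1)] not d as(2) by simp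
    ultimately show False by simp
  qed
  then show ?thesis using as(1) by auto
qed

text \<open>As every word for \<open>c\<close> contains all letters, the word \<open>bs\<close> is
  shortest, and a word of the same length repeats none.\<close>

lemma coxeter_word_reduced:
  assumes c: "c = word_product bs" "bs \<in> lists S" "distinct bs" "set bs = S"
  shows "reduced_word S bs c" and "reduced_word S as c \<Longrightarrow> distinct as \<and> set as = S"
proof -
  have le: "card (inversions c) \<le> length bs" using card_inversions_le c by simp
  have len: "length bs = card S" using distinct_card[OF c(3)] c(4) by simp
  have cW: "c \<in> W" using c by (auto simp: W_def)
  obtain ws where ws: "ws \<in> lists S" "length ws = card (inversions c)" "word_product ws = c"
    using reduced_word_exists[OF cW] by blast
  have "card S \<le> length ws" using coxeter_word_set[OF c ws(1,3)] card_length by metis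
  then show "reduced_word S bs c" using ws le len c by (simp add: reduced_word_iff)
  assume "reduced_word S as c"
  then have as: "as \<in> lists S" "word_product as = c" "length as = card (inversions c)"
    by (auto simp: reduced_word_iff)
  have "set as = S" by (rule coxeter_word_set[OF c as(1,2)])
  moreover have "length as \<le> card S" using as le len by simp
  ultimately show "distinct as \<and> set as = S" using card_length[of as] by (simp add: card_distinct)
qed

text \<open>
  The coefficient of \<open>d'\<close> in \<open>c (omega d)\<close> tells whether the letter of \<open>d\<close> precedes that of
  \<open>d'\<close> in a word for \<open>c\<close>.
\<close>

lemma coxeter_word_order:
  assumes c: "c = word_product (ps @ ms)" "ps @ ms \<in> lists S" "distinct (ps @ ms)" "set (ps @ ms) = S"
    and d: "d \<in> \<Delta>" "d' \<in> \<Delta>" "d \<bullet> d' < 0" "reflection d \<in> set ps" "reflection d' \<in> set ms"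
    and as: "reduced_word S as c"
  shows "as \<noteq> xs @ reflection d' # ys @ reflection d # zs"
proof
  assume split: "as = xs @ reflection d' # ys @ reflection d # zs"
  let ?s = "reflection d" and ?t = "reflection d'"
  have asS: "distinct as" "set as = S" "as \<in> lists S" "word_product as = c"
    using coxeter_word_reduced(2)[OF c as] as by (auto simp: reduced_word_iff)
  have dd: "d \<noteq> d'" using d(3) by (metis inner_ge_zero not_less)
  define k where "k = 2 / (d \<bullet> d)"
  have k: "k \<noteq> 0" using \<Delta>_nz[OF d(1)] by (simp add: k_def)
  have s: "?s (omega d) = omega d - k *\<^sub>R d"
    using omega[OF d(1) d(1)] by (simp add: reflection_def k_def inner_commute[of d "omega d"])
  obtain x1 x2 where ps: "ps = x1 @ ?s # x2" using split_list[OF d(4)] by blast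
  have l: "x1 \<in> lists S" "x2 @ ms \<in> lists S" "?s \<notin> set (x2 @ ms)" "?t \<notin> set x1"
    using c(2,3) d(5) ps by auto
  have "omega d' \<bullet> c (omega d) = omega d' \<bullet> word_product x1 (?s (word_product (x2 @ ms) (omega d)))"
    unfolding c(1) ps by (simp add: word_product_append)
  also have "\<dots> = omega d' \<bullet> ?s (omega d)"
    using omega_word(2)[OF l(1) d(2) l(4)] omega_word(1)[OF l(2) d(1) l(3)] by simp
  \<comment> \<open>Letters act from the right. Here the letter of \<open>d'\<close> meets
    \<open>omega d\<close> before the letter of \<open>d\<close> has moved it, so the coefficient of
    \<open>d'\<close> is not touched.\<close>
  finally have 1: "omega d' \<bullet> c (omega d) = omega d' \<bullet> omega d"
    unfolding s using omega[OF d(2,1)] dd by (simp add: inner_diff_right)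
  have m: "xs \<in> lists S" "ys \<in> lists S" "zs \<in> lists S" "?t \<notin> set xs" "?s \<notin> set ys" "?s \<notin> set zs"
    "?t \<notin> set ys" "distinct ys"
    using asS split by auto
  let ?y = "word_product ys d"
  have "omega d' \<bullet> c (omega d)
      = omega d' \<bullet> word_product xs (?t (word_product ys (?s (word_product zs (omega d)))))"
    unfolding asS(4)[symmetric] split by (simp add: word_product_append)
  also have "\<dots> = omega d' \<bullet> ?t (word_product ys (omega d - k *\<^sub>R d))"
    using omega_word(2)[OF m(1) d(2) m(4)] omega_word(1)[OF m(3) d(1) m(6)] s by simp
  also have "word_product ys (omega d - k *\<^sub>R d) = omega d - k *\<^sub>R ?y"
    using word_linear[OF m(2)] omega_word(1)[OF m(2) d(1) m(5)] by (simp add: linear_diff linear_cmul)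
  also have "?t (omega d - k *\<^sub>R ?y) = omega d - k *\<^sub>R ?t ?y"
    using linear_reflection[of d'] reflection_omega[OF d(1,2) dd] by (simp add: linear_diff linear_cmul)
  finally have 2: "omega d' \<bullet> ?t ?y = 0" using 1 k by (simp add: inner_diff_right)
  have 0: "omega d' \<bullet> ?y = 0" using omega_word(2)[OF m(2) d(2) m(7), of d] omega[OF d(2,1)] dd by simp
  have "omega d' \<bullet> ?t ?y = - (2 * (d' \<bullet> ?y) / (d' \<bullet> d'))"
    using 0 omega[OF d(2,2)] by (simp add: reflection_def inner_diff_right)
  then have "d' \<bullet> ?y = 0" using 2 \<Delta>_nz[OF d(2)] by simp
  \<comment> \<open>In the opposite order the letter of \<open>d'\<close> acts on a vector with
    coefficient 1 at its neighbour \<open>d\<close>. This term is negative and no other is positive,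
    so the coefficient of \<open>d'\<close> would change.\<close>
  moreover have "d' \<bullet> ?y < 0"
  proof -
    have "d' \<bullet> ?y = (\<Sum>x\<in>\<Delta>. (omega x \<bullet> ?y) * (d' \<bullet> x))"
      by (subst simple_expand[of ?y]) (simp add: inner_sum_right)
    also have "\<dots> = (omega d \<bullet> ?y) * (d' \<bullet> d) + (\<Sum>x\<in>\<Delta> - {d}. (omega x \<bullet> ?y) * (d' \<bullet> x))"
      by (rule sum.remove[OF finite_\<Delta> d(1)])
    also have "omega d \<bullet> ?y = 1"
      using omega_word(2)[OF m(2) d(1) m(5), of d] omega[OF d(1,1)] by simp
    also have "(\<Sum>x\<in>\<Delta> - {d}. (omega x \<bullet> ?y) * (d' \<bullet> x)) \<le> 0"
    proof (rule sum_nonpos)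
      fix x assume x: "x \<in> \<Delta> - {d}"
      show "(omega x \<bullet> ?y) * (d' \<bullet> x) \<le> 0"
      proof (cases "x = d'")
        case False
        then show ?thesis
          using \<Delta>_obtuse[OF d(2), of x] omega_word_nonneg[OF m(2,8) d(1) m(5), of x] x
          by (auto intro: mult_nonneg_nonpos)
      qed (use 0 in simp)
    qed
    finally show ?thesis using d(3) by (simp add: inner_commute)
  qed
  ultimately show False by simp
qed

section \<open>Commuting letters and the bipartition\<close>

lemma inner_eq_0_if_commute:
  assumes d: "d \<in> \<Delta>" "d' \<in> \<Delta>" "d \<noteq> d'"
    and com: "reflection d \<circ> reflection d' = reflection d' \<circ> reflection d"
  shows "d \<bullet> d' = 0"
proof (rule ccontr)
  assume ne: "d \<bullet> d' \<noteq> 0"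
  define k where "k = 2 * (d \<bullet> d') / (d \<bullet> d)"
  define k' where "k' = 2 * (d \<bullet> d') / (d' \<bullet> d')"
  have k: "k \<noteq> 0" using ne \<Delta>_nz[OF d(1)] by (simp add: k_def)
  have r: "reflection d d' = d' - k *\<^sub>R d" "reflection d' d = d - k' *\<^sub>R d'"
    by (simp_all add: reflection_def k_def k'_def inner_commute)
  have "reflection d (- d') = reflection d' (d' - k *\<^sub>R d)"
    using fun_cong[OF com, of d'] by (simp add: reflection_self r)
  then have "- (d' - k *\<^sub>R d) = - d' - k *\<^sub>R (d - k' *\<^sub>R d')"
    by (simp add: linear_neg[OF linear_reflection] linear_diff[OF linear_reflection]
        linear_cmul[OF linear_reflection] r reflection_self)
  then have "k *\<^sub>R (2 *\<^sub>R d) = k *\<^sub>R (k' *\<^sub>R d')"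
    by (simp add: algebra_simps scaleR_2)
  then have eq: "2 *\<^sub>R d = k' *\<^sub>R d'" by (rule scaleR_left_imp_eq[OF k])
  then have "2 * (d \<bullet> base) = k' * (d' \<bullet> base)" by (metis inner_scaleR_left)
  then have "k' = 2" using base d by simp
  then show False using eq d(3) by simp
qed

lemma two_le_N: "2 \<le> N"
proof (rule ccontr)
  assume "\<not> 2 \<le> N"
  then have "gap e ` {1..<N} = {}" by auto
  then have "(UNIV :: 'a set) = {0}" using span by simp
  then show False by (metis UNIV_not_singleton)
qed

abbreviation "letter g \<equiv> reflection (gap e g)"

lemma letter_eq_iff:
  "g \<in> {1..<N} \<Longrightarrow> h \<in> {1..<N} \<Longrightarrow> letter g = letter h \<longleftrightarrow> h \<in> same_gap g"
  using reflection_inj gap_in by (fastforce simp: same_gap_def)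

lemma adjacent_not_commuting:
  assumes "1 \<le> g" "Suc g < N" "pairwise_commuting T"
  shows "\<not> (letter g \<in> T \<and> letter (Suc g) \<in> T)"
proof
  assume "letter g \<in> T \<and> letter (Suc g) \<in> T"
  then have "letter g \<circ> letter (Suc g) = letter (Suc g) \<circ> letter g"
    using assms(3) by (simp add: pairwise_commuting_def)
  moreover have "gap e g \<bullet> gap e (Suc g) < 0" by (rule adjacent[OF assms(1,2)])
  moreover have "gap e g \<noteq> gap e (Suc g)" using calculation(2) by (metis inner_ge_zero not_less)
  ultimately show False
    using inner_eq_0_if_commute[of "gap e g" "gap e (Suc g)"] gap_in[of g] gap_in[of "Suc g"] assms(1,2) by simp
qed

text \<open>Neighbouring letters do not commute, so no part contains both; the parts alternate along
  the chain.\<close>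

lemma bipartite_parity:
  assumes S: "set ps \<union> set ms = S" "set ps \<inter> set ms = {}"
    and com: "pairwise_commuting (set ps)" "pairwise_commuting (set ms)"
  shows "1 \<le> g \<Longrightarrow> g < N \<Longrightarrow> letter g \<in> set ps \<longleftrightarrow> even g \<noteq> (letter 1 \<in> set ps)"
proof (induction g rule: nat_induct_at_least[of 1])
  case base
  then show ?case by simp
next
  case (Suc g)
  have "letter g \<in> S" "letter (Suc g) \<in> S" using Suc gap_refl_in by auto
  then have "letter (Suc g) \<in> set ps \<longleftrightarrow> letter g \<notin> set ps"
    using adjacent_not_commuting[OF Suc.hyps Suc.prems com(1)]
      adjacent_not_commuting[OF Suc.hyps Suc.prems com(2)] S by blast
  then show ?case using Suc by simp
qed

end

section \<open>Sortable elements are the aligned ones\<close>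

definition next_pos :: "('a \<Rightarrow> 'a) list \<Rightarrow> nat \<Rightarrow> ('a \<Rightarrow> 'a) \<Rightarrow> nat" where
  "next_pos as p s = (LEAST q. p \<le> q \<and> letter_at as q = s)"

lemma letter_at_add_length [simp]: "letter_at as (q + length as) = letter_at as q"
  by (simp add: letter_at_def)

lemma position_in_window:
  fixes n :: nat
  assumes "i < n"
  obtains q where "p \<le> q" "q < p + n" "q mod n = i"
proof -
  define r where "r = (i + (n - p mod n)) mod n"
  have n: "0 < n" using assms by simp
  have pm: "p mod n < n" using n by simp
  have "(p + r) mod n = (p + (i + (n - p mod n))) mod n" unfolding r_def by (rule mod_add_right_eq)
  also have "p + (i + (n - p mod n)) = n * (p div n) + n + i"
    using pm mult_div_mod_eq[of n p] by linarith
  also have "n * (p div n) + n + i = i + n * Suc (p div n)" by simp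
  also have "(i + n * Suc (p div n)) mod n = i" using assms by (simp only: mod_mult_self2 mod_less)
  finally have "(p + r) mod n = i" .
  moreover have "p \<le> p + r" "p + r < p + n" using n by (auto simp: r_def)
  ultimately show ?thesis using that by blast
qed

context
  fixes as :: "('a \<Rightarrow> 'a) list"
  assumes dist: "distinct as"
begin

lemma next_pos:
  assumes "s \<in> set as"
  shows "p \<le> next_pos as p s" "letter_at as (next_pos as p s) = s" "next_pos as p s < p + length as"
proof -
  obtain i where i: "i < length as" "as ! i = s" using assms by (auto simp: in_set_conv_nth)
  obtain q where q: "p \<le> q" "q < p + length as" "q mod length as = i"
    using position_in_window[OF i(1)] by blast
  have qP: "p \<le> q \<and> letter_at as q = s" using q i by (simp add: letter_at_def)
  from LeastI[where P = "\<lambda>q. p \<le> q \<and> letter_at as q = s", OF qP]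
  show "p \<le> next_pos as p s" "letter_at as (next_pos as p s) = s" by (simp_all add: next_pos_def)
  from Least_le[where P = "\<lambda>q. p \<le> q \<and> letter_at as q = s", OF qP]
  show "next_pos as p s < p + length as" using q(2) by (simp add: next_pos_def)
qed

lemma next_pos_le: "p \<le> q \<Longrightarrow> letter_at as q = s \<Longrightarrow> next_pos as p s \<le> q"
  unfolding next_pos_def by (rule Least_le) simp

lemma next_pos_self: "letter_at as p = s \<Longrightarrow> next_pos as p s = p"
  unfolding next_pos_def by (rule Least_equality) auto

lemma next_pos_gt: "s \<in> set as \<Longrightarrow> letter_at as p \<noteq> s \<Longrightarrow> p < next_pos as p s"
  using next_pos[of s p] by (metis le_neq_implies_less)

lemma next_pos_Suc:
  assumes "s \<in> set as" "letter_at as p \<noteq> s"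
  shows "next_pos as (Suc p) s = next_pos as p s"
proof (rule antisym)
  show "next_pos as (Suc p) s \<le> next_pos as p s"
    by (rule next_pos_le) (use next_pos_gt[OF assms] next_pos[OF assms(1)] in auto)
  show "next_pos as p s \<le> next_pos as (Suc p) s"
    by (rule next_pos_le) (use next_pos[OF assms(1), of "Suc p"] in auto)
qed

lemma letter_at_eq_iff:
  assumes "as \<noteq> []"
  shows "letter_at as p = letter_at as q \<longleftrightarrow> p mod length as = q mod length as"
  unfolding letter_at_def using assms dist by (intro nth_eq_iff_index_eq) auto

lemma next_pos_Suc_self:
  assumes "as \<noteq> []" "letter_at as p = s"
  shows "next_pos as (Suc p) s = p + length as"
proof -
  have s: "s \<in> set as" using assms by (auto simp: letter_at_def)
  have "next_pos as (Suc p) s \<le> p + length as"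
    by (rule next_pos_le) (use assms in \<open>auto simp: Suc_le_eq\<close>)
  moreover have "\<not> next_pos as (Suc p) s < p + length as"
  proof
    assume lt: "next_pos as (Suc p) s < p + length as"
    define q where "q = next_pos as (Suc p) s"
    have q: "p < q" "q < p + length as" "letter_at as q = s"
      using lt next_pos[OF s, of "Suc p"] by (auto simp: q_def)
    then have "q mod length as = p mod length as" using letter_at_eq_iff[OF assms(1), of q p] assms(2) by simp
    then have "length as dvd q - p" using q(1) by (metis less_imp_le mod_eq_dvd_iff_nat)
    then show False using q by (auto dest: dvd_imp_le)
  qed
  ultimately show ?thesis by simp
qed

lemma next_pos_Suc_less:
  assumes "as \<noteq> []" "s \<in> set as" "letter_at as p \<noteq> s"
  shows "next_pos as (Suc p) s < p + length as"
proof -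
  have "next_pos as p s < p + length as" by (rule next_pos(3)[OF assms(2)])
  then show ?thesis using next_pos_Suc[OF assms(2,3)] by simp
qed

end

lemma filter_ge_step:
  fixes xs :: "nat list"
  assumes "sorted_wrt (<) xs"
  shows "filter (\<lambda>q. p \<le> q) xs = (if p \<in> set xs then [p] else []) @ filter (\<lambda>q. Suc p \<le> q) xs"
  using assms
proof (induction xs)
  case (Cons x xs)
  then show ?case
  proof (cases "x = p")
    case True
    then have "filter (\<lambda>q. p \<le> q) xs = filter (\<lambda>q. Suc p \<le> q) xs"
      using Cons.prems by (intro filter_cong) auto
    then show ?thesis using True by simp
  next
    case False
    then show ?thesis using Cons by (auto split: if_splits)
  qed
qed simp

lemma filter_split_at:
  fixes xs :: "nat list"
  assumes "sorted_wrt (<) xs"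
  shows "xs = filter (\<lambda>q. q < p) xs @ filter (\<lambda>q. p \<le> q) xs"
  using assms
proof (induction xs)
  case (Cons x xs)
  show ?case
  proof (cases "x < p")
    case False
    then have "filter (\<lambda>q. q < p) (x # xs) = []" "filter (\<lambda>q. p \<le> q) (x # xs) = x # xs"
      using Cons.prems by (auto simp: filter_empty_conv filter_id_conv)
    then show ?thesis by simp
  qed (use Cons in auto)
qed simp

context chain
begin

text \<open>
  Reading the periodic word from position \<open>p\<close> amounts to conjugating the Coxeter element by the
  letters before \<open>p\<close>; the labels at \<open>p\<close> are those of the conjugated element.
\<close>

definition "lab as p k \<longleftrightarrow> next_pos as p (letter (k - 1)) < next_pos as p (letter k)"

lemma letter_in_S: "1 \<le> g \<Longrightarrow> g < N \<Longrightarrow> letter g \<in> S"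
  using gap_refl_in by simp

text \<open>The letter at \<open>p\<close> has the earliest next occurrence before it is read and
  the latest one, a full period later, afterwards. Comparisons with its neighbours are reversed and
  all others unchanged.\<close>

lemma lab_step:
  assumes as: "distinct as" "set as = S" and g: "g \<in> {1..<N}" "letter_at as p = letter g"
  shows "h \<in> same_gap g \<Longrightarrow> 1 < h \<Longrightarrow> \<not> lab as p h"
    and "h \<in> same_gap g \<Longrightarrow> Suc h < N \<Longrightarrow> lab as p (Suc h)"
    and "h \<in> same_gap g \<Longrightarrow> 1 < h \<Longrightarrow> lab as (Suc p) h"
    and "h \<in> same_gap g \<Longrightarrow> Suc h < N \<Longrightarrow> \<not> lab as (Suc p) (Suc h)"
    and "1 < k \<Longrightarrow> k < N \<Longrightarrow> k \<notin> same_gap g \<Longrightarrow> k - 1 \<notin> same_gap g \<Longrightarrow> lab as (Suc p) k = lab as p k"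
proof -
  have ne: "as \<noteq> []" using as(2) letter_in_S[of g] g by auto
  have eq: "letter_at as p = letter h" if "h \<in> same_gap g" for h
    using that g letter_eq_iff[of g h] by (auto simp: same_gap_def)
  have neq: "letter_at as p \<noteq> letter h" if "h \<notin> same_gap g" "1 \<le> h" "h < N" for h
    using that g letter_eq_iff[of g h] by auto
  have inS: "letter h \<in> set as" if "1 \<le> h" "h < N" for h using letter_in_S that as(2) by simp
  have rng: "1 \<le> h" "h < N" if "h \<in> same_gap g" for h using that by (auto simp: same_gap_def)
  have pre: "h - 1 \<notin> same_gap g" if "h \<in> same_gap g" for h
    using same_gap_nonadjacent[of "h - 1" g] that by (auto simp: same_gap_def)
  show "\<not> lab as p h" if "h \<in> same_gap g" "1 < h"
    unfolding lab_def next_pos_self[OF as(1) eq[OF that(1)]]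
    using next_pos(1)[OF as(1) inS[of "h - 1"], of p] that rng[OF that(1)] by (simp add: not_less)
  show "lab as p (Suc h)" if h: "h \<in> same_gap g" "Suc h < N"
    unfolding lab_def using next_pos_self[OF as(1) eq[OF h(1)]]
      next_pos_gt[OF as(1) inS[of "Suc h"] neq[of "Suc h"]] h same_gap_nonadjacent[OF h(1)] by simp
  show "lab as (Suc p) h" if h: "h \<in> same_gap g" "1 < h"
    unfolding lab_def next_pos_Suc_self[OF as(1) ne eq[OF h(1)]]
    using next_pos_Suc_less[OF as(1) ne inS[of "h - 1"] neq[of "h - 1"]] h rng[OF h(1)] pre[OF h(1)] by simp
  show "\<not> lab as (Suc p) (Suc h)" if h: "h \<in> same_gap g" "Suc h < N"
    unfolding lab_def
    using next_pos_Suc_self[OF as(1) ne eq[OF h(1)]]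
      next_pos_Suc_less[OF as(1) ne inS[of "Suc h"] neq[of "Suc h"]] h same_gap_nonadjacent[OF h(1)] by simp
  show "lab as (Suc p) k = lab as p k" if "1 < k" "k < N" "k \<notin> same_gap g" "k - 1 \<notin> same_gap g"
    unfolding lab_def using that inS[of k] inS[of "k - 1"] neq[of k] neq[of "k - 1"] next_pos_Suc[OF as(1)] by simp
qed

lemma aligned_descent:
  assumes as: "distinct as" "set as = S" and g: "g \<in> {1..<N}" "letter_at as p = letter g"
    and neg: "gap e g \<bullet> w base < 0"
  shows "aligned N (lab as p) (values w) \<longleftrightarrow> aligned N (lab as (Suc p)) (values (letter g \<circ> w))"
proof (rule aligned_swap[where G = "same_gap g"])
  show "values w (Suc h) < values w h" if "h \<in> same_gap g" for h
  proof -
    have "gap e h \<bullet> w base < 0" using that neg by (simp add: same_gap_def)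
    then show ?thesis by (simp add: values_def gap_def inner_diff_left)
  qed
  show "values (letter g \<circ> w) k = values w (swap_gaps (same_gap g) k)" if "k \<in> {1..N}" for k
    by (rule word_values[OF g(1) that])
qed (use same_gap_sub same_gap_nonadjacent lab_step[OF as g] in auto)

text \<open>No inversion crosses a gap of the letter. By \<open>uncrossed_word\<close> and
  \<open>uncrossed_reduced_word\<close> this is membership in the parabolic subgroup generated by
  the other letters.\<close>

definition "uncrossed g w \<longleftrightarrow>
  (\<forall>h\<in>same_gap g. \<forall>i j. 1 \<le> i \<longrightarrow> i \<le> h \<longrightarrow> h < j \<longrightarrow> j \<le> N \<longrightarrow> values w i \<le> values w j)"

text \<open>Exchanges at other gaps never move an index across \<open>h\<close>.\<close>

lemma uncrossed_step:
  assumes g: "g \<in> {1..<N}" "g' \<in> {1..<N}" "letter g' \<noteq> letter g" and w: "uncrossed g w"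
  shows "uncrossed g (letter g' \<circ> w)"
  unfolding uncrossed_def
proof (intro ballI allI impI)
  fix h i j assume h: "h \<in> same_gap g" and ij: "1 \<le> i" "i \<le> h" "h < j" "j \<le> N"
  let ?t = "swap_gaps (same_gap g')"
  have hN: "h \<notin> same_gap g'" using h g by (auto simp: same_gap_def)
  have "i \<noteq> h" if "i \<in> same_gap g'" using hN that by auto
  then have "?t i \<le> h" using ij by (cases "i \<in> same_gap g'") (auto simp: swap_gaps_def)
  moreover have "j - 1 \<noteq> h" if "j - 1 \<in> same_gap g'" using hN that by auto
  then have "h < ?t j" using ij by (cases "j - 1 \<in> same_gap g'") (auto simp: swap_gaps_def)
  moreover have "?t i \<in> {1..N}" "?t j \<in> {1..N}" using swap_range ij by auto
  ultimately have "values w (?t i) \<le> values w (?t j)" using w h by (auto simp: uncrossed_def)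
  moreover have "i \<in> {1..N}" "j \<in> {1..N}" using ij by auto
  ultimately show "values (letter g' \<circ> w) i \<le> values (letter g' \<circ> w) j"
    using word_values[OF g(2)] by (simp del: comp_apply)
qed

lemma uncrossed_word:
  assumes "ws \<in> lists S" "g \<in> {1..<N}" "letter g \<notin> set ws"
  shows "uncrossed g (word_product ws)"
  using assms(1,3)
proof (induction ws)
  case Nil
  have "values id i \<le> values id j" if "1 \<le> i" "i < j" "j \<le> N" for i j
    using chain_le[of base i j] base gap_in that by (auto simp: values_def)
  then show ?case unfolding uncrossed_def word_product_simps by simp
next
  case (Cons s ws)
  then have "s \<in> S" by simp
  then obtain g' where "g' \<in> {1..<N}" "s = letter g'" using S_gap by blast
  moreover have "letter g' \<noteq> letter g" "uncrossed g (word_product ws)"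
    using Cons calculation by auto
  ultimately show ?case unfolding word_product_simps using uncrossed_step[OF assms(2)] by blast
qed

lemma reduced_Cons:
  assumes "g \<in> {1..<N}" "ws \<in> lists S" "length (letter g # ws) = card (inversions (letter g \<circ> word_product ws))"
  shows "length ws = card (inversions (word_product ws))" "gap e g \<bullet> (letter g \<circ> word_product ws) base < 0"
proof -
  let ?w = "word_product ws"
  have w: "?w \<in> W" using assms(2) by (auto simp: W_def)
  have "\<not> gap e g \<bullet> ?w base < 0"
    using card_inversions_descent[where w = ?w, OF assms(1)] card_inversions_le[OF assms(2)] assms(3) by auto
  then have pos: "0 < gap e g \<bullet> ?w base"
    using root_generic[OF w gap_root[OF assms(1)]] by simp
  then show "gap e g \<bullet> (letter g \<circ> ?w) base < 0"
    by (simp add: reflection_self flip: inner_reflection)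
  show "length ws = card (inversions ?w)"
    using card_inversions_ascent[where w = ?w, OF assms(1) pos] assms(3) by simp
qed

text \<open>The first letter of a reduced word is a descent, which an uncrossed element does not
  have at \<open>g\<close>. Stripping it keeps the element uncrossed.\<close>

lemma uncrossed_reduced_word:
  assumes "ws \<in> lists S" "length ws = card (inversions (word_product ws))" "g \<in> {1..<N}"
    and "uncrossed g (word_product ws)"
  shows "letter g \<notin> set ws"
  using assms(1,2,4)
proof (induction ws)
  case (Cons s ws)
  then have "s \<in> S" by simp
  then obtain g' where g': "g' \<in> {1..<N}" "s = letter g'" using S_gap by blast
  note r = reduced_Cons[OF g'(1) Cons.hyps(2), folded g'(2)]
  have red: "length ws = card (inversions (word_product ws))" "gap e g' \<bullet> (s \<circ> word_product ws) base < 0"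
    using r Cons.prems(1) unfolding word_product_simps by blast+
  have ne: "letter g' \<noteq> letter g"
  proof
    assume "letter g' = letter g"
    then have "g' \<in> same_gap g" using letter_eq_iff[OF assms(3) g'(1)] by simp
    then have "values (s \<circ> word_product ws) g' \<le> values (s \<circ> word_product ws) (Suc g')"
      using Cons.prems(2) g'(1) unfolding uncrossed_def word_product_simps by auto
    then show False using red(2) by (simp add: values_def gap_def inner_diff_left)
  qed
  have "uncrossed g (letter g' \<circ> word_product (s # ws))"
    by (rule uncrossed_step[OF assms(3) g'(1) ne Cons.prems(2)])
  moreover have "letter g' \<circ> word_product (s # ws) = word_product ws"
    unfolding word_product_simps g'(2) comp_assoc[symmetric] reflection_comp_self by simp
  ultimately have "uncrossed g (word_product ws)" by simp
  then show ?case using Cons.IH red(1) ne g'(2) by auto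
qed simp

lemma aligned_uncrossed:
  assumes as: "distinct as" "set as = S" and g: "g \<in> {1..<N}" "letter_at as p = letter g"
    and al: "aligned N (lab as p) (values w)" and pos: "0 < gap e g \<bullet> w base"
  shows "uncrossed g w"
  unfolding uncrossed_def
proof (intro ballI allI impI)
  fix h i j assume h: "h \<in> same_gap g" and ij: "1 \<le> i" "i \<le> h" "h < j" "j \<le> N"
  have "values w h < values w (Suc h)"
  proof -
    have "0 < gap e h \<bullet> w base" using h pos by (simp add: same_gap_def)
    then show ?thesis by (simp add: values_def gap_def inner_diff_left)
  qed
  then show "values w i \<le> values w j"
    using aligned_no_crossing[OF al, of h i j] lab_step(1,2)[OF as g h] h ij by (auto simp: same_gap_def)
qed

lemma aligned_uncrossed_relabel:
  assumes as: "distinct as" "set as = S" and g: "g \<in> {1..<N}" "letter_at as p = letter g"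
    and w: "uncrossed g w"
  shows "aligned N (lab as p) (values w) \<longleftrightarrow> aligned N (lab as (Suc p)) (values w)"
proof
  assume "aligned N (lab as p) (values w)"
  then show "aligned N (lab as (Suc p)) (values w)"
    by (rule aligned_relabel[where G = "same_gap g"]) (use lab_step(5)[OF as g] w in \<open>auto simp: uncrossed_def\<close>)
next
  assume "aligned N (lab as (Suc p)) (values w)"
  then show "aligned N (lab as p) (values w)"
    by (rule aligned_relabel[where G = "same_gap g"]) (use lab_step(5)[OF as g] w in \<open>auto simp: uncrossed_def\<close>)
qed

section \<open>Reading a sorting word position by position\<close>

definition "suffix as xs p = word_product (map (letter_at as) (filter (\<lambda>q. p \<le> q) xs))"

lemma letter_at_S: "set as = S \<Longrightarrow> letter_at as p \<in> S"
proof -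
  assume as: "set as = S"
  have "letter 1 \<in> set as" using two_le_N as letter_in_S[of 1] by simp
  then have "as \<noteq> []" by auto
  then have "as ! (p mod length as) \<in> set as" by (intro nth_mem) simp
  then show ?thesis by (simp add: letter_at_def as)
qed

lemma letters_in_S: "set as = S \<Longrightarrow> map (letter_at as) xs \<in> lists S"
  using letter_at_S by auto

lemma suffix_in:
  "sorted_wrt (<) xs \<Longrightarrow> p \<in> set xs \<Longrightarrow> suffix as xs p = letter_at as p \<circ> suffix as xs (Suc p)"
  unfolding suffix_def by (subst filter_ge_step) simp_all

lemma suffix_notin:
  "sorted_wrt (<) xs \<Longrightarrow> p \<notin> set xs \<Longrightarrow> suffix as xs p = suffix as xs (Suc p)"
  unfolding suffix_def by (subst filter_ge_step) simp_all

lemma suffix_reduced: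
  assumes as: "set as = S" and xs: "reduced_subword S as w xs"
  shows "length (filter (\<lambda>q. p \<le> q) xs) = card (inversions (suffix as xs p))"
proof (induction p)
  case 0
  then show ?case using xs by (auto simp: suffix_def reduced_subword_def reduced_word_iff)
next
  case (Suc p)
  have sorted: "sorted_wrt (<) xs" using xs by (simp add: reduced_subword_def)
  show ?case
  proof (cases "p \<in> set xs")
    case True
    obtain g where g: "g \<in> {1..<N}" "letter_at as p = letter g" using S_gap letter_at_S[OF as] by blast
    have f: "filter (\<lambda>q. p \<le> q) xs = p # filter (\<lambda>q. Suc p \<le> q) xs"
      using filter_ge_step[OF sorted, of p] True by simp
    have "length (letter g # map (letter_at as) (filter (\<lambda>q. Suc p \<le> q) xs)) =
        card (inversions (letter g \<circ> suffix as xs (Suc p)))"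
      using Suc unfolding suffix_in[OF sorted True] g(2) f by (simp del: comp_apply)
    from reduced_Cons(1)[OF g(1) letters_in_S[OF as] this[unfolded suffix_def]]
    show ?thesis by (simp add: suffix_def)
  next
    case False
    then show ?thesis
      using Suc filter_ge_step[OF sorted, of p] suffix_notin[OF sorted False, of as] by simp
  qed
qed

lemma suffix_descent:
  assumes as: "set as = S" and xs: "reduced_subword S as w xs" and p: "p \<in> set xs"
    and g: "g \<in> {1..<N}" "letter_at as p = letter g"
  shows "gap e g \<bullet> suffix as xs p base < 0"
proof -
  have sorted: "sorted_wrt (<) xs" using xs by (simp add: reduced_subword_def)
  have f: "filter (\<lambda>q. p \<le> q) xs = p # filter (\<lambda>q. Suc p \<le> q) xs"
    using filter_ge_step[OF sorted, of p] p by simp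
  have "length (letter g # map (letter_at as) (filter (\<lambda>q. Suc p \<le> q) xs)) =
      card (inversions (letter g \<circ> suffix as xs (Suc p)))"
    using suffix_reduced[OF as xs, of p] unfolding suffix_in[OF sorted p] g(2) f by simp
  from reduced_Cons(2)[OF g(1) letters_in_S[OF as] this[unfolded suffix_def]]
  show ?thesis unfolding suffix_in[OF sorted p] g(2) by (simp add: suffix_def)
qed

lemma suffix_W: "set as = S \<Longrightarrow> suffix as xs p \<in> W"
  using letters_in_S by (auto simp: W_def suffix_def)

lemma letters_in_copy_mono:
  assumes "\<And>i. letters_in_copy as xs (Suc i) \<subseteq> letters_in_copy as xs i"
  shows "letters_in_copy as xs (i + m) \<subseteq> letters_in_copy as xs i"
  by (induction m) (use assms in auto)

text \<open>Backward induction over positions. A used position is a descent and exchanges the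
  labels; at a skipped one nestedness keeps the letter out of the rest, so the changed labels are
  not read.\<close>

lemma aligned_if_nested:
  assumes as: "distinct as" "set as = S" and xs: "reduced_subword S as w xs"
    and nested: "\<And>i. letters_in_copy as xs (Suc i) \<subseteq> letters_in_copy as xs i"
  shows "aligned N (lab as 0) (values w)"
proof -
  have sorted: "sorted_wrt (<) xs" using xs by (simp add: reduced_subword_def)
  have ne: "as \<noteq> []" using letter_at_S[OF as(2)] as(2) by auto
  \<comment> \<open>This lies behind every position of \<open>xs\<close>, so the remainder there is
    the identity, which has no inversions.\<close>
  define M where "M = Suc (sum_list xs)"
  have xsM: "q < M" if "q \<in> set xs" for q using member_le_sum_list[OF that] by (simp add: M_def)
  have "p \<le> M \<Longrightarrow> aligned N (lab as p) (values (suffix as xs p))" for p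
  proof (induction p rule: inc_induct)
    case base
    have "filter (\<lambda>q. M \<le> q) xs = []" using xsM by (auto simp: filter_empty_conv not_le)
    then have "suffix as xs M = id" by (simp add: suffix_def)
    moreover have "values id i < values id j" if "1 \<le> i" "i < j" "j \<le> N" for i j
      unfolding values_def id_apply
    proof (rule chain_less)
      show "0 < gap e g \<bullet> base" if "g \<in> {1..<N}" for g
        by (rule root_base_pos[OF gap_root[OF that]])
    qed (use that in auto)
    ultimately show ?case unfolding aligned_def by (metis less_asym order.strict_trans)
  next
    case (step p)
    obtain g where g: "g \<in> {1..<N}" "letter_at as p = letter g" using S_gap letter_at_S[OF as(2)] by blast
    show ?case
    proof (cases "p \<in> set xs")
      case True
      have "letter g \<circ> suffix as xs p = suffix as xs (Suc p)"
        unfolding suffix_in[OF sorted True] g(2) comp_assoc[symmetric] reflection_comp_self by simp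
      then show ?thesis
        using aligned_descent[where w = "suffix as xs p", OF as g suffix_descent[OF as(2) xs True g]] step.IH by simp
    next
      case False
      have "letter g \<notin> set (map (letter_at as) (filter (\<lambda>q. p \<le> q) xs))"
      proof
        assume "letter g \<in> set (map (letter_at as) (filter (\<lambda>q. p \<le> q) xs))"
        then obtain q where q: "q \<in> set xs" "p \<le> q" "letter_at as q = letter_at as p"
          using g by auto
        let ?n = "length as"
        have "p div ?n \<le> q div ?n" using q(2) by (rule div_le_mono)
        then obtain m where m: "q div ?n = p div ?n + m" using le_Suc_ex by blast
        have "letter_at as q \<in> letters_in_copy as xs (p div ?n + m)"
          using q(1) m by (auto simp: letters_in_copy_def)
        \<comment> \<open>A later occurrence would be matched by one in the copy of
          \<open>p\<close>, and there the letter occurs only at \<open>p\<close> itself.\<close>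
        then have "letter_at as q \<in> letters_in_copy as xs (p div ?n)"
          using letters_in_copy_mono[OF nested] by blast
        then obtain q' where q': "q' \<in> set xs" "q' div ?n = p div ?n" "letter_at as q' = letter_at as p"
          using q(3) by (auto simp: letters_in_copy_def)
        then have "q' = p" using letter_at_eq_iff[OF as(1) ne] by (metis div_mult_mod_eq)
        then show False using q'(1) False by simp
      qed
      then have "uncrossed g (suffix as xs p)"
        unfolding suffix_def by (rule uncrossed_word[OF letters_in_S[OF as(2)] g(1)])
      then show ?thesis
        using aligned_uncrossed_relabel[where w = "suffix as xs p", OF as g]
          suffix_notin[OF sorted False, of as] step.IH by simp
    qed
  qed
  from this[of 0] show ?thesis
    using xs by (simp add: suffix_def reduced_subword_def reduced_word_iff)
qed

lemma subword_exists:
  assumes "set as = S"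
  shows "ws \<in> lists S \<Longrightarrow>
    \<exists>zs. sorted_wrt (<) zs \<and> (\<forall>z\<in>set zs. p \<le> z) \<and> map (letter_at as) zs = ws"
proof (induction ws arbitrary: p)
  case (Cons s ws)
  then have "s \<in> set as" using assms by simp
  then obtain i where i: "i < length as" "as ! i = s" by (auto simp: in_set_conv_nth)
  obtain q where q: "p \<le> q" "q mod length as = i" using position_in_window[OF i(1)] by blast
  obtain zs where "sorted_wrt (<) zs" "\<forall>z\<in>set zs. Suc q \<le> z" "map (letter_at as) zs = ws"
    using Cons.IH[of "Suc q"] Cons.prems by auto
  then show ?case using q i by (intro exI[of _ "q # zs"]) (auto simp: letter_at_def)
qed (auto intro: exI[of _ "[]"])

text \<open>All reduced subwords for \<open>w\<close> have the same length, where the lexicographic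
  order is total as well as well-founded; so a minimal one precedes all others.\<close>

lemma sorting_word_exists:
  assumes as: "set as = S" and w: "w \<in> W"
  obtains xs where "sorting_word S as w xs"
proof -
  obtain ws where ws: "ws \<in> lists S" "length ws = card (inversions w)" "word_product ws = w"
    using reduced_word_exists[OF w] by blast
  obtain zs where "sorted_wrt (<) zs" "map (letter_at as) zs = ws"
    using subword_exists[OF as ws(1)] by blast
  then have zs: "reduced_subword S as w zs" using ws by (simp add: reduced_subword_def reduced_word_iff)
  have "wf (lex less_than)" by (simp add: wf_lex)
  then obtain xs where xs: "reduced_subword S as w xs"
    "\<And>ys. (ys, xs) \<in> lex less_than \<Longrightarrow> \<not> reduced_subword S as w ys"
    using zs wfE_min[of "lex less_than" zs "{ys. reduced_subword S as w ys}"] by auto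
  have "ys = xs \<or> (xs, ys) \<in> lex less_than" if ys: "reduced_subword S as w ys" for ys
  proof -
    have len: "length xs = length ys" using xs(1) ys by (auto simp: reduced_subword_def reduced_word_iff)
    have "total (lexord less_than)" by (rule total_lexord) (simp add: total_less_than)
    then have "xs = ys \<or> (xs, ys) \<in> lexord less_than \<or> (ys, xs) \<in> lexord less_than"
      by (auto simp: total_on_def)
    then show ?thesis using xs(2)[of ys] ys len by (auto simp: lexord_lex)
  qed
  then show ?thesis using that xs(1) by (auto simp: sorting_word_def)
qed

text \<open>Skipping a position whose letter is a descent of the remainder would not be leftmost.\<close>

lemma skipped_not_descent:
  assumes as: "set as = S" and xs: "sorting_word S as w xs" and p: "p \<notin> set xs"
    and g: "g \<in> {1..<N}" "letter_at as p = letter g"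
  shows "0 < gap e g \<bullet> suffix as xs p base"
proof (rule ccontr)
  let ?r = "suffix as xs p"
  have red: "reduced_subword S as w xs" using xs by (simp add: sorting_word_def)
  then have sorted: "sorted_wrt (<) xs" by (simp add: reduced_subword_def)
  have rW: "?r \<in> W" by (rule suffix_W[OF as])
  assume "\<not> 0 < gap e g \<bullet> ?r base"
  then have neg: "gap e g \<bullet> ?r base < 0" using root_generic[OF rW gap_root[OF g(1)]] by simp
  have "letter g \<circ> ?r \<in> W" using W_Cons gap_refl_in g(1) rW by blast
  then obtain ws where ws: "ws \<in> lists S" "length ws = card (inversions (letter g \<circ> ?r))"
    "word_product ws = letter g \<circ> ?r" using reduced_word_exists by blast
  obtain zs where zs: "sorted_wrt (<) zs" "\<forall>z\<in>set zs. Suc p \<le> z" "map (letter_at as) zs = ws"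
    using subword_exists[OF as ws(1)] by blast
  define us where "us = filter (\<lambda>q. q < p) xs"
  define vs where "vs = filter (\<lambda>q. p \<le> q) xs"
  have xs_split: "xs = us @ vs" unfolding us_def vs_def by (rule filter_split_at[OF sorted])
  have "word_product (map (letter_at as) (us @ p # zs))
      = word_product (map (letter_at as) us) \<circ> (letter g \<circ> (letter g \<circ> ?r))"
    using zs(3) ws(3) g(2) by (simp add: word_product_append del: comp_apply)
  also have "letter g \<circ> (letter g \<circ> ?r) = ?r"
    unfolding comp_assoc[symmetric] reflection_comp_self by simp
  also have "word_product (map (letter_at as) us) \<circ> ?r = word_product (map (letter_at as) (us @ vs))"
    unfolding suffix_def vs_def[symmetric] by (simp add: word_product_append del: comp_apply)
  also have "\<dots> = word_product (map (letter_at as) xs)" using xs_split by simp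
  also have "\<dots> = w" using red by (simp add: reduced_subword_def reduced_word_iff)
  finally have prod: "word_product (map (letter_at as) (us @ p # zs)) = w" .
  have "length zs = length ws" using zs(3) by (metis length_map)
  then have len: "length (p # zs) = length vs"
    using card_inversions_descent[where w = ?r, OF g(1) neg] ws(2) suffix_reduced[OF as red, of p]
    by (simp add: vs_def del: comp_apply)
  \<comment> \<open>Before \<open>p\<close> this subword agrees with \<open>xs\<close>, and then it
    has \<open>p\<close> where \<open>xs\<close> has a later position.\<close>
  have "reduced_subword S as w (us @ p # zs)"
    unfolding reduced_subword_def reduced_word_iff
  proof (intro conjI)
    show "sorted_wrt (<) (us @ p # zs)"
      using zs sorted by (auto simp: sorted_wrt_append us_def sorted_wrt_filter intro: order.strict_trans)
    show "map (letter_at as) (us @ p # zs) \<in> lists S" by (rule letters_in_S[OF as])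
    show "word_product (map (letter_at as) (us @ p # zs)) = w" by (rule prod)
    show "length (map (letter_at as) (us @ p # zs)) = card (inversions w)"
      using len red xs_split by (auto simp: reduced_subword_def reduced_word_iff)
  qed
  then have "us @ p # zs = xs \<or> (xs, us @ p # zs) \<in> lex less_than"
    using xs by (auto simp: sorting_word_def)
  then have "p # zs = vs \<or> (vs, p # zs) \<in> lex less_than"
    unfolding xs_split by (auto simp: lex_append_left_iff irrefl_on_def)
  moreover have "p \<notin> set vs" "\<forall>q\<in>set vs. p \<le> q" using p by (auto simp: vs_def)
  ultimately show False using len by (cases vs) auto
qed

text \<open>This induction runs forward. A skipped letter is no descent of the remainder, so
  alignment makes the remainder uncrossed there and the letter never returns. Hence a letter used in
  one copy was used in the copy before.\<close>

lemma nested_if_aligned: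
  assumes as: "distinct as" "set as = S" and xs: "sorting_word S as w xs"
    and al: "aligned N (lab as 0) (values w)"
  shows "letters_in_copy as xs (Suc i) \<subseteq> letters_in_copy as xs i"
proof -
  have red: "reduced_subword S as w xs" using xs by (simp add: sorting_word_def)
  then have sorted: "sorted_wrt (<) xs" by (simp add: reduced_subword_def)
  have aligned: "aligned N (lab as p) (values (suffix as xs p))" for p
  proof (induction p)
    case 0
    then show ?case using al red by (simp add: suffix_def reduced_subword_def reduced_word_iff)
  next
    case (Suc p)
    obtain g where g: "g \<in> {1..<N}" "letter_at as p = letter g" using S_gap letter_at_S[OF as(2)] by blast
    show ?case
    proof (cases "p \<in> set xs")
      case True
      have "letter g \<circ> suffix as xs p = suffix as xs (Suc p)"
        unfolding suffix_in[OF sorted True] g(2) comp_assoc[symmetric] reflection_comp_self by simp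
      then show ?thesis
        using aligned_descent[where w = "suffix as xs p", OF as g suffix_descent[OF as(2) red True g]] Suc by simp
    next
      case False
      have "uncrossed g (suffix as xs p)"
        by (rule aligned_uncrossed[OF as g Suc skipped_not_descent[OF as(2) xs False g]])
      then have "aligned N (lab as (Suc p)) (values (suffix as xs p))"
        using aligned_uncrossed_relabel[where w = "suffix as xs p", OF as g] Suc by blast
      then show ?thesis using suffix_notin[OF sorted False, of as] by simp
    qed
  qed
  have unused: "letter_at as q \<noteq> letter_at as p" if p: "p \<notin> set xs" and q: "q \<in> set xs" "p \<le> q" for p q
  proof -
    obtain g where g: "g \<in> {1..<N}" "letter_at as p = letter g" using S_gap letter_at_S[OF as(2)] by blast
    have "uncrossed g (suffix as xs p)"
      by (rule aligned_uncrossed[OF as g aligned skipped_not_descent[OF as(2) xs p g]])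
    then have "letter g \<notin> set (map (letter_at as) (filter (\<lambda>q. p \<le> q) xs))"
      using suffix_reduced[OF as(2) red, of p]
      by (intro uncrossed_reduced_word[OF letters_in_S[OF as(2)] _ g(1)]) (simp_all add: suffix_def)
    then show ?thesis using g q by force
  qed
  have n: "0 < length as" using letter_at_S[OF as(2)] as(2) by auto
  show ?thesis
  proof
    fix s assume "s \<in> letters_in_copy as xs (Suc i)"
    then obtain q where q: "q \<in> set xs" "q div length as = Suc i" "s = letter_at as q"
      by (auto simp: letters_in_copy_def)
    \<comment> \<open>The same letter one copy earlier.\<close>
    define p where "p = q - length as"
    have "length as \<le> q" using q(2) n by (metis div_less less_nat_zero_code not_less old.nat.distinct(1))
    then have p: "q = p + length as" by (simp add: p_def)
    have l: "letter_at as p = s" using q(3) p by simp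
    have "p div length as = i" using q(2) n unfolding p by simp
    moreover have "p \<le> q" using p by simp
    then have "p \<in> set xs" using unused[of p q] q(1,3) l by metis
    ultimately show "s \<in> letters_in_copy as xs i" using l by (auto simp: letters_in_copy_def)
  qed
qed

lemma aligned_label_cong:
  "(\<And>k. 1 < k \<Longrightarrow> k < N \<Longrightarrow> lab' k = lab'' k) \<Longrightarrow> aligned N lab' x \<longleftrightarrow> aligned N lab'' x"
  unfolding aligned_def by (intro iff_allI imp_cong refl) auto

lemma next_pos_less_split:
  assumes as: "distinct as" "s \<in> set as" "t \<in> set as"
    and less: "next_pos as 0 t < next_pos as 0 s"
  shows "\<exists>xs ys zs. as = xs @ t # ys @ s # zs"
proof -
  define i where "i = next_pos as 0 t"
  define j where "j = next_pos as 0 s"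
  have i: "i < length as" "as ! i = t"
    using next_pos(2,3)[OF as(1,3), of 0] by (auto simp: i_def letter_at_def)
  have j: "j < length as" "as ! j = s"
    using next_pos(2,3)[OF as(1,2), of 0] by (auto simp: j_def letter_at_def)
  have ij: "i < j" using less by (simp add: i_def j_def)
  have "as = take i as @ t # drop (Suc i) as" using id_take_nth_drop[OF i(1)] i(2) by simp
  moreover have "drop (Suc i) as = take (j - Suc i) (drop (Suc i) as) @ s # drop (Suc (j - Suc i)) (drop (Suc i) as)"
    using id_take_nth_drop[of "j - Suc i" "drop (Suc i) as"] ij j by simp
  ultimately show ?thesis by metis
qed

text \<open>In every reduced word for the Coxeter element, of two neighbouring letters the one from
  \<open>ps\<close> comes first, and the parts alternate along the chain.\<close>

lemma lab_0_eq_parity: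
  assumes bi: "distinct ps" "distinct ms" "set ps \<union> set ms = S" "set ps \<inter> set ms = {}"
      "pairwise_commuting (set ps)" "pairwise_commuting (set ms)"
    and as: "reduced_word S as (word_product ps \<circ> word_product ms)"
    and k: "1 < k" "k < N"
  shows "lab as 0 k \<longleftrightarrow> parity (letter 1 \<in> set ps) k"
proof -
  let ?c = "word_product ps \<circ> word_product ms"
  have c: "?c = word_product (ps @ ms)" "ps @ ms \<in> lists S" "distinct (ps @ ms)" "set (ps @ ms) = S"
    using bi by (auto simp: word_product_append)
  have asS: "distinct as" "set as = S" using coxeter_word_reduced(2)[OF c as] by auto
  obtain h where h: "k = Suc h" "1 \<le> h" using k(1) by (cases k) auto
  have adj: "gap e h \<bullet> gap e k < 0" using adjacent[of h] h k by simp
  have D: "gap e h \<in> \<Delta>" "gap e k \<in> \<Delta>" using gap_in h k by auto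
  have inS: "letter h \<in> set as" "letter k \<in> set as" using letter_in_S[of h] letter_in_S[of k] h k asS by auto
  have par: "letter h \<in> set ps \<longleftrightarrow> even h \<noteq> (letter 1 \<in> set ps)" "letter k \<in> set ps \<longleftrightarrow> even k \<noteq> (letter 1 \<in> set ps)"
    by (rule bipartite_parity[OF bi(3-6)]; use h k in simp)+
  show ?thesis
  proof (cases "letter h \<in> set ps")
    case True
    then have "letter k \<in> set ms" using par h(1) inS asS bi(3) by auto
    then have "\<not> next_pos as 0 (letter k) < next_pos as 0 (letter h)"
      using next_pos_less_split[OF asS(1) inS] coxeter_word_order[OF c D adj True _ as] by metis
    moreover have "next_pos as 0 (letter k) \<noteq> next_pos as 0 (letter h)"
      using next_pos(2)[OF asS(1) inS(1), of 0] next_pos(2)[OF asS(1) inS(2), of 0] True \<open>letter k \<in> set ms\<close> bi(4)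
      by (metis IntI empty_iff)
    ultimately show ?thesis using True par h by (auto simp: lab_def parity_def)
  next
    case False
    then have "letter k \<in> set ps" "letter h \<in> set ms" using par h(1) inS asS bi(3) by auto
    then have "\<not> next_pos as 0 (letter h) < next_pos as 0 (letter k)"
      using next_pos_less_split[OF asS(1) inS(2,1)] coxeter_word_order[OF c D(2,1) _ _ _ as] adj
      by (metis inner_commute)
    then show ?thesis using False par h by (auto simp: lab_def parity_def)
  qed
qed

lemma sortable_iff_aligned:
  assumes bi: "distinct ps" "distinct ms" "set ps \<union> set ms = S" "set ps \<inter> set ms = {}"
      "pairwise_commuting (set ps)" "pairwise_commuting (set ms)"
  shows "sortable S (word_product ps \<circ> word_product ms) w \<longleftrightarrow>
    w \<in> W \<and> aligned N (parity (letter 1 \<in> set ps)) (values w)"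
proof -
  let ?c = "word_product ps \<circ> word_product ms" and ?l = "parity (letter 1 \<in> set ps)"
  have c: "?c = word_product (ps @ ms)" "ps @ ms \<in> lists S" "distinct (ps @ ms)" "set (ps @ ms) = S"
    using bi by (auto simp: word_product_append)
  have lab: "aligned N (lab as 0) x \<longleftrightarrow> aligned N ?l x" if "reduced_word S as ?c" for as x
    by (rule aligned_label_cong) (rule lab_0_eq_parity[OF bi that])
  show ?thesis
  proof
    assume "sortable S ?c w"
    then obtain as xs where *: "reduced_word S as ?c" "sorting_word S as w xs"
      "\<And>i. letters_in_copy as xs (Suc i) \<subseteq> letters_in_copy as xs i"
      unfolding sortable_def by blast
    have as: "distinct as" "set as = S" using coxeter_word_reduced(2)[OF c *(1)] by auto
    have red: "reduced_subword S as w xs" using *(2) by (simp add: sorting_word_def)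
    then have "w \<in> W" by (auto simp: reduced_subword_def reduced_word_iff W_def)
    then show "w \<in> W \<and> aligned N ?l (values w)"
      using aligned_if_nested[OF as red *(3)] lab[OF *(1)] by blast
  next
    assume w: "w \<in> W \<and> aligned N ?l (values w)"
    let ?as = "ps @ ms"
    have r: "reduced_word S ?as ?c" by (rule coxeter_word_reduced(1)[OF c])
    obtain xs where xs: "sorting_word S ?as w xs" using sorting_word_exists[OF c(4)] w by blast
    have "aligned N (lab ?as 0) (values w)" using w lab[OF r] by blast
    then show "sortable S ?c w"
      unfolding sortable_def using r xs nested_if_aligned[OF c(3,4) xs] by blast
  qed
qed

end

section \<open>The biCambrian cones\<close>

context chain
begin

lemma pair_root:
  "i \<in> {1..N} \<Longrightarrow> j \<in> {1..N} \<Longrightarrow> i \<noteq> j \<Longrightarrow> e j - e i \<in> \<Phi> \<or> e i - e j \<in> \<Phi>"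
proof -
  have "e y - e x \<in> \<Phi>" if "x \<in> {1..N}" "y \<in> {1..N}" "x < y" for x y
    unfolding \<Phi>_def using that by auto
  then show "i \<in> {1..N} \<Longrightarrow> j \<in> {1..N} \<Longrightarrow> i \<noteq> j \<Longrightarrow> e j - e i \<in> \<Phi> \<or> e i - e j \<in> \<Phi>"
    by (metis linorder_neqE_nat)
qed

text \<open>Prescribing the products with the gap vectors determines all differences. Two gaps with
  the same vector need equal increments of \<open>f\<close>, which antisymmetry supplies in the
  folded case.\<close>

lemma realise_values:
  fixes f :: "nat \<Rightarrow> real"
  assumes f: "folded \<Longrightarrow> \<forall>k\<in>{1..N}. f (N + 1 - k) = - f k"
  obtains v where "\<And>i j. i \<in> {1..N} \<Longrightarrow> j \<in> {1..N} \<Longrightarrow> e j \<bullet> v - e i \<bullet> v = f j - f i"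
proof -
  have cons: "f (Suc g) - f g = f (Suc h) - f h"
    if g: "g \<in> {1..<N}" "h \<in> {1..<N}" "gap e g = gap e h" for g h
  proof (cases folded)
    case True
    have "f (N + 1 - g) = - f g" "f (N + 1 - Suc g) = - f (Suc g)"
      using f[OF True, rule_format, of g] f[OF True, rule_format, of "Suc g"] g by auto
    moreover have "N + 1 - g = Suc (N - g)" "N + 1 - Suc g = N - g" using g by auto
    ultimately have "f (Suc (N - g)) = - f g" "f (N - g) = - f (Suc g)" by metis+
    then have "f (Suc (N - g)) - f (N - g) = f (Suc g) - f g" by linarith
    moreover have "h = g \<or> h = N - g" by (rule folded(3)[OF True g])
    ultimately show ?thesis by metis
  next
    case False
    then show ?thesis using inj_onD[OF unfolded[OF False] g(3) g(1,2)] by simp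
  qed
  define h where "h = (\<lambda>d. f (Suc (inv_into {1..<N} (gap e) d)) - f (inv_into {1..<N} (gap e) d))"
  obtain v where v: "\<forall>d\<in>\<Delta>. d \<bullet> v = h d" using prescribe[of h] by blast
  have gapv: "gap e g \<bullet> v = f (Suc g) - f g" if g: "g \<in> {1..<N}" for g
  proof -
    have im: "gap e g \<in> gap e ` {1..<N}" using g by blast
    have "h (gap e g) = f (Suc g) - f g"
      unfolding h_def by (rule cons) (use inv_into_into[OF im] f_inv_into_f[OF im] g in auto)
    then show ?thesis using v gap_in[OF g] by simp
  qed
  have tel: "1 \<le> k \<Longrightarrow> k \<le> N \<Longrightarrow> e k \<bullet> v - e 1 \<bullet> v = f k - f 1" for k
  proof (induction k rule: nat_induct_at_least[of 1])
    case (Suc k)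
    then show ?case using gapv[of k] by (simp add: gap_def inner_diff_left)
  qed simp
  have "e j \<bullet> v - e i \<bullet> v = f j - f i" if "i \<in> {1..N}" "j \<in> {1..N}" for i j
    using tel[of i] tel[of j] that by simp
  then show ?thesis using that by blast
qed

text \<open>Take the point of the orbit of \<open>v\<close> with the largest product with
  \<open>base\<close>; reflecting in a simple root with a negative product would increase
  it.\<close>

lemma chamber_exists: "\<exists>r\<in>W. inv r v \<in> D"
proof -
  obtain r where r: "r \<in> W" "\<And>r'. r' \<in> W \<Longrightarrow> inv r' v \<bullet> base \<le> inv r v \<bullet> base"
  proof -
    let ?M = "(\<lambda>r. inv r v \<bullet> base) ` W"
    have fin: "finite ?M" using finite_W by simp
    then have "Max ?M \<in> ?M" using W_id by (intro Max_in) auto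
    then obtain r where "r \<in> W" "Max ?M = inv r v \<bullet> base" by blast
    moreover have "inv r' v \<bullet> base \<le> Max ?M" if "r' \<in> W" for r' using fin that by (intro Max_ge) auto
    ultimately show ?thesis using that by auto
  qed
  have "0 \<le> d \<bullet> inv r v" if d: "d \<in> \<Delta>" for d
  proof (rule ccontr)
    assume "\<not> 0 \<le> d \<bullet> inv r v"
    then have neg: "d \<bullet> inv r v < 0" by simp
    let ?s = "reflection d"
    have s: "?s \<in> S" using d by (auto simp: S_def)
    have rs: "r \<circ> ?s \<in> W" by (rule W_comp[OF r(1) W_S[OF s]])
    have "(r \<circ> ?s) (?s (inv r v)) = v" by (simp add: reflection_involution inv_W_apply(1)[OF r(1)])
    then have "inv (r \<circ> ?s) v = ?s (inv r v)" using inv_W_apply(2)[OF rs] by metis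
    then have "inv (r \<circ> ?s) v \<bullet> base = inv r v \<bullet> base - (2 * (d \<bullet> inv r v) / (d \<bullet> d)) * (d \<bullet> base)"
      by (simp add: reflection_def inner_diff_left)
    also have "\<dots> > inv r v \<bullet> base" using neg \<Delta>_nz[OF d] base[OF d] by (simp add: divide_neg_pos)
    finally show False using r(2)[OF rs] by simp
  qed
  then show ?thesis using r(1) by (auto simp: D_def)
qed

lemma chamber_order:
  assumes r: "r \<in> W" "inv r v \<in> D" and ij: "i \<in> {1..N}" "j \<in> {1..N}" "values r i < values r j"
  shows "e i \<bullet> v \<le> e j \<bullet> v"
proof -
  have "i \<noteq> j" using ij by auto
  then have root: "inv r (e j - e i) \<in> \<Phi> \<or> - inv r (e j - e i) \<in> \<Phi>"
    using pair_root[OF ij(1,2)] W_root[OF W_inv[OF r(1)], of "e j - e i"] W_root[OF W_inv[OF r(1)], of "e i - e j"]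
      linear_neg[OF W_linear[OF W_inv[OF r(1)]], of "e i - e j"] by auto
  have "0 < (e j - e i) \<bullet> r base" using ij(3) by (simp add: values_def inner_diff_left)
  then have "0 < inv r (e j - e i) \<bullet> base" using W_inner_inv[OF r(1)] by simp
  then have "inv r (e j - e i) \<in> \<Phi>" using root root_base_pos[of "- inv r (e j - e i)"] by auto
  then have "0 \<le> inv r (e j - e i) \<bullet> inv r v" by (rule root_D[OF _ r(2)])
  then show ?thesis using W_inner[OF W_inv[OF r(1)]] by (simp add: inner_diff_left)
qed

lemma chamber_mem:
  assumes r: "r \<in> W"
    and le: "\<And>i j. i \<in> {1..N} \<Longrightarrow> j \<in> {1..N} \<Longrightarrow> values r i < values r j \<Longrightarrow> e i \<bullet> v \<le> e j \<bullet> v"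
  shows "inv r v \<in> D"
proof -
  have "0 \<le> gap e g \<bullet> inv r v" if g: "g \<in> {1..<N}" for g
  proof -
    have pos: "0 < r (gap e g) \<bullet> r base"
      using W_inner[OF r] root_base_pos[OF gap_root[OF g]] by simp
    have "r (gap e g) \<in> \<Phi> \<or> - r (gap e g) \<in> \<Phi>" by (rule W_root[OF r gap_root[OF g]])
    then obtain i j where ij: "i \<in> {1..N}" "j \<in> {1..N}" "r (gap e g) = e j - e i"
    proof
      assume "r (gap e g) \<in> \<Phi>"
      then obtain i j where "r (gap e g) = e j - e i" "1 \<le> i" "i < j" "j \<le> N"
        unfolding \<Phi>_def by blast
      then show ?thesis using that[of i j] by simp
    next
      assume "- r (gap e g) \<in> \<Phi>"
      then obtain i j where "- r (gap e g) = e j - e i" "i \<in> {1..N}" "j \<in> {1..N}" by (force simp: \<Phi>_def)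
      moreover from this(1) have "r (gap e g) = e i - e j" by (metis minus_diff_eq minus_minus)
      ultimately show ?thesis using that by blast
    qed
    then have "values r i < values r j" using pos by (simp add: values_def inner_diff_left)
    then have "0 \<le> (e j - e i) \<bullet> v" using le ij by (simp add: inner_diff_left)
    also have "(e j - e i) \<bullet> v = gap e g \<bullet> inv r v"
      using W_inner[OF r, of "gap e g" "inv r v"] inv_W_apply(1)[OF r] ij(3) by simp
    finally show ?thesis .
  qed
  then show ?thesis by (auto simp: D_def \<Delta>_def)
qed

lemma chamber_generic:
  assumes v: "inj_on (\<lambda>k. e k \<bullet> v) {1..N}"
  obtains r where "r \<in> W"
    "\<And>i j. i \<in> {1..N} \<Longrightarrow> j \<in> {1..N} \<Longrightarrow> values r i < values r j \<longleftrightarrow> e i \<bullet> v < e j \<bullet> v"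
proof -
  obtain r where r: "r \<in> W" "inv r v \<in> D" using chamber_exists by blast
  have 1: "e i \<bullet> v < e j \<bullet> v" if ij: "i \<in> {1..N}" "j \<in> {1..N}" "values r i < values r j" for i j
  proof -
    have "i \<noteq> j" using ij(3) by auto
    then have "e i \<bullet> v \<noteq> e j \<bullet> v" using inj_onD[OF v _ ij(1,2)] by blast
    then show ?thesis using chamber_order[OF r ij] by simp
  qed
  have "values r i < values r j \<longleftrightarrow> e i \<bullet> v < e j \<bullet> v" if ij: "i \<in> {1..N}" "j \<in> {1..N}" for i j
  proof (cases "i = j")
    case False
    then have "values r i \<noteq> values r j" using inj_onD[OF values_inj[OF r(1)] _ ij] by blast
    then show ?thesis
      using 1[OF ij] 1[OF ij(2,1)] by (cases "values r i < values r j") auto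
  qed simp
  then show ?thesis using that r(1) by blast
qed

section \<open>The Cambrian projection in terms of arrows\<close>

lemma values_folded: "folded \<Longrightarrow> k \<in> {1..N} \<Longrightarrow> values w (N + 1 - k) = - values w k"
  using folded(2) by (simp add: values_def)

lemma parity_folded: "folded \<Longrightarrow> k \<in> {1..N} \<Longrightarrow> parity b (N + 1 - k) \<longleftrightarrow> \<not> parity b k"
  using folded(1) by (auto simp: parity_def)

lemma decreasing_arrows_element:
  obtains r where "r \<in> W"
    "\<And>i j. i \<in> {1..N} \<Longrightarrow> j \<in> {1..N} \<Longrightarrow> i < j \<Longrightarrow>
      values r j < values r i \<longleftrightarrow> (j, i) \<in> arrows N (parity b) (values w)"
proof (rule realise_decreasing_arrows[of N "parity b" "values w"])
  fix f :: "nat \<Rightarrow> real"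
  assume f: "inj_on f {1..N}"
    "\<And>i j. i \<in> {1..N} \<Longrightarrow> j \<in> {1..N} \<Longrightarrow> i < j \<Longrightarrow> f j < f i \<longleftrightarrow> (j, i) \<in> arrows N (parity b) (values w)"
    "(\<And>k. k \<in> {1..N} \<Longrightarrow> values w (N + 1 - k) = - values w k) \<Longrightarrow>
      (\<And>k. k \<in> {1..N} \<Longrightarrow> parity b (N + 1 - k) \<longleftrightarrow> \<not> parity b k) \<Longrightarrow>
      (\<And>k. k \<in> {1..N} \<Longrightarrow> f (N + 1 - k) = - f k)"
  have "folded \<Longrightarrow> \<forall>k\<in>{1..N}. f (N + 1 - k) = - f k"
    using f(3) values_folded parity_folded by blast
  then obtain v where v: "\<And>i j. i \<in> {1..N} \<Longrightarrow> j \<in> {1..N} \<Longrightarrow> e j \<bullet> v - e i \<bullet> v = f j - f i"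
    using realise_values[of f] by blast
  have "inj_on (\<lambda>k. e k \<bullet> v) {1..N}"
  proof (rule inj_onI)
    fix i j assume ij: "i \<in> {1..N}" "j \<in> {1..N}" "e i \<bullet> v = e j \<bullet> v"
    then have "f i = f j" using v[OF ij(1,2)] by simp
    then show "i = j" using inj_onD[OF f(1) _ ij(1,2)] by blast
  qed
  then obtain r where r: "r \<in> W"
    "\<And>i j. i \<in> {1..N} \<Longrightarrow> j \<in> {1..N} \<Longrightarrow> values r i < values r j \<longleftrightarrow> e i \<bullet> v < e j \<bullet> v"
    using chamber_generic by blast
  have "values r j < values r i \<longleftrightarrow> (j, i) \<in> arrows N (parity b) (values w)"
    if ij: "i \<in> {1..N}" "j \<in> {1..N}" "i < j" for i j
    using r(2)[OF ij(2,1)] v[OF ij(1,2)] f(2)[OF ij] by auto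
  then show thesis using that r(1) by blast
qed

text \<open>An element with the decreasing arrows of \<open>w\<close> as inversions is aligned and
  lies below \<open>w\<close>. Every inversion of an aligned element below \<open>w\<close> is a
  decreasing arrow of that element; it is made of inversions that \<open>w\<close> shares, so it is
  an arrow of \<open>w\<close>.\<close>

lemma pi_down_inversions:
  assumes sort: "\<And>w. sortable S c w \<longleftrightarrow> w \<in> W \<and> aligned N (parity b) (values w)" and w: "w \<in> W"
  shows "pi_down S c w \<in> W"
    "i \<in> {1..N} \<Longrightarrow> j \<in> {1..N} \<Longrightarrow> i < j \<Longrightarrow>
      values (pi_down S c w) j < values (pi_down S c w) i \<longleftrightarrow> (j, i) \<in> arrows N (parity b) (values w)"
proof -
  obtain r where r: "r \<in> W" "\<And>i j. i \<in> {1..N} \<Longrightarrow> j \<in> {1..N} \<Longrightarrow> i < j \<Longrightarrow>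
      values r j < values r i \<longleftrightarrow> (j, i) \<in> arrows N (parity b) (values w)"
    using decreasing_arrows_element by blast
  have srt: "sortable S c r" using sort r aligned_if_inversions_arrows by blast
  have rw: "weak_le S r w"
    unfolding weak_le_iff[OF r(1) w] inversions_subset_iff using r(2) arrows_less by blast
  have max: "weak_le S u r" if u: "sortable S c u" "weak_le S u w" for u
  proof -
    have uW: "u \<in> W" and al: "aligned N (parity b) (values u)" using u(1) sort by auto
    have sub: "\<And>i j. i \<in> {1..N} \<Longrightarrow> j \<in> {1..N} \<Longrightarrow> i < j \<Longrightarrow> values u j < values u i \<Longrightarrow> values w j < values w i"
      using u(2) unfolding weak_le_iff[OF uW w] inversions_subset_iff by blast
    show ?thesis
      unfolding weak_le_iff[OF uW r(1)] inversions_subset_iff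
    proof (intro ballI impI)
      fix i j assume ij: "i \<in> {1..N}" "j \<in> {1..N}" "i < j" "values u j < values u i"
      have "(j, i) \<in> arrows N (parity b) (values w)"
        by (rule arrow_if_inversions_subset[OF aligned_imp_decreasing_arrow[OF al ij] ij(3) sub])
      then show "values r j < values r i" using r(2)[OF ij(1,2,3)] by simp
    qed
  qed
  have "pi_down S c w = r"
    unfolding pi_down_def
  proof (rule the_equality)
    show "sortable S c r \<and> weak_le S r w \<and> (\<forall>u. sortable S c u \<and> weak_le S u w \<longrightarrow> weak_le S u r)"
      using srt rw max by blast
    fix v assume v: "sortable S c v \<and> weak_le S v w \<and> (\<forall>u. sortable S c u \<and> weak_le S u w \<longrightarrow> weak_le S u v)"
    then have vW: "v \<in> W" using sort by blast
    have "weak_le S v r" "weak_le S r v" using v max srt rw by blast+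
    then show "v = r" using inversions_inj[OF vW r(1)] weak_le_iff vW r(1) by blast
  qed
  then show "pi_down S c w \<in> W" "i \<in> {1..N} \<Longrightarrow> j \<in> {1..N} \<Longrightarrow> i < j \<Longrightarrow>
      values (pi_down S c w) j < values (pi_down S c w) i \<longleftrightarrow> (j, i) \<in> arrows N (parity b) (values w)"
    using r by auto
qed

lemma pi_down_eq_iff:
  assumes sort: "\<And>w. sortable S c w \<longleftrightarrow> w \<in> W \<and> aligned N (parity b) (values w)"
    and uw: "u \<in> W" "w \<in> W"
  shows "pi_down S c u = pi_down S c w \<longleftrightarrow>
    arrows N (parity b) (values w) = arrows N (parity b) (values u)"
proof
  assume eq: "pi_down S c u = pi_down S c w"
  show "arrows N (parity b) (values w) = arrows N (parity b) (values u)"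
  proof (rule arrows_eq_if_decreasing_eq[OF values_inj[OF uw(1)] values_inj[OF uw(2)]])
    fix a a' :: nat assume "a' < a"
    then show "(a, a') \<in> arrows N (parity b) (values u) \<longleftrightarrow> (a, a') \<in> arrows N (parity b) (values w)"
      using pi_down_inversions(2)[OF sort uw(1), of a' a] pi_down_inversions(2)[OF sort uw(2), of a' a]
        arrows_range[of a a'] eq by metis
  qed
next
  assume eq: "arrows N (parity b) (values w) = arrows N (parity b) (values u)"
  have "inversions (pi_down S c u) \<subseteq> inversions (pi_down S c w)"
    "inversions (pi_down S c w) \<subseteq> inversions (pi_down S c u)"
    unfolding inversions_subset_iff
    using pi_down_inversions(2)[OF sort uw(1)] pi_down_inversions(2)[OF sort uw(2)] eq by blast+
  then show "pi_down S c u = pi_down S c w"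
    using inversions_inj[OF pi_down_inversions(1)[OF sort uw(1)] pi_down_inversions(1)[OF sort uw(2)]] by blast
qed

text \<open>Reversing a word for \<open>c\<close> exchanges the roles of the two parts, so
  \<open>inv c\<close> belongs to the complementary labelling.\<close>

lemma bicambrian_equiv_iff:
  assumes c: "bipartite_coxeter_element S c" and uw: "u \<in> W" "w \<in> W"
  shows "bicambrian_equiv S c u w \<longleftrightarrow>
    (\<forall>b. arrows N (parity b) (values w) = arrows N (parity b) (values u))"
proof -
  obtain ps ms where bi: "distinct ps" "distinct ms" "set ps \<union> set ms = S" "set ps \<inter> set ms = {}"
      "pairwise_commuting (set ps)" "pairwise_commuting (set ms)" "c = word_product ps \<circ> word_product ms"
    using c unfolding bipartite_coxeter_element_def by blast
  have l: "ps @ ms \<in> lists S" "c = word_product (ps @ ms)" using bi by (auto simp: word_product_append)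
  have "inv c = word_product (rev (ps @ ms))" using inv_word_product[OF l(1)] l(2) by simp
  then have invc: "inv c = word_product (rev ms) \<circ> word_product (rev ps)"
    by (simp add: word_product_append)
  have 1: "letter 1 \<in> set ms \<longleftrightarrow> letter 1 \<notin> set ps" using letter_in_S[of 1] two_le_N bi(3,4) by auto
  have s1: "sortable S c w \<longleftrightarrow> w \<in> W \<and> aligned N (parity (letter 1 \<in> set ps)) (values w)" for w
    unfolding bi(7) by (rule sortable_iff_aligned[OF bi(1-6)])
  have s2: "sortable S (inv c) w \<longleftrightarrow> w \<in> W \<and> aligned N (parity (letter 1 \<notin> set ps)) (values w)" for w
    unfolding invc 1[symmetric] using sortable_iff_aligned[of "rev ms" "rev ps" w] bi by (simp add: Un_commute Int_commute)
  show ?thesis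
    unfolding bicambrian_equiv_def pi_down_eq_iff[OF s1 uw] pi_down_eq_iff[OF s2 uw]
    by (cases "letter 1 \<in> set ps") (auto simp: all_bool_eq)
qed

definition "wedge u = {v. \<forall>(a, b)\<in>biarrows N (values u). e a \<bullet> v \<le> e b \<bullet> v}"

lemma wedgeD: "v \<in> wedge u \<Longrightarrow> (a, b) \<in> biarrows N (values u) \<Longrightarrow> e a \<bullet> v \<le> e b \<bullet> v"
  by (auto simp: wedge_def)

lemma bicambrian_cone_eq_wedge:
  assumes simple: "simple_reflections W D = S" and c: "bipartite_coxeter_element S c" and u: "u \<in> W"
  shows "bicambrian_cone W D c u = wedge u"
proof
  show "bicambrian_cone W D c u \<subseteq> wedge u"
  proof
    fix v assume "v \<in> bicambrian_cone W D c u"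
    then obtain w where w: "w \<in> W" "bicambrian_equiv S c u w" "v \<in> w ` D"
      by (auto simp: bicambrian_cone_def simple)
    then have "inv w v \<in> D" using inv_W_apply(2)[OF w(1)] by auto
    moreover have "biarrows N (values w) = biarrows N (values u)"
      using w bicambrian_equiv_iff[OF c u w(1)] by (simp add: biarrows_def)
    ultimately show "v \<in> wedge u"
      unfolding wedge_def using chamber_order[OF w(1)] biarrows_less biarrows_range by blast
  qed
  show "wedge u \<subseteq> bicambrian_cone W D c u"
  proof
    fix v assume v: "v \<in> wedge u"
    \<comment> \<open>A boundary point is pushed towards the chamber of \<open>u\<close>. The
      perturbed point lies in a chamber of the class, and the closure of that chamber contains
      \<open>v\<close>.\<close>
    obtain t where t: "0 < t" "inj_on (\<lambda>k. e k \<bullet> v + t * values u k) {1..N}"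
      "\<And>i j. i \<in> {1..N} \<Longrightarrow> j \<in> {1..N} \<Longrightarrow> e i \<bullet> v < e j \<bullet> v \<Longrightarrow> e i \<bullet> v + t * values u i < e j \<bullet> v + t * values u j"
      using perturbation[OF values_inj[OF u], of "\<lambda>k. e k \<bullet> v"] by blast
    define v' where "v' = v + t *\<^sub>R u base"
    have v': "e k \<bullet> v' = e k \<bullet> v + t * values u k" for k by (simp add: v'_def inner_add_right values_def)
    obtain r where r: "r \<in> W"
      "\<And>i j. i \<in> {1..N} \<Longrightarrow> j \<in> {1..N} \<Longrightarrow> values r i < values r j \<longleftrightarrow> e i \<bullet> v' < e j \<bullet> v'"
      using chamber_generic[of v'] t(2) unfolding v' by blast
    have "values r a < values r b" if ab: "(a, b) \<in> biarrows N (values u)" for a b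
    proof -
      have "e a \<bullet> v \<le> e b \<bullet> v" by (rule wedgeD[OF v ab])
      then have "e a \<bullet> v' < e b \<bullet> v'" unfolding v' using biarrows_less[OF ab] t(1) by (simp add: add_le_less_mono)
      then show ?thesis using r(2) biarrows_range[OF ab] by blast
    qed
    then have "bicambrian_equiv S c u r"
      unfolding bicambrian_equiv_iff[OF c u r(1)] using biarrows_eqI(2)[OF values_inj[OF u]] by blast
    moreover have "inv r v \<in> D"
    proof (rule chamber_mem[OF r(1)])
      fix i j assume ij: "i \<in> {1..N}" "j \<in> {1..N}" "values r i < values r j"
      show "e i \<bullet> v \<le> e j \<bullet> v"
      proof (rule ccontr)
        assume "\<not> e i \<bullet> v \<le> e j \<bullet> v"
        then have "e j \<bullet> v' < e i \<bullet> v'" unfolding v' using t(3)[OF ij(2,1)] by simp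
        then show False using r(2)[OF ij(1,2)] ij(3) by simp
      qed
    qed
    then have "v \<in> r ` D" using inv_W_apply(1)[OF r(1)] by (metis image_eqI)
    ultimately show "v \<in> bicambrian_cone W D c u"
      using r(1) by (auto simp: bicambrian_cone_def simple)
  qed
qed

text \<open>
  The walls of a cone are indexed by covers, in the folded case up to the symmetry
  \<open>(a, b) \<mapsto> (N + 1 - b, N + 1 - a)\<close>. A dependency between the wall normals lifts to one between
  all covers.
\<close>

definition "normals u = (\<lambda>(a, b). e b - e a) ` covers N (values u)"

lemma wedge_normals: "wedge u = {v. \<forall>d\<in>normals u. 0 \<le> d \<bullet> v}"
proof -
  have "v \<in> wedge u \<longleftrightarrow> (\<forall>(a, b)\<in>covers N (values u). e a \<bullet> v \<le> e b \<bullet> v)" for v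
  proof
    assume v: "v \<in> wedge u"
    show "\<forall>(a, b)\<in>covers N (values u). e a \<bullet> v \<le> e b \<bullet> v" using wedgeD[OF v] covers_biarrows by blast
  next
    assume "\<forall>(a, b)\<in>covers N (values u). e a \<bullet> v \<le> e b \<bullet> v"
    then show "v \<in> wedge u"
      unfolding wedge_def using covers_le_imp_biarrows_le[where y = "\<lambda>k. e k \<bullet> v"] by blast
  qed
  then show ?thesis by (auto simp: normals_def inner_diff_left split_beta)
qed

text \<open>A vector orthogonal to all normals has equal products at the ends of every cover, hence
  of every arrow; consecutive indices are comparable, so it is orthogonal to all gaps.\<close>

lemma span_normals:
  assumes u: "u \<in> W"
  shows "span (normals u) = UNIV"
proof (rule span_UNIV_if_orthogonal_0)
  fix x assume x: "\<And>d. d \<in> normals u \<Longrightarrow> d \<bullet> x = 0"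
  have 0: "e b \<bullet> x = e a \<bullet> x" if "(a, b) \<in> covers N (values u)" for a b
    using x[of "e b - e a"] that by (force simp: normals_def inner_diff_left)
  have eq: "e a \<bullet> x = e b \<bullet> x" if "(a, b) \<in> biarrows N (values u)" for a b
  proof -
    have "e a \<bullet> x \<le> e b \<bullet> x"
      by (rule covers_le_imp_biarrows_le[where y = "\<lambda>k. e k \<bullet> x"]) (use 0 that in auto)
    moreover have "- (e a \<bullet> x) \<le> - (e b \<bullet> x)"
      by (rule covers_le_imp_biarrows_le[where y = "\<lambda>k. - (e k \<bullet> x)"]) (use 0 that in auto)
    ultimately show ?thesis by simp
  qed
  show "x = 0"
  proof (rule \<Delta>_eq_0)
    fix g assume g: "g \<in> {1..<N}"
    then show "gap e g \<bullet> x = 0"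
      using consecutive_comparable[OF values_inj[OF u], of g] eq[of g "Suc g"] eq[of "Suc g" g]
      by (auto simp: gap_def inner_diff_left)
  qed
qed

lemma independent_normals:
  assumes u: "u \<in> W"
  shows "independent (normals u)"
proof (rule independent_if_scalars_zero)
  let ?E = "covers N (values u)"
  let ?d = "\<lambda>(a, b). e b - e a"
  have finE: "finite ?E" by (rule finite_covers)
  show "finite (normals u)" using finE by (simp add: normals_def)
  fix m x assume dep: "(\<Sum>d\<in>normals u. m d *\<^sub>R d) = 0" and x: "x \<in> normals u"
  \<comment> \<open>Several covers may share a normal; its coefficient is divided evenly among
    them.\<close>
  define mult where "mult = (\<lambda>d. card {E \<in> ?E. ?d E = d})"
  have mult: "mult (?d E) \<noteq> 0" if "E \<in> ?E" for E
  proof -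
    have "{E' \<in> ?E. ?d E' = ?d E} \<noteq> {}" using that by blast
    then show ?thesis using finE by (simp add: mult_def card_eq_0_iff)
  qed
  define coef where "coef = (\<lambda>E. m (?d E) / mult (?d E))"
  have sum0: "(\<Sum>E\<in>?E. coef E * (?d E \<bullet> v)) = 0" for v
  proof -
    have "(\<Sum>E\<in>?E. coef E * (?d E \<bullet> v)) = (\<Sum>d\<in>normals u. \<Sum>E\<in>{E \<in> ?E. ?d E = d}. coef E * (?d E \<bullet> v))"
      unfolding normals_def by (rule sum.image_gen[OF finE])
    also have "\<dots> = (\<Sum>d\<in>normals u. m d * (d \<bullet> v))"
    proof (rule sum.cong[OF refl])
      fix d assume "d \<in> normals u"
      then have nz: "real (mult d) \<noteq> 0" using mult by (auto simp: normals_def)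
      have "(\<Sum>E\<in>{E \<in> ?E. ?d E = d}. coef E * (?d E \<bullet> v)) = (\<Sum>E\<in>{E \<in> ?E. ?d E = d}. m d / mult d * (d \<bullet> v))"
        by (rule sum.cong) (auto simp: coef_def)
      also have "\<dots> = real (mult d) * (m d / mult d * (d \<bullet> v))" by (simp add: mult_def)
      also have "\<dots> = m d * (d \<bullet> v)" using nz by simp
      finally show "(\<Sum>E\<in>{E \<in> ?E. ?d E = d}. coef E * (?d E \<bullet> v)) = m d * (d \<bullet> v)" .
    qed
    also have "\<dots> = (\<Sum>d\<in>normals u. m d *\<^sub>R d) \<bullet> v" by (simp add: inner_sum_left)
    finally show ?thesis using dep by simp
  qed
  have realised: "(\<Sum>E\<in>?E. coef E * (f (snd E) - f (fst E))) = 0"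
    if f: "folded \<Longrightarrow> \<forall>k\<in>{1..N}. f (N + 1 - k) = - f k" for f :: "nat \<Rightarrow> real"
  proof -
    obtain v where v: "\<And>i j. i \<in> {1..N} \<Longrightarrow> j \<in> {1..N} \<Longrightarrow> e j \<bullet> v - e i \<bullet> v = f j - f i"
      using realise_values[OF f] by blast
    have "(\<Sum>E\<in>?E. coef E * (f (snd E) - f (fst E))) = (\<Sum>E\<in>?E. coef E * (?d E \<bullet> v))"
    proof (rule sum.cong[OF refl])
      fix E assume E: "E \<in> ?E"
      obtain a b where ab: "E = (a, b)" by (cases E)
      show "coef E * (f (snd E) - f (fst E)) = coef E * (?d E \<bullet> v)"
        using v[of a b] covers_range[of a b] E ab by (simp add: inner_diff_left)
    qed
    then show ?thesis using sum0 by simp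
  qed
  have all: "(\<Sum>E\<in>?E. coef E * (f (snd E) - f (fst E))) = 0" for f :: "nat \<Rightarrow> real"
  proof (cases folded)
    case True
    let ?\<sigma> = "\<lambda>(a, b). (N + 1 - b, N + 1 - a)"
    have \<sigma>: "?\<sigma> E \<in> ?E" "?\<sigma> (?\<sigma> E) = E" "?d (?\<sigma> E) = ?d E" if E: "E \<in> ?E" for E
    proof -
      obtain a b where ab: "E = (a, b)" by (cases E)
      note rng = covers_range[OF E[unfolded ab]]
      show "?\<sigma> E \<in> ?E"
        using covers_reflect[OF E[unfolded ab] folded(1)[OF True] values_folded[OF True]] ab by simp
      show "?\<sigma> (?\<sigma> E) = E" using rng ab by auto
      show "?d (?\<sigma> E) = ?d E" using folded(2)[OF True] rng ab by simp
    qed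
    \<comment> \<open>In the folded case only antisymmetric functions come from vectors, so an
      arbitrary \<open>f\<close> is antisymmetrised. The coefficients are invariant under the
      symmetry, so the sum for \<open>f'\<close> is twice the sum for \<open>f\<close>.\<close>
    define f' where "f' = (\<lambda>k. f k - f (N + 1 - k))"
    have "(\<Sum>E\<in>?E. coef E * (f' (snd E) - f' (fst E))) = 0"
      by (rule realised) (auto simp: f'_def)
    moreover have "coef E * (f' (snd E) - f' (fst E))
        = coef E * (f (snd E) - f (fst E)) + coef E * (f (snd (?\<sigma> E)) - f (fst (?\<sigma> E)))" for E
      by (simp add: f'_def algebra_simps split: prod.split)
    moreover have "(\<Sum>E\<in>?E. coef E * (f (snd (?\<sigma> E)) - f (fst (?\<sigma> E)))) = (\<Sum>E\<in>?E. coef E * (f (snd E) - f (fst E)))"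
      by (rule sum.reindex_bij_witness[where i = ?\<sigma> and j = ?\<sigma>]) (use \<sigma> in \<open>auto simp: coef_def\<close>)
    ultimately have "2 * (\<Sum>E\<in>?E. coef E * (f (snd E) - f (fst E))) = 0"
      by (simp add: sum.distrib)
    then show ?thesis by simp
  qed (use realised in blast)
  obtain E where E: "E \<in> ?E" "x = ?d E" using x by (auto simp: normals_def)
  have "coef E = 0" by (rule covers_independent[OF values_inj[OF u] all E(1)])
  then show "m x = 0" using mult[OF E(1)] E(2) by (simp add: coef_def)
qed

lemma simplicial_cone_wedge: "u \<in> W \<Longrightarrow> simplicial_cone (wedge u)"
  unfolding wedge_normals by (rule simplicial_cone_halfspaces[OF independent_normals span_normals])

lemma wedge_Int_face:
  assumes u: "u \<in> W"
  shows "wedge u \<inter> wedge v face_of wedge u"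
  unfolding face_of_def
proof (intro conjI ballI impI)
  have cvx: "convex (wedge w)" for w
    unfolding wedge_normals by (auto simp: convex_def inner_add_right intro: add_nonneg_nonneg)
  show "convex (wedge u \<inter> wedge v)" by (intro convex_Int cvx)
  fix y z x assume yz: "y \<in> wedge u" "z \<in> wedge u" and x: "x \<in> wedge u \<inter> wedge v" "x \<in> open_segment y z"
  obtain s where s: "0 < s" "s < 1" "x = (1 - s) *\<^sub>R y + s *\<^sub>R z"
    using x(2) by (auto simp: in_segment)
  have "e a \<bullet> y \<le> e b \<bullet> y \<and> e a \<bullet> z \<le> e b \<bullet> z" if ab: "(a, b) \<in> biarrows N (values v)" for a b
  proof -
    obtain c where c: "(a, b) \<in> arrows N (parity c) (values v)" using ab by (auto simp: biarrows_def)
    show ?thesis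
    proof (rule arrows_segment[OF values_inj[OF u] s(1,2) _ _ _ c])
      fix a b assume ab: "(a, b) \<in> arrows N (parity c) (values u)"
      then have ab': "(a, b) \<in> biarrows N (values u)" by (auto simp: biarrows_def)
      show "e a \<bullet> y \<le> e b \<bullet> y" "e a \<bullet> z \<le> e b \<bullet> z" using wedgeD[OF _ ab'] yz by auto
    next
      fix a b assume "(a, b) \<in> arrows N (parity c) (values v)"
      then have "e a \<bullet> x \<le> e b \<bullet> x" using wedgeD[of x v] x(1) by (auto simp: biarrows_def)
      then show "(1 - s) * (e a \<bullet> y) + s * (e a \<bullet> z) \<le> (1 - s) * (e b \<bullet> y) + s * (e b \<bullet> z)"
        unfolding s(3) by (simp add: inner_add_right)
    qed
  qed
  then show "y \<in> wedge u \<inter> wedge v" "z \<in> wedge u \<inter> wedge v" using yz by (auto simp: wedge_def)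
qed auto

theorem simplicial_fan_biCamb:
  assumes simple: "simple_reflections W D = S" and c: "bipartite_coxeter_element S c"
  shows "simplicial_fan (biCamb W D c)"
proof -
  have "biCamb W D c = {F. F \<noteq> {} \<and> (\<exists>C\<in>wedge ` W. F face_of C)}"
    unfolding biCamb_def using bicambrian_cone_eq_wedge[OF simple c] by auto
  moreover have "simplicial_fan {F. F \<noteq> {} \<and> (\<exists>C\<in>wedge ` W. F face_of C)}"
  proof (rule simplicial_fan_faces)
    show "finite (wedge ` W)" "wedge ` W \<noteq> {}" using finite_W W_id by auto
    show "simplicial_cone C" if "C \<in> wedge ` W" for C using that simplicial_cone_wedge by blast
    show "C \<inter> C' face_of C" if "C \<in> wedge ` W" "C' \<in> wedge ` W" for C C'
      using that wedge_Int_face by blast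
  qed
  ultimately show ?thesis by simp
qed

end

section \<open>Simple roots of a finite reflection group\<close>

lemma reflection_scaleR: "k \<noteq> 0 \<Longrightarrow> reflection (k *\<^sub>R a) = reflection a"
  by (rule ext) (simp add: reflection_def power2_eq_square)

lemma reflection_uminus: "reflection (- a) = reflection a"
  using reflection_scaleR[of "-1" a] by simp

lemma hyperplane_fixed: "a \<noteq> 0 \<Longrightarrow> hyperplane a = {x. reflection a x = x}"
  by (auto simp: hyperplane_def reflection_def)

lemma reflection_isometry: "reflection a x \<bullet> reflection a y = x \<bullet> y"
  by (simp add: inner_reflection reflection_involution)

lemma reflection_conjugate:
  "reflection (reflection a b) = reflection a \<circ> reflection b \<circ> reflection a"
proof
  fix x
  have "reflection a (reflection b (reflection a x))
      = reflection a (reflection a x) - (2 * (b \<bullet> reflection a x) / (b \<bullet> b)) *\<^sub>R reflection a b"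
    unfolding reflection_def[of b]
    by (simp add: linear_diff[OF linear_reflection] linear_cmul[OF linear_reflection])
  then show "reflection (reflection a b) x = (reflection a \<circ> reflection b \<circ> reflection a) x"
    by (simp add: reflection_def[of "reflection a b"] reflection_involution reflection_isometry inner_reflection)
qed

text \<open>Finiteness of \<open>W\<close> makes two powers coincide, so the \<open>LEAST\<close> in
  \<open>map_order\<close> is attained and not a junk value.\<close>

lemma map_order_power:
  fixes f :: "'a \<Rightarrow> 'a"
  assumes "finite W" "bij f" "\<And>k. f ^^ k \<in> W"
  shows "0 < map_order f" "f ^^ map_order f = id" "0 < k \<Longrightarrow> k < map_order f \<Longrightarrow> f ^^ k \<noteq> id"
proof -
  have "\<not> inj (\<lambda>k. f ^^ k)"
  proof
    assume "inj (\<lambda>k. f ^^ k)"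
    then have "infinite (range (\<lambda>k. f ^^ k))" by (rule range_inj_infinite)
    moreover have "range (\<lambda>k. f ^^ k) \<subseteq> W" using assms(3) by blast
    ultimately show False using assms(1) finite_subset by blast
  qed
  then obtain i j where "f ^^ i = f ^^ j" "i \<noteq> j" by (auto simp: inj_on_def)
  then obtain i j where ij: "f ^^ i = f ^^ j" "i < j" by (metis linorder_neqE_nat)
  have "f ^^ i \<circ> f ^^ (j - i) = f ^^ (i + (j - i))" by (simp only: funpow_add)
  also have "\<dots> = f ^^ i \<circ> id" using ij by simp
  finally have "f ^^ i \<circ> f ^^ (j - i) = f ^^ i \<circ> id" .
  moreover have "inj (f ^^ i)" using assms(2) by (simp add: bij_is_inj inj_fn)
  ultimately have "f ^^ (j - i) = id" by (metis fun.inj_map_strong injD comp_apply ext)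
  then have ex: "0 < j - i \<and> f ^^ (j - i) = id" using ij by simp
  from LeastI[where P = "\<lambda>k. 0 < k \<and> f ^^ k = id", OF ex]
  show "0 < map_order f" "f ^^ map_order f = id" by (simp_all add: map_order_def)
  show "0 < k \<Longrightarrow> k < map_order f \<Longrightarrow> f ^^ k \<noteq> id"
    using not_less_Least[of k "\<lambda>k. 0 < k \<and> f ^^ k = id"] by (auto simp: map_order_def)
qed

section \<open>Angles between simple roots from the orders of products\<close>

lemma reflection_combination:
  "reflection a (x *\<^sub>R a + y *\<^sub>R b) = (- x - 2 * (a \<bullet> b) / (a \<bullet> a) * y) *\<^sub>R a + y *\<^sub>R b"
proof -
  have "reflection a b = b - (2 * (a \<bullet> b) / (a \<bullet> a)) *\<^sub>R a" by (simp add: reflection_def)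
  then show ?thesis
    unfolding linear_add[OF linear_reflection] linear_cmul[OF linear_reflection] reflection_self
    by (simp only:) (simp add: scaleR_left_diff_distrib scaleR_right_diff_distrib mult.commute)
qed

lemma reflection_combination':
  "reflection b (x *\<^sub>R a + y *\<^sub>R b) = x *\<^sub>R a + (- y - 2 * (a \<bullet> b) / (b \<bullet> b) * x) *\<^sub>R b"
  using reflection_combination[of b y x a] by (simp add: add.commute inner_commute)

context
  fixes a b :: "'a::euclidean_space"
  assumes indep: "\<And>x y. x *\<^sub>R a + y *\<^sub>R b = 0 \<Longrightarrow> x = 0 \<and> y = 0"
begin

lemma combination_eq: "x *\<^sub>R a + y *\<^sub>R b = x' *\<^sub>R a + y' *\<^sub>R b \<Longrightarrow> x = x' \<and> y = y'"
  using indep[of "x - x'" "y - y'"] by (simp add: algebra_simps)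

lemma combination_nz: "a \<bullet> a \<noteq> 0" "b \<bullet> b \<noteq> 0"
  using indep[of 1 0] indep[of 0 1] by auto

text \<open>The relation is rewritten as the equality of the two alternating products of length 2.
  Applied to \<open>a\<close> and compared in the basis \<open>a\<close>, \<open>b\<close>, it is a
  polynomial equation in the two Cartan numbers; orders 3 and 4 are treated likewise.\<close>

lemma order_2_inner:
  assumes "(reflection a \<circ> reflection b) ^^ 2 = id"
  shows "a \<bullet> b = 0"
proof -
  let ?s = "reflection a" and ?t = "reflection b"
  have "?s (?t (?s (?t x))) = x" for x using fun_cong[OF assms, of x] by (simp add: numeral_2_eq_2)
  from this[of "?t (?s (1 *\<^sub>R a + 0 *\<^sub>R b))"]
  have "?s (?t (1 *\<^sub>R a + 0 *\<^sub>R b)) = ?t (?s (1 *\<^sub>R a + 0 *\<^sub>R b))"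
    by (simp only: reflection_involution)
  note combination_eq[OF this[unfolded reflection_combination reflection_combination']]
  then show ?thesis using combination_nz by simp
qed

lemma commute_if_inner_0: "a \<bullet> b = 0 \<Longrightarrow> (reflection a \<circ> reflection b) ^^ 2 = id"
  by (rule ext) (simp add: numeral_2_eq_2 reflection_def inner_diff_right inner_commute algebra_simps)

lemma order_3_inner:
  assumes "(reflection a \<circ> reflection b) ^^ 3 = id"
  shows "4 * (a \<bullet> b)\<^sup>2 = (a \<bullet> a) * (b \<bullet> b)"
proof -
  let ?s = "reflection a" and ?t = "reflection b"
  define p where "p = 2 * (a \<bullet> b) / (a \<bullet> a)"
  define q where "q = 2 * (a \<bullet> b) / (b \<bullet> b)"
  have "?s (?t (?s (?t (?s (?t x))))) = x" for x using fun_cong[OF assms, of x] by (simp add: numeral_3_eq_3)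
  from this[of "?t (?s (?t (1 *\<^sub>R a + 0 *\<^sub>R b)))"]
  have "?s (?t (?s (1 *\<^sub>R a + 0 *\<^sub>R b))) = ?t (?s (?t (1 *\<^sub>R a + 0 *\<^sub>R b)))"
    by (simp only: reflection_involution)
  note combination_eq[OF this[unfolded reflection_combination reflection_combination', folded p_def q_def]]
  then have "p * q = 1" by (simp add: algebra_simps)
  then show ?thesis using combination_nz by (simp add: p_def q_def field_simps power2_eq_square)
qed

lemma order_4_inner:
  assumes "(reflection a \<circ> reflection b) ^^ 4 = id" "(reflection a \<circ> reflection b) ^^ 2 \<noteq> id"
  shows "2 * (a \<bullet> b)\<^sup>2 = (a \<bullet> a) * (b \<bullet> b)"
proof -
  let ?s = "reflection a" and ?t = "reflection b"
  define p where "p = 2 * (a \<bullet> b) / (a \<bullet> a)"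
  define q where "q = 2 * (a \<bullet> b) / (b \<bullet> b)"
  have "?s (?t (?s (?t (?s (?t (?s (?t x))))))) = x" for x
    using fun_cong[OF assms(1), of x] by (simp add: numeral_eq_Suc)
  from this[of "?t (?s (?t (?s (1 *\<^sub>R a + 0 *\<^sub>R b))))"]
  have "?s (?t (?s (?t (1 *\<^sub>R a + 0 *\<^sub>R b)))) = ?t (?s (?t (?s (1 *\<^sub>R a + 0 *\<^sub>R b))))"
    by (simp only: reflection_involution)
  note combination_eq[OF this[unfolded reflection_combination reflection_combination', folded p_def q_def]]
  \<comment> \<open>The factor \<open>q\<close> is cancelled after excluding \<open>q = 0\<close>,
    where already the square would be the identity.\<close>
  then have "q * (p * q) = q * 2" by (simp add: algebra_simps)
  moreover have "a \<bullet> b \<noteq> 0" using assms(2) commute_if_inner_0 by blast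
  then have "q \<noteq> 0" using combination_nz by (simp add: q_def)
  ultimately have "p * q = 2" by simp
  then show ?thesis using combination_nz by (simp add: p_def q_def field_simps power2_eq_square)
qed

end

lemma word_product_closed:
  assumes "W = word_product ` lists S" "f \<in> W" "g \<in> W"
  shows "f \<circ> g \<in> W"
proof -
  obtain us vs where "us \<in> lists S" "f = word_product us" "vs \<in> lists S" "g = word_product vs"
    using assms by blast
  then have "f \<circ> g = word_product (us @ vs)" "us @ vs \<in> lists S" by (auto simp: word_product_append)
  then show ?thesis using assms(1) by blast
qed

text \<open>
  The chamber is cut out by the half-spaces of its facets. If the inward normals of two facets
  made an acute angle, then the hyperplane of the reflection \<open>s t s\<close> would cut the chamber.
\<close>

lemma simple_roots:
  fixes W :: "('a::euclidean_space \<Rightarrow> 'a) set"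
  assumes frg: "finite_reflection_group W D" and dim: "DIM('a) = n"
    and s: "bij_betw s {1..n} (simple_reflections W D)"
  obtains b where "\<And>i. i \<in> {1..n} \<Longrightarrow> s i = reflection (b i)" "inj_on b {1..n}"
    "independent (b ` {1..n})" "span (b ` {1..n}) = UNIV" "D = {x. \<forall>i\<in>{1..n}. 0 \<le> b i \<bullet> x}"
    "\<And>i j. i \<in> {1..n} \<Longrightarrow> j \<in> {1..n} \<Longrightarrow> i \<noteq> j \<Longrightarrow> b i \<bullet> b j \<le> 0"
proof -
  define S where "S = simple_reflections W D"
  have finW: "finite W" and chD: "D \<in> chambers W" and WS: "W = word_product ` lists S"
    and fixed: "{x. \<forall>w\<in>W. w x = x} = {0}"
    using frg by (auto simp: finite_reflection_group_def S_def)
  let ?H = "reflecting_hyperplanes W"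
  obtain K where K: "K \<in> components (- \<Union> ?H)" "D = closure K" using chD by (auto simp: chambers_def)
  have "K \<noteq> {}" "K \<subseteq> - \<Union> ?H" "connected K"
    using K(1) in_components_nonempty in_components_subset in_components_connected by blast+
  then obtain p0 where p0: "p0 \<in> K" by blast
  have finH: "finite ?H"
  proof (rule finite_subset)
    show "?H \<subseteq> (\<lambda>f. {x. f x = x}) ` W"
      by (auto simp: reflecting_hyperplanes_def hyperplane_fixed)
    show "finite ((\<lambda>f. {x. f x = x}) ` W)" using finW by simp
  qed
  have avoid: "a \<bullet> x \<noteq> 0" if "x \<in> K" "a \<noteq> 0" "reflection a \<in> W" for a x
    using \<open>K \<subseteq> - \<Union> ?H\<close> that by (auto simp: reflecting_hyperplanes_def hyperplane_def)
  define R where "R = {a. a \<noteq> 0 \<and> reflection a \<in> W \<and> 0 < a \<bullet> p0}"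
  have R_cases: "a \<in> R \<or> - a \<in> R" if "a \<noteq> 0" "reflection a \<in> W" for a
    using avoid[OF p0 that] that by (auto simp: R_def reflection_uminus)
  have K_eq: "K = {x. \<forall>a\<in>R. 0 < a \<bullet> x}"
  proof
    show "K \<subseteq> {x. \<forall>a\<in>R. 0 < a \<bullet> x}"
    proof clarify
      fix x a assume x: "x \<in> K" and a: "a \<in> R"
      show "0 < a \<bullet> x"
      proof (rule ccontr)
        assume "\<not> 0 < a \<bullet> x"
        then obtain z where "z \<in> K" "a \<bullet> z = 0"
          using connected_ivt_hyperplane[OF \<open>connected K\<close> x p0, of a 0] a by (auto simp: R_def)
        then show False using avoid a by (auto simp: R_def)
      qed
    qed
    show "{x. \<forall>a\<in>R. 0 < a \<bullet> x} \<subseteq> K"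
    proof (rule components_maximal[OF K(1)])
      have "convex {x. \<forall>a\<in>R. 0 < a \<bullet> x}"
        unfolding convex_alt
      proof clarify
        fix x y a and u :: real
        assume xy: "\<forall>a\<in>R. 0 < a \<bullet> x" "\<forall>a\<in>R. 0 < a \<bullet> y" and u: "0 \<le> u" "u \<le> 1" and a: "a \<in> R"
        have "0 < (1 - u) * (a \<bullet> x) + u * (a \<bullet> y)"
        proof (cases "u = 0")
          case False
          then have "0 < u * (a \<bullet> y)" using u xy a by simp
          moreover have "0 \<le> (1 - u) * (a \<bullet> x)"
            by (rule mult_nonneg_nonneg) (use u xy a in \<open>auto intro: less_imp_le\<close>)
          ultimately show ?thesis by simp
        qed (use xy a in simp)
        then show "0 < a \<bullet> ((1 - u) *\<^sub>R x + u *\<^sub>R y)" by (simp add: inner_add_right)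
      qed
      then show "connected {x. \<forall>a\<in>R. 0 < a \<bullet> x}" by (rule convex_connected)
      show "{x. \<forall>a\<in>R. 0 < a \<bullet> x} \<subseteq> - \<Union> ?H"
      proof clarify
        fix x h assume x: "\<forall>a\<in>R. 0 < a \<bullet> x" and h: "x \<in> h" "h \<in> ?H"
        then obtain a where a: "a \<noteq> 0" "reflection a \<in> W" "a \<bullet> x = 0"
          by (auto simp: reflecting_hyperplanes_def hyperplane_def)
        show False using R_cases[OF a(1,2)] x a(3) by fastforce
      qed
      show "K \<inter> {x. \<forall>a\<in>R. 0 < a \<bullet> x} \<noteq> {}" using p0 by (auto simp: R_def)
    qed
  qed
  have D_eq: "D = {x. \<forall>a\<in>R. 0 \<le> a \<bullet> x}"
  proof
    have "{x. \<forall>a\<in>R. 0 \<le> a \<bullet> x} = (\<Inter>a\<in>R. {x. 0 \<le> a \<bullet> x})" by auto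
    then have "closed {x. \<forall>a\<in>R. 0 \<le> a \<bullet> x}" by (auto intro!: closed_INT closed_halfspace_ge)
    then show "D \<subseteq> {x. \<forall>a\<in>R. 0 \<le> a \<bullet> x}"
      unfolding K(2) by (rule closure_minimal[rotated]) (auto simp: K_eq intro: less_imp_le)
    show "{x. \<forall>a\<in>R. 0 \<le> a \<bullet> x} \<subseteq> D"
    proof clarify
      fix x assume x: "\<forall>a\<in>R. 0 \<le> a \<bullet> x"
      show "x \<in> D"
        unfolding K(2) closure_approachable
      proof (intro allI impI)
        fix r :: real assume r: "0 < r"
        define m where "m = norm p0 + 1"
        define t where "t = r / (2 * m)"
        have np: "0 < m" by (simp add: m_def add_nonneg_pos)
        have t: "0 < t" using r np by (simp add: t_def)
        have "x + t *\<^sub>R p0 \<in> K"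
          unfolding K_eq using x t by (auto simp: inner_add_right R_def intro!: add_nonneg_pos)
        moreover have "t * norm p0 < r"
        proof -
          have "t * norm p0 \<le> t * m" using t by (simp add: m_def mult_left_mono)
          also have "\<dots> = r / 2" using np by (simp add: t_def)
          also have "\<dots> < r" using r by simp
          finally show ?thesis .
        qed
        then have "dist (x + t *\<^sub>R p0) x < r" using t by (simp add: dist_norm)
        ultimately show "\<exists>y\<in>K. dist y x < r" by blast
      qed
    qed
  qed
  \<comment> \<open>\<open>R\<close> is closed under positive scaling, so half-spaces replace
    vectors: each is determined by its reflection, hence there are finitely many.\<close>
  define hs where "hs = (\<lambda>a::'a. {x. (- a) \<bullet> x \<le> 0})"
  have parallel: "\<exists>k>0. a' = k *\<^sub>R a" if R: "a \<in> R" "a' \<in> R" "reflection a = reflection a'" for a a'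
  proof -
    obtain k where k: "a' = k *\<^sub>R a" using reflection_eq_imp_parallel[OF R(3)] by blast
    then have "0 < k * (a \<bullet> p0)" using R(2) by (simp add: R_def)
    then have "0 < k" using R(1) by (simp add: R_def zero_less_mult_iff)
    then show ?thesis using k by blast
  qed
  have hs_eq: "hs a = hs a'" if "a \<in> R" "a' \<in> R" "reflection a = reflection a'" for a a'
    using parallel[OF that] by (auto simp: hs_def zero_le_mult_iff)
  have fin_hs: "finite (hs ` R)"
  proof -
    have "hs ` R \<subseteq> (\<lambda>f. hs (SOME a. a \<in> R \<and> reflection a = f)) ` W"
    proof clarify
      fix a assume a: "a \<in> R"
      have "(SOME a'. a' \<in> R \<and> reflection a' = reflection a) \<in> R \<and>
          reflection (SOME a'. a' \<in> R \<and> reflection a' = reflection a) = reflection a"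
        by (rule someI[of _ a]) (use a in simp)
      then have "hs a = hs (SOME a'. a' \<in> R \<and> reflection a' = reflection a)" using hs_eq a by metis
      moreover have "reflection a \<in> W" using a by (simp add: R_def)
      ultimately show "hs a \<in> (\<lambda>f. hs (SOME a. a \<in> R \<and> reflection a = f)) ` W" by (rule image_eqI)
    qed
    then show ?thesis using finW finite_subset by blast
  qed
  have "D = \<Inter> (hs ` R)" by (auto simp: D_eq hs_def)
  then have "hs ` R \<in> {\<F>. \<F> \<subseteq> hs ` R \<and> \<Inter>\<F> = D}" by simp
  moreover have "finite {\<F>. \<F> \<subseteq> hs ` R \<and> \<Inter>\<F> = D}" using fin_hs by simp
  \<comment> \<open>A minimal family of half-spaces has no redundant member, so each of its boundary
    hyperplanes cuts out a facet.\<close>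
  ultimately obtain \<F> where F: "\<F> \<subseteq> hs ` R" "\<Inter>\<F> = D"
    "\<And>\<F>'. \<F>' \<subseteq> hs ` R \<Longrightarrow> \<Inter>\<F>' = D \<Longrightarrow> \<F>' \<subseteq> \<F> \<Longrightarrow> \<F>' = \<F>"
    using finite_has_minimal[of "{\<F>. \<F> \<subseteq> hs ` R \<and> \<Inter>\<F> = D}"] by (smt (verit) empty_iff mem_Collect_eq)
  have finF: "finite \<F>" using F(1) fin_hs finite_subset by blast
  define nrm where "nrm = (\<lambda>h. SOME a. a \<in> R \<and> h = hs a)"
  have nrm: "nrm h \<in> R" "h = hs (nrm h)" if h: "h \<in> \<F>" for h
  proof -
    obtain a where "a \<in> R \<and> h = hs a" using F(1) h by blast
    then have "nrm h \<in> R \<and> h = hs (nrm h)" unfolding nrm_def by (rule someI)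
    then show "nrm h \<in> R" "h = hs (nrm h)" by auto
  qed
  have "open K"
  proof (rule open_components[OF _ K(1)])
    have "closed h" if "h \<in> ?H" for h
      using that by (auto simp: reflecting_hyperplanes_def hyperplane_def closed_hyperplane)
    then show "open (- \<Union> ?H)" using finH by (intro open_Compl closed_Union) auto
  qed
  then have "interior D \<noteq> {}" using p0 interior_maximal[OF closure_subset] K(2) by blast
  then have aff: "affine hull D = UNIV" by (rule affine_hull_nonempty_interior)
  have facet: "D \<inter> hyperplane (nrm h) facet_of D" if h: "h \<in> \<F>" for h
  proof -
    have "C facet_of D \<longleftrightarrow> (\<exists>h. h \<in> \<F> \<and> C = D \<inter> {x. (- nrm h) \<bullet> x = 0})" for C
    proof (rule facet_of_polyhedron_explicit[OF finF])
      show "D = affine hull D \<inter> \<Inter>\<F>" using aff F(2) by simp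
      show "- nrm h \<noteq> 0 \<and> h = {x. - nrm h \<bullet> x \<le> 0}" if "h \<in> \<F>" for h
        using nrm[OF that] by (auto simp: R_def hs_def)
      show "D \<subset> affine hull D \<inter> \<Inter>\<F>'" if "\<F>' \<subset> \<F>" for \<F>'
      proof -
        have "\<Inter>\<F>' \<noteq> D" using F(1) F(3)[of \<F>'] that by blast
        moreover have "D \<subseteq> \<Inter>\<F>'" using F(2) that by blast
        ultimately show ?thesis using aff by auto
      qed
    qed
    moreover have "hyperplane (nrm h) = {x. (- nrm h) \<bullet> x = 0}" by (simp add: hyperplane_def)
    ultimately show ?thesis using h by auto
  qed
  have S_mem: "reflection (nrm h) \<in> S" if h: "h \<in> \<F>" for h
    using facet[OF h] nrm(1)[OF h] by (auto simp: S_def simple_reflections_def R_def)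
  have "\<exists>a. a \<in> R \<and> s i = reflection a" if i: "i \<in> {1..n}" for i
  proof -
    have "s i \<in> S" using s i by (auto simp: S_def bij_betw_def)
    then obtain a where a: "s i = reflection a" "a \<noteq> 0" "reflection a \<in> W"
      by (auto simp: S_def simple_reflections_def)
    then show ?thesis using R_cases[OF a(2,3)] reflection_uminus by metis
  qed
  then obtain b where b: "\<And>i. i \<in> {1..n} \<Longrightarrow> b i \<in> R" "\<And>i. i \<in> {1..n} \<Longrightarrow> s i = reflection (b i)" by metis
  have D_b: "D = {x. \<forall>i\<in>{1..n}. 0 \<le> b i \<bullet> x}"
  proof
    show "D \<subseteq> {x. \<forall>i\<in>{1..n}. 0 \<le> b i \<bullet> x}" using b(1) by (auto simp: D_eq)
    show "{x. \<forall>i\<in>{1..n}. 0 \<le> b i \<bullet> x} \<subseteq> D"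
    proof clarify
      fix x assume x: "\<forall>i\<in>{1..n}. 0 \<le> b i \<bullet> x"
      have "x \<in> h" if h: "h \<in> \<F>" for h
      proof -
        have "reflection (nrm h) \<in> s ` {1..n}" using S_mem[OF h] s by (simp add: S_def bij_betw_def)
        then obtain i where i: "i \<in> {1..n}" "s i = reflection (nrm h)" by (metis imageE)
        then obtain k where "k > 0" "nrm h = k *\<^sub>R b i"
          using parallel[OF b(1)[OF i(1)] nrm(1)[OF h]] b(2)[OF i(1)] by auto
        then have "0 \<le> nrm h \<bullet> x" using x i(1) by simp
        then show ?thesis by (subst nrm(2)[OF h]) (simp add: hs_def)
      qed
      then show "x \<in> D" using F(2) by blast
    qed
  qed
  \<comment> \<open>A vector orthogonal to all the normals is fixed by every simple reflection,
    hence by \<open>W\<close>, and the fixed subspace is trivial.\<close>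
  have span: "span (b ` {1..n}) = UNIV"
  proof (rule span_UNIV_if_orthogonal_0)
    fix x assume x: "\<And>c. c \<in> b ` {1..n} \<Longrightarrow> c \<bullet> x = 0"
    have "t x = x" if "t \<in> S" for t
    proof -
      have "t \<in> s ` {1..n}" using s that by (simp add: S_def bij_betw_def)
      then obtain i where "i \<in> {1..n}" "t = s i" by blast
      then show ?thesis using b(2) x by (simp add: reflection_def)
    qed
    then have "word_product ws x = x" if "ws \<in> lists S" for ws
      using that by (induction ws) auto
    then have "\<forall>w\<in>W. w x = x" using WS by auto
    then show "x = 0" using fixed by auto
  qed
  have inj: "inj_on b {1..n}"
    by (rule inj_onI) (metis b(2) bij_betw_imp_inj_on[OF s] inj_onD)
  have indep: "independent (b ` {1..n})"
  proof (rule card_le_dim_spanning[of _ UNIV])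
    show "card (b ` {1..n}) \<le> dim (UNIV :: 'a set)" using dim card_image_le[of "{1..n}" b] by simp
  qed (use span in auto)
  have obtuse: "b i \<bullet> b j \<le> 0" if ij: "i \<in> {1..n}" "j \<in> {1..n}" "i \<noteq> j" for i j
  proof (rule ccontr)
    assume "\<not> b i \<bullet> b j \<le> 0"
    then have pos: "0 < b i \<bullet> b j" by simp
    define k where "k = 2 * (b i \<bullet> b j) / (b i \<bullet> b i)"
    have k: "0 < k" using pos b(1)[OF ij(1)] by (simp add: k_def R_def)
    define v where "v = reflection (b i) (b j)"
    have v: "v = b j - k *\<^sub>R b i" by (simp add: v_def reflection_def k_def)
    have W_b: "reflection (b l) \<in> W" if "l \<in> {1..n}" for l using b(1)[OF that] by (simp add: R_def)
    have "reflection v \<in> W"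
      unfolding v_def reflection_conjugate by (intro word_product_closed[OF WS] W_b ij)
    moreover have "v \<noteq> 0"
    proof
      assume "v = 0"
      then have "reflection (b i) v = 0" by (simp add: reflection_def)
      then have "b j = 0" unfolding v_def reflection_involution .
      then show False using b(1)[OF ij(2)] by (simp add: R_def)
    qed
    ultimately have "v \<in> R \<or> - v \<in> R" using R_cases by blast
    then have sgn: "(\<forall>x\<in>D. 0 \<le> v \<bullet> x) \<or> (\<forall>x\<in>D. v \<bullet> x \<le> 0)" by (auto simp: D_eq)
    obtain w where w: "\<And>c c'. c \<in> b ` {1..n} \<Longrightarrow> c' \<in> b ` {1..n} \<Longrightarrow> w c \<bullet> c' = (if c = c' then 1 else 0)"
      using dual_basis[OF indep] by blast
    have w': "b l \<bullet> w (b m) = (if l = m then 1 else 0)" if "l \<in> {1..n}" "m \<in> {1..n}" for l m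
      using w[of "b m" "b l"] inj_onD[OF inj, of m l] that by (auto simp: inner_commute)
    \<comment> \<open>The dual basis vectors of \<open>b i\<close> and \<open>b j\<close> lie in the
      chamber, on opposite sides of the hyperplane of \<open>v\<close>.\<close>
    have "w (b i) \<in> D" "w (b j) \<in> D" using w' ij by (auto simp: D_b)
    moreover have "v \<bullet> w (b i) < 0" "0 < v \<bullet> w (b j)"
      using w' ij k by (auto simp: v inner_diff_left)
    ultimately show False using sgn by fastforce
  qed
  show ?thesis using that[of b] b(2) inj indep span D_b obtuse by blast
qed

text \<open>The orders of the products fix the angles and leave the lengths free. Prescribing
  squared lengths \<open>L\<close> therefore determines the Gram matrix for orders 2, 3 and 4, the
  signs being nonpositive.\<close>

lemma normalised_simple_roots:
  fixes W :: "('a::euclidean_space \<Rightarrow> 'a) set" and L :: "nat \<Rightarrow> real"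
  assumes frg: "finite_reflection_group W D" and dim: "DIM('a) = n"
    and s: "bij_betw s {1..n} (simple_reflections W D)" and L: "\<And>i. i \<in> {1..n} \<Longrightarrow> 0 < L i"
  obtains a where "\<And>i. i \<in> {1..n} \<Longrightarrow> s i = reflection (a i)" "inj_on a {1..n}"
    "independent (a ` {1..n})" "span (a ` {1..n}) = UNIV" "D = {x. \<forall>i\<in>{1..n}. 0 \<le> a i \<bullet> x}"
    "\<And>i j. i \<in> {1..n} \<Longrightarrow> j \<in> {1..n} \<Longrightarrow> i \<noteq> j \<Longrightarrow> a i \<bullet> a j \<le> 0"
    "\<And>i. i \<in> {1..n} \<Longrightarrow> a i \<bullet> a i = L i"
    "\<And>i j. i \<in> {1..n} \<Longrightarrow> j \<in> {1..n} \<Longrightarrow> i \<noteq> j \<Longrightarrow> map_order (s i \<circ> s j) = 2 \<Longrightarrow> a i \<bullet> a j = 0"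
    "\<And>i j. i \<in> {1..n} \<Longrightarrow> j \<in> {1..n} \<Longrightarrow> i \<noteq> j \<Longrightarrow> map_order (s i \<circ> s j) = 3 \<Longrightarrow>
      4 * (a i \<bullet> a j)\<^sup>2 = L i * L j"
    "\<And>i j. i \<in> {1..n} \<Longrightarrow> j \<in> {1..n} \<Longrightarrow> i \<noteq> j \<Longrightarrow> map_order (s i \<circ> s j) = 4 \<Longrightarrow>
      2 * (a i \<bullet> a j)\<^sup>2 = L i * L j"
proof -
  let ?I = "{1..n}"
  obtain b where b: "\<And>i. i \<in> ?I \<Longrightarrow> s i = reflection (b i)" "inj_on b ?I"
    "independent (b ` ?I)" "span (b ` ?I) = UNIV" "D = {x. \<forall>i\<in>?I. 0 \<le> b i \<bullet> x}"
    "\<And>i j. i \<in> ?I \<Longrightarrow> j \<in> ?I \<Longrightarrow> i \<noteq> j \<Longrightarrow> b i \<bullet> b j \<le> 0"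
    using simple_roots[OF frg dim s] by blast
  have b0: "0 < b i \<bullet> b i" if "i \<in> ?I" for i
    using b(3) that dependent_zero[of "b ` ?I"] by force
  define k where "k = (\<lambda>i. sqrt (L i / (b i \<bullet> b i)))"
  have k: "0 < k i" if "i \<in> ?I" for i using L[OF that] b0[OF that] by (simp add: k_def)
  define a where "a = (\<lambda>i. k i *\<^sub>R b i)"
  have refl: "s i = reflection (a i)" if "i \<in> ?I" for i
    using b(1)[OF that] reflection_scaleR[of "k i" "b i"] k[OF that] by (simp add: a_def)
  have inj: "inj_on a ?I"
  proof (rule inj_onI)
    fix i j assume "i \<in> ?I" "j \<in> ?I" "a i = a j"
    then show "i = j" using refl bij_betw_imp_inj_on[OF s] by (metis inj_onD)
  qed
  have spn: "span (a ` ?I) = UNIV"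
  proof (rule span_UNIV_if_orthogonal_0)
    fix x assume x: "\<And>c. c \<in> a ` ?I \<Longrightarrow> c \<bullet> x = 0"
    show "x = 0"
    proof (rule eq_0_if_orthogonal_basis[OF b(4)])
      fix c assume "c \<in> b ` ?I"
      then obtain i where i: "i \<in> ?I" "c = b i" by blast
      have "k i * (b i \<bullet> x) = 0" using x[of "a i"] i(1) by (simp add: a_def)
      then show "c \<bullet> x = 0" using k[OF i(1)] i(2) by simp
    qed
  qed
  have ind: "independent (a ` ?I)"
  proof (rule card_le_dim_spanning[of _ UNIV])
    show "card (a ` ?I) \<le> dim (UNIV :: 'a set)" using dim card_image_le[of ?I a] by simp
  qed (use spn in auto)
  have D: "D = {x. \<forall>i\<in>?I. 0 \<le> a i \<bullet> x}"
  proof -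
    have "0 \<le> a i \<bullet> x \<longleftrightarrow> 0 \<le> b i \<bullet> x" if "i \<in> ?I" for i x
      using k[OF that] by (simp add: a_def zero_le_mult_iff)
    then show ?thesis unfolding b(5) by auto
  qed
  have obt: "a i \<bullet> a j \<le> 0" if "i \<in> ?I" "j \<in> ?I" "i \<noteq> j" for i j
    using b(6)[OF that] k[OF that(1)] k[OF that(2)] by (simp add: a_def mult_nonneg_nonpos less_imp_le)
  have len: "a i \<bullet> a i = L i" if "i \<in> ?I" for i
  proof -
    have "a i \<bullet> a i = (k i)\<^sup>2 * (b i \<bullet> b i)" by (simp add: a_def power2_eq_square)
    also have "(k i)\<^sup>2 = L i / (b i \<bullet> b i)"
      unfolding k_def using L[OF that] b0[OF that] by (intro real_sqrt_pow2) (simp add: less_imp_le)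
    finally show ?thesis using b0[OF that] by simp
  qed
  have pair: "x = 0 \<and> y = 0" if ij: "i \<in> ?I" "j \<in> ?I" "i \<noteq> j" and 0: "x *\<^sub>R a i + y *\<^sub>R a j = 0" for i j x y
  proof -
    obtain w where w: "\<And>c c'. c \<in> a ` ?I \<Longrightarrow> c' \<in> a ` ?I \<Longrightarrow> w c \<bullet> c' = (if c = c' then 1 else 0)"
      using dual_basis[OF ind] by blast
    have ne: "a i \<noteq> a j" using inj_onD[OF inj _ ij(1,2)] ij(3) by blast
    have "w (a i) \<bullet> (x *\<^sub>R a i + y *\<^sub>R a j) = x" "w (a j) \<bullet> (x *\<^sub>R a i + y *\<^sub>R a j) = y"
      using w ij ne by (simp_all add: inner_add_right)
    then show ?thesis unfolding 0 by simp
  qed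
  have W: "finite W" "W = word_product ` lists (simple_reflections W D)"
    using frg by (auto simp: finite_reflection_group_def)
  have ord: "(s i \<circ> s j) ^^ map_order (s i \<circ> s j) = id"
    "\<And>m. 0 < m \<Longrightarrow> m < map_order (s i \<circ> s j) \<Longrightarrow> (s i \<circ> s j) ^^ m \<noteq> id" if ij: "i \<in> ?I" "j \<in> ?I" for i j
  proof -
    have S: "s l \<in> simple_reflections W D" if "l \<in> ?I" for l using s that by (auto simp: bij_betw_def)
    have "word_product [s i, s j] \<in> W" by (subst W(2), rule imageI) (use S ij in simp)
    then have f: "s i \<circ> s j \<in> W" by simp
    have "word_product [] \<in> W" by (subst W(2), rule imageI) simp
    then have id: "id \<in> W" by (simp only: word_product_simps)
    have pow: "(s i \<circ> s j) ^^ m \<in> W" for m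
    proof (induction m)
      case (Suc m)
      then show ?case unfolding funpow.simps by (rule word_product_closed[OF W(2) f])
    qed (simp only: funpow.simps id)
    have "bij (s l)" if "l \<in> ?I" for l
      unfolding refl[OF that] by (rule o_bij[OF reflection_comp_self reflection_comp_self])
    then have bij: "bij (s i \<circ> s j)" using ij bij_comp by blast
    show "(s i \<circ> s j) ^^ map_order (s i \<circ> s j) = id"
      by (rule map_order_power(2)[OF W(1) bij pow])
    show "(s i \<circ> s j) ^^ m \<noteq> id" if "0 < m" "m < map_order (s i \<circ> s j)" for m
      by (rule map_order_power(3)[OF W(1) bij pow that])
  qed
  show ?thesis
  proof (rule that[of a])
    fix i j assume ij: "i \<in> ?I" "j \<in> ?I" "i \<noteq> j"
    note o = ord[OF ij(1,2)]
    note o = o[unfolded refl[OF ij(1)] refl[OF ij(2)]]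
    note pair = pair[OF ij]
    show "a i \<bullet> a j = 0" if "map_order (s i \<circ> s j) = 2"
    proof (rule order_2_inner[OF pair])
      show "(reflection (a i) \<circ> reflection (a j)) ^^ 2 = id"
        using o(1) that refl[OF ij(1)] refl[OF ij(2)] by metis
    qed
    show "4 * (a i \<bullet> a j)\<^sup>2 = L i * L j" if "map_order (s i \<circ> s j) = 3"
      unfolding len[OF ij(1), symmetric] len[OF ij(2), symmetric]
    proof (rule order_3_inner[OF pair])
      show "(reflection (a i) \<circ> reflection (a j)) ^^ 3 = id"
        using o(1) that refl[OF ij(1)] refl[OF ij(2)] by metis
    qed
    show "2 * (a i \<bullet> a j)\<^sup>2 = L i * L j" if m: "map_order (s i \<circ> s j) = 4"
      unfolding len[OF ij(1), symmetric] len[OF ij(2), symmetric]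
    proof (rule order_4_inner[OF pair])
      have m': "map_order (reflection (a i) \<circ> reflection (a j)) = 4"
        using m refl[OF ij(1)] refl[OF ij(2)] by metis
      show "(reflection (a i) \<circ> reflection (a j)) ^^ 4 = id" using o(1) unfolding m' .
      show "(reflection (a i) \<circ> reflection (a j)) ^^ 2 \<noteq> id" by (rule o(2)) (simp_all add: m')
    qed
  qed (fact refl inj ind spn D obt len)+
qed

lemma chain_conclusion:
  fixes W :: "('a::euclidean_space \<Rightarrow> 'a) set"
  assumes ch: "chain N e folded" and gaps: "gap e ` {1..<N} = a ` {1..n}"
    and s: "bij_betw s {1..n} (simple_reflections W D)"
    and a: "\<And>i. i \<in> {1..n} \<Longrightarrow> s i = reflection (a i)" and D: "D = {x. \<forall>i\<in>{1..n}. 0 \<le> a i \<bullet> x}"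
    and W: "W = word_product ` lists (simple_reflections W D)"
    and c: "bipartite_coxeter_element (simple_reflections W D) c"
  shows "simplicial_fan (biCamb W D c)"
proof -
  interpret ch: chain N e folded by (rule ch)
  have S: "simple_reflections W D = ch.S"
  proof -
    have "simple_reflections W D = s ` {1..n}" using s by (simp add: bij_betw_def)
    also have "\<dots> = (\<lambda>i. reflection (a i)) ` {1..n}" by (rule image_cong) (use a in auto)
    also have "\<dots> = ch.S" unfolding ch.S_def ch.\<Delta>_def gaps by (simp add: image_image)
    finally show ?thesis .
  qed
  have chD: "ch.D = D" unfolding ch.D_def ch.\<Delta>_def gaps D by simp
  have chW: "ch.W = W" unfolding ch.W_def using W S by simp
  show ?thesis
    using ch.simplicial_fan_biCamb[of c] c unfolding chW chD S by simp
qed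

section \<open>Type A\<close>

lemma simplicial_fan_A:
  fixes W :: "('a::euclidean_space \<Rightarrow> 'a) set"
  assumes dim: "DIM('a) = n" and frg: "finite_reflection_group W D"
    and m: "has_coxeter_matrix (simple_reflections W D) n matrix_A"
    and c: "bipartite_coxeter_element (simple_reflections W D) c"
  shows "simplicial_fan (biCamb W D c)"
proof -
  let ?I = "{1..n}"
  obtain s where s: "bij_betw s ?I (simple_reflections W D)"
    "\<And>i j. i \<in> ?I \<Longrightarrow> j \<in> ?I \<Longrightarrow> map_order (s i \<circ> s j) = matrix_A i j"
    using m by (auto simp: has_coxeter_matrix_def)
  show ?thesis
  proof (rule normalised_simple_roots[OF frg dim s(1), of "\<lambda>_. 2", OF zero_less_numeral])
    fix a assume a: "\<And>i. i \<in> ?I \<Longrightarrow> s i = reflection (a i)" "inj_on a ?I"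
    "independent (a ` ?I)" "span (a ` ?I) = UNIV" "D = {x. \<forall>i\<in>?I. 0 \<le> a i \<bullet> x}"
    "\<And>i j. i \<in> ?I \<Longrightarrow> j \<in> ?I \<Longrightarrow> i \<noteq> j \<Longrightarrow> a i \<bullet> a j \<le> 0"
    "\<And>i. i \<in> ?I \<Longrightarrow> a i \<bullet> a i = 2"
    "\<And>i j. i \<in> ?I \<Longrightarrow> j \<in> ?I \<Longrightarrow> i \<noteq> j \<Longrightarrow> map_order (s i \<circ> s j) = 2 \<Longrightarrow> a i \<bullet> a j = 0"
    "\<And>i j. i \<in> ?I \<Longrightarrow> j \<in> ?I \<Longrightarrow> i \<noteq> j \<Longrightarrow> map_order (s i \<circ> s j) = 3 \<Longrightarrow> 4 * (a i \<bullet> a j)\<^sup>2 = 2 * 2"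
    "\<And>i j. i \<in> ?I \<Longrightarrow> j \<in> ?I \<Longrightarrow> i \<noteq> j \<Longrightarrow> map_order (s i \<circ> s j) = 4 \<Longrightarrow> 2 * (a i \<bullet> a j)\<^sup>2 = 2 * 2"
    have gram: "a i \<bullet> a j = (if i = j then 2 else if i = Suc j \<or> j = Suc i then -1 else 0)"
      if ij: "i \<in> ?I" "j \<in> ?I" for i j
    proof (cases "i = j \<or> \<not> (i = Suc j \<or> j = Suc i)")
      case True
      then show ?thesis using a(7)[OF ij(1)] a(8)[OF ij] s(2)[OF ij] by (auto simp: matrix_A_def)
    next
      case False
      then have "4 * (a i \<bullet> a j)\<^sup>2 = 2 * 2" "a i \<bullet> a j \<le> 0"
        using a(9)[OF ij] a(6)[OF ij] s(2)[OF ij] by (auto simp: matrix_A_def)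
      then have "(a i \<bullet> a j)\<^sup>2 = 1" "a i \<bullet> a j \<noteq> 1" by auto
      then have "a i \<bullet> a j = -1" by (auto simp: power2_eq_1_iff)
      then show ?thesis using False by auto
    qed
    obtain w where w: "\<And>d d'. d \<in> a ` ?I \<Longrightarrow> d' \<in> a ` ?I \<Longrightarrow> w d \<bullet> d' = (if d = d' then 1 else 0)"
      using dual_basis[OF a(3)] by blast
    \<comment> \<open>The weights of the standard representation, vertices of a simplex:
      \<open>e 1\<close> has product -1 with \<open>a 1\<close> and 0 with the other roots, and each
      step adds the next root.\<close>
    define e where "e = (\<lambda>k. - w (a 1) + (\<Sum>i=1..<k. a i))"
    have n1: "1 \<in> ?I" using dim DIM_positive[where 'a = 'a] by simp
    have eSuc: "e (Suc k) = e k + a k" if "1 \<le> k" for k using that by (simp add: e_def)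
    have gap: "gap e k = a k" if "1 \<le> k" for k using eSuc[OF that] by (simp add: gap_def)
    have ae: "a i \<bullet> e k = (if k = Suc i then 1 else if k = i then -1 else 0)"
      if i: "i \<in> ?I" and k: "1 \<le> k" "k \<le> Suc n" for i k
      using k
    proof (induction k rule: nat_induct_at_least[of 1])
      case base
      have "w (a 1) \<bullet> a i = (if i = 1 then 1 else 0)"
        using w[of "a 1" "a i"] inj_onD[OF a(2), of 1 i] i n1 by auto
      then show ?case using i by (auto simp: e_def inner_commute)
    next
      case (Suc k)
      then show ?case using gram[OF i, of k] i by (auto simp: eSuc inner_add_right)
    qed
    have ch: "chain (Suc n) e False"
    proof (unfold_locales)
      fix g k assume g: "g \<in> {1..<Suc n}" and k: "k \<in> {1..Suc n}"
      have gI: "g \<in> ?I" using g by auto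
      have "{h \<in> {1..<Suc n}. gap e h = gap e g} = {g}"
        using gap inj_onD[OF a(2), of _ g] g by auto
      moreover have "reflection (a g) (e k) = e (swap_gaps {g} k)"
        using ae[OF gI, of k] k a(7)[OF gI] eSuc[of g] g by (auto simp: reflection_def swap_gaps_def)
      ultimately show "reflection (gap e g) (e k) = e (swap_gaps {h \<in> {1..<Suc n}. gap e h = gap e g} k)"
        using gap[of g] g by simp
    next
      fix g assume "1 \<le> g" "Suc g < Suc n"
      then show "gap e g \<bullet> gap e (Suc g) < 0" using gram[of g "Suc g"] gap by simp
    next
      fix g h assume "g \<in> {1..<Suc n}" "h \<in> {1..<Suc n}" "gap e g \<noteq> gap e h"
      then show "gap e g \<bullet> gap e h \<le> 0" using a(6)[of g h] gap by auto
    next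
      have im: "gap e ` {1..<Suc n} = a ` ?I" by (rule image_cong) (use gap in auto)
      show "independent (gap e ` {1..<Suc n})" "span (gap e ` {1..<Suc n}) = UNIV" unfolding im by (fact a)+
      show "inj_on (gap e) {1..<Suc n}"
      proof (rule inj_onI)
        fix g h assume gh: "g \<in> {1..<Suc n}" "h \<in> {1..<Suc n}" "gap e g = gap e h"
        then have "a g = a h" using gap[of g] gap[of h] by simp
        then show "g = h" using inj_onD[OF a(2), of g h] gh by simp
      qed
      have "reflection ` gap e ` {1..<Suc n} = s ` ?I"
        unfolding im image_image by (rule image_cong) (use a(1) in auto)
      then show "finite (word_product ` lists (reflection ` gap e ` {1..<Suc n}))"
        using frg s(1) by (simp add: finite_reflection_group_def bij_betw_def)
    qed simp_all
    have im: "gap e ` {1..<Suc n} = a ` ?I" by (rule image_cong) (use gap in auto)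
    show ?thesis
      by (rule chain_conclusion[OF ch im s(1) a(1) a(5) _ c])
        (use frg in \<open>auto simp: finite_reflection_group_def\<close>)
  qed
qed

section \<open>Type B\<close>

lemma simplicial_fan_B:
  fixes W :: "('a::euclidean_space \<Rightarrow> 'a) set"
  assumes dim: "DIM('a) = n" and frg: "finite_reflection_group W D"
    and m: "has_coxeter_matrix (simple_reflections W D) n matrix_B"
    and c: "bipartite_coxeter_element (simple_reflections W D) c"
  shows "simplicial_fan (biCamb W D c)"
proof -
  let ?I = "{1..n}"
  \<comment> \<open>The central gap will be \<open>u 1 - (- u 1) = a 1\<close>, the others
    differences of vectors \<open>u i\<close>. Squared lengths 4 and 2 make the \<open>u i\<close>
    orthonormal.\<close>
  define L :: "nat \<Rightarrow> real" where "L = (\<lambda>i. if i = 1 then 4 else 2)"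
  obtain s where s: "bij_betw s ?I (simple_reflections W D)"
    "\<And>i j. i \<in> ?I \<Longrightarrow> j \<in> ?I \<Longrightarrow> map_order (s i \<circ> s j) = matrix_B i j"
    using m by (auto simp: has_coxeter_matrix_def)
  have L: "0 < L i" for i by (simp add: L_def)
  show ?thesis
  proof (rule normalised_simple_roots[OF frg dim s(1), of L, OF L])
    fix a assume a: "\<And>i. i \<in> ?I \<Longrightarrow> s i = reflection (a i)" "inj_on a ?I"
    "independent (a ` ?I)" "span (a ` ?I) = UNIV" "D = {x. \<forall>i\<in>?I. 0 \<le> a i \<bullet> x}"
    "\<And>i j. i \<in> ?I \<Longrightarrow> j \<in> ?I \<Longrightarrow> i \<noteq> j \<Longrightarrow> a i \<bullet> a j \<le> 0"
    "\<And>i. i \<in> ?I \<Longrightarrow> a i \<bullet> a i = L i"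
    "\<And>i j. i \<in> ?I \<Longrightarrow> j \<in> ?I \<Longrightarrow> i \<noteq> j \<Longrightarrow> map_order (s i \<circ> s j) = 2 \<Longrightarrow> a i \<bullet> a j = 0"
    "\<And>i j. i \<in> ?I \<Longrightarrow> j \<in> ?I \<Longrightarrow> i \<noteq> j \<Longrightarrow> map_order (s i \<circ> s j) = 3 \<Longrightarrow> 4 * (a i \<bullet> a j)\<^sup>2 = L i * L j"
    "\<And>i j. i \<in> ?I \<Longrightarrow> j \<in> ?I \<Longrightarrow> i \<noteq> j \<Longrightarrow> map_order (s i \<circ> s j) = 4 \<Longrightarrow> 2 * (a i \<bullet> a j)\<^sup>2 = L i * L j"
    have gram: "a i \<bullet> a j = (if i = j then L i else if {i, j} = {1, 2} then -2
        else if i = Suc j \<or> j = Suc i then -1 else 0)"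
      if ij: "i \<in> ?I" "j \<in> ?I" for i j
    proof -
      consider "i = j" | "i \<noteq> j" "{i, j} = {1, 2}" | "i \<noteq> j" "{i, j} \<noteq> {1, 2}" "i = Suc j \<or> j = Suc i"
        | "i \<noteq> j" "{i, j} \<noteq> {1, 2}" "\<not> (i = Suc j \<or> j = Suc i)" by blast
      then show ?thesis
      proof cases
        case 1
        then show ?thesis using a(7)[OF ij(1)] by simp
      next
        case 2
        have "L i * L j = 8" using 2 by (auto simp: L_def doubleton_eq_iff)
        then have "2 * (a i \<bullet> a j)\<^sup>2 = 8" "a i \<bullet> a j \<le> 0"
          using a(10)[OF ij] a(6)[OF ij] s(2)[OF ij] 2 by (auto simp: matrix_B_def)
        then have "(a i \<bullet> a j)\<^sup>2 = 2\<^sup>2" "a i \<bullet> a j \<noteq> 2" by auto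
        then have "a i \<bullet> a j = -2" unfolding power2_eq_iff by blast
        then show ?thesis using 2 by simp
      next
        case 3
        have "L i * L j = 4" using 3 ij by (auto simp: L_def doubleton_eq_iff)
        then have "4 * (a i \<bullet> a j)\<^sup>2 = 4" "a i \<bullet> a j \<le> 0"
          using a(9)[OF ij] a(6)[OF ij] s(2)[OF ij] 3 by (auto simp: matrix_B_def matrix_A_def)
        then have "(a i \<bullet> a j)\<^sup>2 = 1\<^sup>2" "a i \<bullet> a j \<noteq> 1" by auto
        then have "a i \<bullet> a j = -1" unfolding power2_eq_iff by blast
        then show ?thesis using 3 by simp
      next
        case 4
        then show ?thesis using a(8)[OF ij] s(2)[OF ij] by (auto simp: matrix_B_def matrix_A_def)
      qed
    qed
    have n1: "1 \<in> ?I" "1 \<le> n" using dim DIM_positive[where 'a = 'a] by simp_all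
    define u where "u = (\<lambda>i. (1/2) *\<^sub>R a 1 + (\<Sum>j=2..<Suc i. a j))"
    have u1: "u 1 = (1/2) *\<^sub>R a 1" by (simp add: u_def)
    have uSuc: "u (Suc i) = u i + a (Suc i)" if "1 \<le> i" for i using that by (simp add: u_def)
    have au: "a i \<bullet> u k = (if i = 1 then (if k = 1 then 2 else 0) else if k = i then 1 else if Suc k = i then -1 else 0)"
      if i: "i \<in> ?I" and k: "1 \<le> k" "k \<le> n" for i k
      using k
    proof (induction k rule: nat_induct_at_least[of 1])
      case base
      then show ?case using gram[OF i n1(1)] i by (auto simp: u1[simplified] L_def doubleton_eq_iff)
    next
      case (Suc k)
      then show ?case using gram[OF i, of "Suc k"] i by (auto simp: uSuc inner_add_right L_def doubleton_eq_iff)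
    qed
    \<comment> \<open>The chain runs through \<open>- u n\<close>, ..., \<open>- u 1\<close>,
      \<open>u 1\<close>, ..., \<open>u n\<close>.\<close>
    define e where "e = (\<lambda>k. if n < k then u (k - n) else - u (n + 1 - k))"
    \<comment> \<open>Gaps at equal distance from the centre \<open>n\<close> belong to the same
      simple root; the centre itself belongs to \<open>a 1\<close>.\<close>
    define idx where "idx = (\<lambda>g. if n \<le> g then g - n + 1 else n - g + 1)"
    have idx: "idx g \<in> ?I" if "g \<in> {1..<2 * n}" for g using that by (auto simp: idx_def)
    have gap: "gap e g = a (idx g)" if g: "g \<in> {1..<2 * n}" for g
    proof -
      consider "g = n" | "n < g" | "g < n" by linarith
      then show ?thesis
      proof cases
        case 1
        then show ?thesis by (simp add: gap_def e_def idx_def u1[simplified] flip: scaleR_add_left)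
      next
        case 2
        then show ?thesis using uSuc[of "g - n"] by (simp add: gap_def e_def idx_def Suc_diff_le)
      next
        case 3
        then show ?thesis using uSuc[of "n - g"] by (simp add: gap_def e_def idx_def Suc_diff_le)
      qed
    qed
    have idx_eq: "idx h = idx g \<longleftrightarrow> h = g \<or> h = 2 * n - g" if "g \<in> {1..<2 * n}" "h \<in> {1..<2 * n}" for g h
      using that by (auto simp: idx_def)
    have gap_eq: "gap e h = gap e g \<longleftrightarrow> h = g \<or> h = 2 * n - g" if "g \<in> {1..<2 * n}" "h \<in> {1..<2 * n}" for g h
      using idx_eq[OF that] gap that inj_onD[OF a(2) _ idx[OF that(2)] idx[OF that(1)]] by auto
    have im: "gap e ` {1..<2 * n} = a ` ?I"
    proof
      show "gap e ` {1..<2 * n} \<subseteq> a ` ?I" using gap idx by auto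
      show "a ` ?I \<subseteq> gap e ` {1..<2 * n}"
      proof clarify
        fix i assume i: "i \<in> ?I"
        then have "n + i - 1 \<in> {1..<2 * n}" "idx (n + i - 1) = i" by (auto simp: idx_def)
        then show "a i \<in> gap e ` {1..<2 * n}" using gap by (metis image_eqI)
      qed
    qed
    have e_neg: "e (2 * n + 1 - k) = - e k" if "k \<in> {1..2 * n}" for k
      using that by (auto simp: e_def)
    have refl_u: "reflection (a i) (u k) =
        (if i = 1 then (if k = 1 then - u 1 else u k) else if k = i then u (i - 1) else if Suc k = i then u i else u k)"
      if i: "i \<in> ?I" and k: "1 \<le> k" "k \<le> n" for i k
    proof -
      have r: "reflection (a i) (u k) = u k - (2 * (a i \<bullet> u k) / L i) *\<^sub>R a i"
        using a(7)[OF i] by (simp add: reflection_def)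
      show ?thesis
      proof (cases "i = 1")
        case True
        have "a 1 = u 1 + u 1" by (simp add: u1[simplified] flip: scaleR_add_left)
        then have "u 1 - a 1 = - u 1" by simp
        then show ?thesis using r au[OF i k] True by (auto simp: L_def)
      next
        case False
        then obtain i' where "i = Suc i'" "1 \<le> i'" using i by (cases i) auto
        then have "u i = u (i - 1) + a i" using uSuc[of i'] by simp
        then show ?thesis using r au[OF i k] False by (auto simp: L_def)
      qed
    qed
    have ch: "chain (2 * n) e True"
    proof (unfold_locales)
      fix g k assume g: "g \<in> {1..<2 * n}" and k: "k \<in> {1..2 * n}"
      let ?G = "{h \<in> {1..<2 * n}. gap e h = gap e g}"
      have G: "?G = {g, 2 * n - g}" using gap_eq[OF g] g by auto
      have r: "reflection d (- x) = - reflection d x" for d x :: 'a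
        by (rule linear_neg[OF linear_reflection])
      have pos: "e (n + j) = u j" if "1 \<le> j" for j using that by (simp add: e_def)
      have neg: "e (Suc n - j) = - u j" if "1 \<le> j" "j \<le> n" for j
      proof -
        have "Suc n - (Suc n - j) = j" "\<not> n < Suc n - j" using that by auto
        then show ?thesis by (simp add: e_def)
      qed
      define i where "i = idx g"
      have i: "1 \<le> i" "i \<le> n" "i \<in> ?I" using idx[OF g] by (auto simp: i_def)
      \<comment> \<open>The two gaps of the letter coincide exactly for
        \<open>i = 1\<close>.\<close>
      have gi: "{g, 2 * n - g} = {n + i - 1, n + 1 - i}" using g by (auto simp: i_def idx_def)
      have "reflection (a i) (e k) = e (swap_gaps {n + i - 1, n + 1 - i} k)"
      proof (cases "n < k")
        case True
        define j where "j = k - n"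
        have j: "1 \<le> j" "j \<le> n" "k = n + j" using True k by (auto simp: j_def)
        have sw: "swap_gaps {n + i - 1, n + 1 - i} (n + j) =
            (if i = 1 then (if j = 1 then Suc n - 1 else n + j)
             else if j = i then n + (i - 1) else if Suc j = i then n + i else n + j)"
        proof -
          have "n + j \<in> {n + i - 1, n + 1 - i} \<longleftrightarrow> Suc j = i" "n + j - 1 \<in> {n + i - 1, n + 1 - i} \<longleftrightarrow> j = i"
            using i j by auto
          then show ?thesis unfolding swap_gaps_def using i j by auto
        qed
        show ?thesis
          unfolding j(3) sw pos[OF j(1)] refl_u[OF i(3) j(1,2)]
          using pos[of i] pos[of "i - 1"] pos[of j] neg[of 1] i j by simp
      next
        case False
        define j where "j = Suc n - k"
        have j: "1 \<le> j" "j \<le> n" "k = Suc n - j" using False k by (auto simp: j_def)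
        have sw: "swap_gaps {n + i - 1, n + 1 - i} (Suc n - j) =
            (if i = 1 then (if j = 1 then n + 1 else Suc n - j)
             else if j = i then Suc n - (i - 1) else if Suc j = i then Suc n - i else Suc n - j)"
        proof -
          have "Suc n - j \<in> {n + i - 1, n + 1 - i} \<longleftrightarrow> j = i"
            "Suc n - j - 1 \<in> {n + i - 1, n + 1 - i} \<longleftrightarrow> Suc j = i" using i j by auto
          then show ?thesis unfolding swap_gaps_def using i j by auto
        qed
        show ?thesis
          unfolding j(3) sw neg[OF j(1,2)] r refl_u[OF i(3) j(1,2)]
          using neg[of i] neg[of "i - 1"] neg[of j] pos[of 1] i j by simp
      qed
      then have "reflection (a (idx g)) (e k) = e (swap_gaps {g, 2 * n - g} k)"
        unfolding gi i_def[symmetric] .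
      then show "reflection (gap e g) (e k) = e (swap_gaps ?G k)"
        by (subst G) (simp only: gap[OF g])
    next
      fix g assume g: "1 \<le> g" "Suc g < 2 * n"
      then have "idx g \<in> ?I" "idx (Suc g) \<in> ?I" using idx by auto
      moreover have "idx g = Suc (idx (Suc g)) \<or> idx (Suc g) = Suc (idx g)" by (auto simp: idx_def)
      moreover have "a i \<bullet> a j < 0" if "i \<in> ?I" "j \<in> ?I" "i = Suc j \<or> j = Suc i" for i j
        unfolding gram[OF that(1,2)] using that(3) by auto
      ultimately have "a (idx g) \<bullet> a (idx (Suc g)) < 0" by blast
      then show "gap e g \<bullet> gap e (Suc g) < 0" using gap[of g] gap[of "Suc g"] g by simp
    next
      fix g h assume "g \<in> {1..<2 * n}" "h \<in> {1..<2 * n}" "gap e g \<noteq> gap e h"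
      then show "gap e g \<bullet> gap e h \<le> 0" using a(6)[of "idx g" "idx h"] gap idx by metis
    next
      show "independent (gap e ` {1..<2 * n})" "span (gap e ` {1..<2 * n}) = UNIV" unfolding im by (fact a)+
      have "reflection ` gap e ` {1..<2 * n} = s ` ?I"
        unfolding im image_image by (rule image_cong) (use a(1) in auto)
      then show "finite (word_product ` lists (reflection ` gap e ` {1..<2 * n}))"
        using frg s(1) by (simp add: finite_reflection_group_def bij_betw_def)
    next
      fix g h assume "g \<in> {1..<2 * n}" "h \<in> {1..<2 * n}" "gap e g = gap e h"
      then show "h = g \<or> h = 2 * n - g" using gap_eq by metis
    next
      fix k assume "k \<in> {1..2 * n}"
      then show "e (2 * n + 1 - k) = - e k" by (rule e_neg)
    qed simp_all
    show ?thesis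
      by (rule chain_conclusion[OF ch im s(1) a(1) a(5) _ c])
        (use frg in \<open>auto simp: finite_reflection_group_def\<close>)
  qed
qed

theorem theorem2p12:
  fixes W :: "('a::euclidean_space \<Rightarrow> 'a) set" and D :: "'a set" and c :: "'a \<Rightarrow> 'a" and n :: nat
  assumes "DIM('a) = n"
    and "finite_reflection_group W D"
    and "has_coxeter_matrix (simple_reflections W D) n matrix_A \<or>
         has_coxeter_matrix (simple_reflections W D) n matrix_B"
    and "bipartite_coxeter_element (simple_reflections W D) c"
  shows "simplicial_fan (biCamb W D c) \<and>
         (\<forall>P. polytope P \<and> normal_fan P = biCamb W D c \<longrightarrow> simple_polytope P)"
proof -
  have fan: "simplicial_fan (biCamb W D c)"
    using assms simplicial_fan_A simplicial_fan_B by blast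
  have "simple_polytope P" if "polytope P" "normal_fan P = biCamb W D c" for P
    using that fan by (intro simple_polytope_if_normal_fan_simplicial) (auto simp: simplicial_fan_def)
  with fan show ?thesis by blast
qed

end
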